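(* Let $R$ be one of the chain rings $\mathbb{G}_4=\mathbb{Z}_4[X]/(X^2+X+1)$, $\mathbb{S}_4=\mathbb{F}_4[X]/(X^2)$, $\mathbb{T}_4=\mathbb{F}_4[X;a\mapsto a^2]/(X^2)$. Then (i) $\mathrm{m}_6(R)\le 84$, and (ii) $\mathrm{m}_6(R)<84$ if $R\ne\mathbb{G}_4$.
   Context: $\mathbb{F}_4[X;a\mapsto a^2]$ denotes the skew polynomial ring with commutation rule $Xa=a^2X$. For a finite chain ring $R$ of length $2$ with residue field $\mathbb{F}_q$, the projective Hjelmslev plane $\mathrm{PHG}(2,R)$ is the incidence structure whose points are the free rank-$1$ submodules of the right module $R_R^3$, whose lines are the free rank-$2$ submodules of $R_R^3$, with incidence given by inclusion. A projective $(k,n)$-arc is a set of $k$ points meeting every line in at most $n$ points. For $0\le n\le q^2+q$, $\mathrm{m}_n(R)$ denotes the largest $k$ such that a projective $(k,n)$-arc exists in $\mathrm{PHG}(2,R)$. *)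

theory Defs
  imports "HOL-Algebra.Ring"
begin

text \<open>F_4 = {0,1,a,a+1} encoded as 0,1,2,3 (bit pattern of coefficients w.r.t. basis 1,a),
  with a^2 = a + 1.  Addition is bitwise xor.\<close>

definition f4_add :: "nat \<Rightarrow> nat \<Rightarrow> nat" where
  "f4_add x y = [[0,1,2,3],[1,0,3,2],[2,3,0,1],[3,2,1,0]] ! x ! y"

definition f4_mul :: "nat \<Rightarrow> nat \<Rightarrow> nat" where
  "f4_mul x y = [[0,0,0,0],[0,1,2,3],[0,2,3,1],[0,3,1,2]] ! x ! y"

definition f4_frob :: "nat \<Rightarrow> nat" where
  "f4_frob x = [0,1,3,2] ! x"

text \<open>G_4 = Z_4[X]/(X^2+X+1): the pair (a,b) stands for a + b w with a,b \<in> Z_4 and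
  w^2 = -1 - w.\<close>
definition G4 :: "(nat \<times> nat) ring" where
  "G4 = \<lparr> carrier = {0..<4} \<times> {0..<4},
          mult = (\<lambda>(a,b) (c,d). ((a*c + 3*b*d) mod 4, (a*d + b*c + 3*b*d) mod 4)),
          one = (1,0),
          zero = (0,0),
          add = (\<lambda>(a,b) (c,d). ((a+c) mod 4, (b+d) mod 4)) \<rparr>"

text \<open>S_4 = F_4[X]/(X^2): the pair (a,b) stands for a + b X.\<close>
definition S4 :: "(nat \<times> nat) ring" where
  "S4 = \<lparr> carrier = {0..<4} \<times> {0..<4},
          mult = (\<lambda>(a,b) (c,d). (f4_mul a c, f4_add (f4_mul a d) (f4_mul b c))),
          one = (1,0),
          zero = (0,0),
          add = (\<lambda>(a,b) (c,d). (f4_add a c, f4_add b d)) \<rparr>"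

text \<open>T_4 = F_4[X; a \<mapsto> a^2]/(X^2) with X a = a^2 X: the pair (a,b) stands for a + b X, so
  (a + bX)(c + dX) = ac + (ad + b c^2) X.\<close>
definition T4 :: "(nat \<times> nat) ring" where
  "T4 = \<lparr> carrier = {0..<4} \<times> {0..<4},
          mult = (\<lambda>(a,b) (c,d). (f4_mul a c, f4_add (f4_mul a d) (f4_mul b (f4_frob c)))),
          one = (1,0),
          zero = (0,0),
          add = (\<lambda>(a,b) (c,d). (f4_add a c, f4_add b d)) \<rparr>"

definition vecs :: "('a, 'b) ring_scheme \<Rightarrow> nat \<Rightarrow> 'a list set" where
  "vecs R k = {v. length v = k \<and> set v \<subseteq> carrier R}"

definition vadd :: "('a, 'b) ring_scheme \<Rightarrow> 'a list \<Rightarrow> 'a list \<Rightarrow> 'a list" where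
  "vadd R u v = map2 (add R) u v"

definition vsmul :: "('a, 'b) ring_scheme \<Rightarrow> 'a list \<Rightarrow> 'a \<Rightarrow> 'a list" where
  "vsmul R v r = map (\<lambda>x. mult R x r) v"

definition vzero :: "('a, 'b) ring_scheme \<Rightarrow> 'a list" where
  "vzero R = replicate 3 (zero R)"

definition lincomb :: "('a, 'b) ring_scheme \<Rightarrow> 'a list list \<Rightarrow> 'a list \<Rightarrow> 'a list" where
  "lincomb R bs cs = foldr (\<lambda>(b, c) acc. vadd R (vsmul R b c) acc) (zip bs cs) (vzero R)"

definition right_submodule :: "('a, 'b) ring_scheme \<Rightarrow> 'a list set \<Rightarrow> bool" where
  "right_submodule R U \<longleftrightarrow> U \<subseteq> vecs R 3 \<and> vzero R \<in> U \<and>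
     (\<forall>u\<in>U. \<forall>v\<in>U. vadd R u v \<in> U) \<and> (\<forall>u\<in>U. \<forall>r\<in>carrier R. vsmul R u r \<in> U)"

text \<open>U is a free submodule of rank k of R_R^3: it has a basis of k vectors, i.e. the map
  (c_1,...,c_k) \<mapsto> b_1 c_1 + ... + b_k c_k is a bijection R^k \<rightarrow> U (it is automatically
  right R-linear, hence a module isomorphism R_R^k \<cong> U).\<close>
definition free_submodule :: "('a, 'b) ring_scheme \<Rightarrow> nat \<Rightarrow> 'a list set \<Rightarrow> bool" where
  "free_submodule R k U \<longleftrightarrow> right_submodule R U \<and>
     (\<exists>bs. length bs = k \<and> set bs \<subseteq> U \<and> bij_betw (lincomb R bs) (vecs R k) U)"

definition hpoints :: "('a, 'b) ring_scheme \<Rightarrow> 'a list set set" where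
  "hpoints R = {U. free_submodule R 1 U}"

definition hlines :: "('a, 'b) ring_scheme \<Rightarrow> 'a list set set" where
  "hlines R = {U. free_submodule R 2 U}"

definition proj_arc :: "('a, 'b) ring_scheme \<Rightarrow> nat \<Rightarrow> nat \<Rightarrow> 'a list set set \<Rightarrow> bool" where
  "proj_arc R k n K \<longleftrightarrow> K \<subseteq> hpoints R \<and> card K = k \<and>
     (\<forall>L\<in>hlines R. card {P\<in>K. P \<subseteq> L} \<le> n)"

definition max_arc :: "('a, 'b) ring_scheme \<Rightarrow> nat \<Rightarrow> nat" where
  "max_arc R n = Max {k. \<exists>K. proj_arc R k n K}"

end

theory Submission
  imports Defs
begin

text \<open>
  The plane has 21 neighbour classes of points and of lines, forming a projective plane of order 4;
  each class of 16 points is an affine plane of order 4, and so is, dually, each class of lines.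
  Suppose 84 points meet every line in at most 6 points, and let a point class contain 4 + d of
  them and a line class 20 + e. For a point class on a line class, the four lines through a
  common segment partition the other points of the line class, so a segment with c points satisfies
  4 c \<le> 8 + d - e. Together with the count of pairs inside a class this gives d \<le> 2 and leaves
  few possibilities for the line classes with e > 0. If one of them has a single class with d > 0,
  then at most two classes have d > 0, and counting the pairs of points in the classes with d = 0
  gives a contradiction; otherwise all of them have class sizes 5, 5, 5, 3, 3, which forces a line
  class with sizes 0, 5, 5, 5, 5, and that is impossible. Hence d = 0 throughout (so 85 points are
  impossible), and then every line meets the set in 2 or 6 points.

  In characteristic 2 the plane contains a subplane of order 4 with one point and one line in each
  class. The sum of the 21 line intersections is 84 + 4 m, where m is the number of its points in
  the set, but also 2 modulo 4.
\<close>

text \<open>Two quadratic counts meet exactly. Two points of a class share precisely one segment, so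
  over the five directions the squared segment counts of a class with n points add up to n^2 + 4 n,
  which is 32 for n = 4. Dually, five classes of four points on a line class have squared counts at
  most 32 in total. With 21 classes on both sides the bound is tight everywhere, and its equality
  case leaves only lines with 2 or 6 points. The obstacle is to reach d = 0 first. The segment
  inequality still allows classes with 5 or 6 points, but it makes them rigid: in every direction
  their segments carry 0, 1, 2, 2 or 0, 2, 2, 2 points. Against them works the slack 8 -
  \<open>Q\<close> of a four-point class, 8 in total over its five directions: a line class with e >
  0 takes 4 of it from each of its four-point classes, and line classes without large classes need a
  share as well. The final parity argument does not reach the Galois ring because its digits are not
  closed under addition: the carry shifts line labels, so that the zero labels no longer form a
  subplane.\<close>

lemma ex_other:
  assumes "2 \<le> card Y"
  shows "\<exists>y\<in>Y. x \<noteq> y"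
proof (rule ccontr)
  assume "\<not> ?thesis"
  then have "Y \<subseteq> {x}" by auto
  then have "card Y \<le> card {x}" by (rule card_mono[rotated]) simp
  then show False using assms by simp
qed

lemma sum_if_const:
  fixes m :: "'b :: semiring_1"
  assumes "finite S"
  shows "(\<Sum>x\<in>S. if R x then m else 0) = of_nat (card {x \<in> S. R x}) * m"
  unfolding sum.inter_filter[OF assms, symmetric] by (rule sum_constant)

lemma sum_tight:
  fixes F :: "'x \<Rightarrow> int"
  assumes "finite S" "\<And>x. x \<in> S \<Longrightarrow> F x \<le> m" "int (card S) * m \<le> (\<Sum>x\<in>S. F x)" "y \<in> S"
  shows "F y = m"
proof (rule ccontr)
  assume "F y \<noteq> m"
  then have "F y < m" using assms(2)[OF assms(4)] by simp
  then have "(\<Sum>x\<in>S. F x) < (\<Sum>x\<in>S. m)"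
    using assms by (intro sum_strict_mono_ex1) auto
  then show False using assms(3) by simp
qed

lemma nonpos_sum_zero:
  fixes F :: "'x \<Rightarrow> int"
  assumes "finite S" "\<And>x. x \<in> S \<Longrightarrow> F x \<le> 0" "0 \<le> (\<Sum>x\<in>S. F x)" "y \<in> S"
  shows "F y = 0"
  using sum_tight[of S F 0 y] assms by simp

section \<open>Weighted nets of order 4\<close>

datatype gf4 = F0 | F1 | Fw | Fv

lemma UNIV_gf4: "(UNIV :: gf4 set) = {F0, F1, Fw, Fv}"
  using gf4.exhaust by blast

instance gf4 :: finite
  by standard (simp add: UNIV_gf4)

lemma card_gf4: "card (UNIV :: gf4 set) = 4"
  by (simp add: UNIV_gf4)

lemma sum_gf4: "(\<Sum>v\<in>UNIV. h v) = h F0 + h F1 + h Fw + (h Fv :: 'a :: comm_monoid_add)"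
  by (simp add: UNIV_gf4 add.assoc)

lemma all_gf4: "(\<forall>v. Q v) \<longleftrightarrow> Q F0 \<and> Q F1 \<and> Q Fw \<and> Q Fv"
  by (metis gf4.exhaust)

lemma ex_gf4: "(\<exists>v. Q v) \<longleftrightarrow> Q F0 \<or> Q F1 \<or> Q Fw \<or> Q Fv"
  by (metis gf4.exhaust)

text \<open>An affine plane of order 4: B is its point set, X indexes the five parallel classes, and g i b is
  the label of the line of class i through b.\<close>
locale net4 =
  fixes X :: "'i set" and B :: "'b set" and g :: "'i \<Rightarrow> 'b \<Rightarrow> gf4"
  assumes card_X: "card X = 5"
    and card_B: "card B = 16"
    and sep: "\<lbrakk>i \<in> X; j \<in> X; i \<noteq> j; b \<in> B; b' \<in> B; g i b = g i b'; g j b = g j b'\<rbrakk> \<Longrightarrow> b = b'"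
begin

lemma finite_X [simp]: "finite X"
  using card_X by (intro card_ge_0_finite) simp

lemma finite_B [simp]: "finite B"
  using card_B by (intro card_ge_0_finite) simp

definition seg :: "'i \<Rightarrow> gf4 \<Rightarrow> 'b set" where
  "seg i v = {b \<in> B. g i b = v}"

lemma in_seg [simp]: "b \<in> seg i v \<longleftrightarrow> b \<in> B \<and> g i b = v"
  by (simp add: seg_def)

lemma finite_seg [simp]: "finite (seg i v)"
  by (simp add: seg_def)

text \<open>\<open>sep\<close> says only that lines of different directions meet at most once; as 16
  = 4 * 4, injectivity of the pair of labels is already bijectivity.\<close>

lemma bij_pair:
  assumes "i \<in> X" "j \<in> X" "i \<noteq> j"
  shows "bij_betw (\<lambda>b. (g i b, g j b)) B UNIV"
proof -
  have inj: "inj_on (\<lambda>b. (g i b, g j b)) B"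
    using sep[OF assms] by (auto intro!: inj_onI)
  have "card (UNIV :: (gf4 \<times> gf4) set) = card ((\<lambda>b. (g i b, g j b)) ` B)"
    by (simp add: card_image[OF inj] card_B card_gf4 flip: UNIV_Times_UNIV)
  then have "(\<lambda>b. (g i b, g j b)) ` B = UNIV"
    by (intro card_subset_eq) auto
  with inj show ?thesis by (simp add: bij_betw_def)
qed

lemma ex_point:
  assumes "i \<in> X" "j \<in> X" "i \<noteq> j"
  obtains b where "b \<in> B" "g i b = v" "g j b = v'"
proof -
  have "(v, v') \<in> (\<lambda>b. (g i b, g j b)) ` B"
    using bij_pair[OF assms] by (simp add: bij_betw_def)
  then show thesis using that by auto
qed

lemma bij_seg:
  assumes "i \<in> X" "j \<in> X" "i \<noteq> j"
  shows "bij_betw (g j) (seg i v) UNIV"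
  unfolding bij_betw_def
proof
  show "inj_on (g j) (seg i v)"
    using sep[OF assms] by (auto intro!: inj_onI)
  show "g j ` seg i v = UNIV"
    using ex_point[OF assms, of v] by (metis UNIV_eq_I image_eqI in_seg)
qed

lemma other_class:
  assumes "i \<in> X"
  obtains j where "j \<in> X" "j \<noteq> i"
  using that ex_other[of X i] card_X by auto

lemma card_seg: "i \<in> X \<Longrightarrow> card (seg i v) = 4"
  by (metis bij_seg bij_betw_same_card card_gf4 other_class)

lemma sum_seg_other:
  assumes "i \<in> X" "j \<in> X" "i \<noteq> j"
  shows "(\<Sum>b\<in>seg i v. h (g j b)) = (\<Sum>v\<in>UNIV. h v)"
  by (rule sum.reindex_bij_betw[OF bij_seg[OF assms]])

lemma sum_B_seg: "(\<Sum>b\<in>B. h b) = (\<Sum>v\<in>UNIV. \<Sum>b\<in>seg i v. h b)"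
  unfolding seg_def by (rule sum.group[symmetric]) auto

text \<open>The five lines through \<open>b\<close> have three further points each and share only
  \<open>b\<close>, so they cover all 15 other points.\<close>

lemma card_joining:
  assumes "b \<in> B" "b' \<in> B" "b \<noteq> b'"
  shows "card {i \<in> X. g i b = g i b'} = 1"
proof -
  let ?S = "\<lambda>i. seg i (g i b) - {b}"
  have "card (\<Union>i\<in>X. ?S i) = (\<Sum>i\<in>X. card (?S i))"
  proof (rule card_UN_disjoint)
    show "\<forall>i\<in>X. \<forall>j\<in>X. i \<noteq> j \<longrightarrow> ?S i \<inter> ?S j = {}"
      using sep assms(1) by fastforce
  qed simp_all
  also have "\<dots> = (\<Sum>i\<in>X. 3)"
    using assms(1) by (intro sum.cong) (auto simp: card_seg)
  also have "\<dots> = card (B - {b})"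
    using assms(1) by (simp add: card_X card_B)
  finally have "(\<Union>i\<in>X. ?S i) = B - {b}"
    by (intro card_subset_eq) auto
  then have "b' \<in> (\<Union>i\<in>X. ?S i)" using assms by simp
  then obtain i where i: "i \<in> X" "g i b = g i b'" by auto
  have "{i \<in> X. g i b = g i b'} = {i}"
    using i sep assms by auto
  then show ?thesis by simp
qed

lemma joined:
  assumes "b \<in> B" "b' \<in> B" "b \<noteq> b'"
  obtains i where "i \<in> X" "g i b = g i b'"
  using card_joining[OF assms] by (metis (mono_tags, lifting) card_1_singletonE mem_Collect_eq singletonI)

text \<open>Both sides count a direction together with an ordered pair from \<open>S\<close> having
  equal labels there: a repeated point counts in all five directions, two distinct points in
  one.\<close>

lemma sum_squares:
  assumes "S \<subseteq> B"
  shows "(\<Sum>i\<in>X. \<Sum>v\<in>UNIV. (int (card {b \<in> S. g i b = v}))\<^sup>2) = (int (card S))\<^sup>2 + 4 * int (card S)"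
proof -
  have fin: "finite S" using assms finite_B finite_subset by blast
  have "(\<Sum>v\<in>UNIV. (int (card {b \<in> S. g i b = v}))\<^sup>2)
      = (\<Sum>b\<in>S. \<Sum>b'\<in>S. if g i b = g i b' then 1 else 0)" for i
  proof -
    have "(\<Sum>b\<in>S. \<Sum>b'\<in>S. if g i b = g i b' then 1 else 0) = (\<Sum>b\<in>S. int (card {b' \<in> S. g i b' = g i b}))"
      using fin by (intro sum.cong) (auto simp: sum.If_cases Int_def eq_commute)
    also have "\<dots> = (\<Sum>v\<in>UNIV. \<Sum>b\<in>{b \<in> S. g i b = v}. int (card {b' \<in> S. g i b' = g i b}))"
      using fin by (intro sum.group[symmetric]) auto
    also have "\<dots> = (\<Sum>v\<in>UNIV. (int (card {b \<in> S. g i b = v}))\<^sup>2)"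
      by (intro sum.cong) (auto simp: power2_eq_square)
    finally show ?thesis by simp
  qed
  then have "(\<Sum>i\<in>X. \<Sum>v\<in>UNIV. (int (card {b \<in> S. g i b = v}))\<^sup>2)
     = (\<Sum>i\<in>X. \<Sum>b\<in>S. \<Sum>b'\<in>S. if g i b = g i b' then 1 else 0)"
    by simp
  also have "\<dots> = (\<Sum>b\<in>S. \<Sum>b'\<in>S. \<Sum>i\<in>X. if g i b = g i b' then 1 else 0)"
    by (simp add: sum.swap[of _ _ X])
  also have "\<dots> = (\<Sum>b\<in>S. \<Sum>b'\<in>S. if b = b' then 5 else 1)"
  proof (intro sum.cong refl)
    fix b b' assume "b \<in> S" "b' \<in> S"
    then show "(\<Sum>i\<in>X. if g i b = g i b' then 1 else 0) = (if b = b' then 5 else (1::int))"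
      using card_joining[of b b'] assms card_X by (auto simp: sum.If_cases Int_def)
  qed
  also have "\<dots> = (\<Sum>b\<in>S. int (card S) + 4)"
  proof (intro sum.cong refl)
    fix b assume "b \<in> S"
    have "(\<Sum>b'\<in>S. if b = b' then 5 else (1::int)) = (\<Sum>b'\<in>S. 1 + (if b = b' then 4 else 0))"
      by (intro sum.cong) auto
    also have "\<dots> = int (card S) + 4"
      using \<open>b \<in> S\<close> fin by (simp only: sum.distrib sum.delta) simp
    finally show "(\<Sum>b'\<in>S. if b = b' then 5 else (1::int)) = int (card S) + 4" .
  qed
  finally show ?thesis by (simp add: power2_eq_square algebra_simps)
qed

end

text \<open>Applied to a class of lines of the Hjelmslev plane: B consists of its 16 lines, X of the five
  point classes on it, and c i v counts the points of the arc in segment v of class i. Then D b is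
  the number of points that the line b lacks from 6.\<close>
locale weighted_net4 = net4 X B g
  for X :: "'i set" and B :: "'b set" and g :: "'i \<Rightarrow> 'b \<Rightarrow> gf4" +
  fixes c :: "'i \<Rightarrow> gf4 \<Rightarrow> int"
  assumes c_nonneg: "0 \<le> c i v"
    and weight_le: "b \<in> B \<Longrightarrow> (\<Sum>i\<in>X. c i (g i b)) \<le> 6"
begin

definition D :: "'b \<Rightarrow> int" where "D b = 6 - (\<Sum>i\<in>X. c i (g i b))"
definition u :: "'i \<Rightarrow> int" where "u i = (\<Sum>v\<in>UNIV. c i v)"
definition k :: int where "k = (\<Sum>i\<in>X. u i)"

lemma D_nonneg: "b \<in> B \<Longrightarrow> 0 \<le> D b"
  using weight_le by (simp add: D_def)

lemma D_le: "D b \<le> 6"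
  by (simp add: D_def sum_nonneg c_nonneg)

text \<open>The four lines on a segment of class \<open>i\<close> meet each other class in its four
  different segments, so they count every outside point once and the segment itself four times; 24
  is four times the arc bound 6.\<close>

lemma seg_sum:
  assumes "i \<in> X"
  shows "(\<Sum>b\<in>seg i v. D b) = 24 - k + u i - 4 * c i v"
proof -
  have "(\<Sum>b\<in>seg i v. \<Sum>j\<in>X. c j (g j b)) = (\<Sum>j\<in>X. \<Sum>b\<in>seg i v. c j (g j b))"
    by (rule sum.swap)
  also have "\<dots> = (\<Sum>b\<in>seg i v. c i (g i b)) + (\<Sum>j\<in>X-{i}. \<Sum>b\<in>seg i v. c j (g j b))"
    using assms by (simp add: sum.remove)
  also have "(\<Sum>b\<in>seg i v. c i (g i b)) = 4 * c i v"
    by (simp add: card_seg assms)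
  also have "(\<Sum>j\<in>X-{i}. \<Sum>b\<in>seg i v. c j (g j b)) = (\<Sum>j\<in>X-{i}. u j)"
    using assms by (intro sum.cong) (auto simp: u_def sum_seg_other)
  also have "\<dots> = k - u i"
    using assms by (simp add: k_def sum_diff1)
  finally show ?thesis
    by (simp add: D_def sum_subtractf card_seg assms)
qed

lemma c_le:
  assumes "i \<in> X"
  shows "4 * c i v \<le> 24 - k + u i"
proof -
  have "0 \<le> (\<Sum>b\<in>seg i v. D b)" by (intro sum_nonneg) (simp add: D_nonneg)
  then show ?thesis using seg_sum[OF assms, of v] by simp
qed

lemma D_le_seg:
  assumes "i \<in> X" "b \<in> B"
  shows "D b \<le> 24 - k + u i - 4 * c i (g i b)"
  using member_le_sum[of b "seg i (g i b)" D] seg_sum[OF assms(1), of "g i b"] assms(2) D_nonneg by simp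

lemma seg_sum_superset:
  assumes "i \<in> X" "T \<subseteq> seg i v" "\<And>b. b \<in> seg i v \<Longrightarrow> D b \<noteq> 0 \<Longrightarrow> b \<in> T"
  shows "(\<Sum>b\<in>T. D b) = 24 - k + u i - 4 * c i v"
  unfolding seg_sum[OF assms(1), symmetric] using assms(2,3)
  by (intro sum.mono_neutral_left) (simp, simp, blast)

section \<open>Nets containing classes with five or six points\<close>

definition six :: "'i \<Rightarrow> bool" where
  "six i \<longleftrightarrow> (\<exists>v0. \<forall>v. c i v = (if v = v0 then 0 else 2))"

definition five :: "'i \<Rightarrow> bool" where
  "five i \<longleftrightarrow> (\<exists>v0 v1. v0 \<noteq> v1 \<and> (\<forall>v. c i v = (if v = v0 then 0 else if v = v1 then 1 else 2)))"

lemma u_six: "six i \<Longrightarrow> u i = 6"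
  by (auto simp: six_def u_def sum_gf4 ex_gf4 all_gf4)

lemma u_five: "five i \<Longrightarrow> u i = 5"
  by (auto simp: five_def u_def sum_gf4 ex_gf4 all_gf4)

text \<open>For \<open>k = 22\<close> the lines on a segment with 2 points of a six lack nothing. So
  on the empty segment of \<open>i\<close> only the line that also passes through the empty segment
  of \<open>j\<close> can be deficient, and it would lack 8 points.\<close>

lemma not_two_sixes:
  assumes "k = 22" "i \<in> X" "j \<in> X" "i \<noteq> j" "six i" "six j"
  shows False
proof -
  obtain v where v: "\<And>x. c i x = (if x = v then 0 else 2)"
    using assms(5) by (auto simp: six_def)
  obtain v' where v': "\<And>x. c j x = (if x = v' then 0 else 2)"
    using assms(6) by (auto simp: six_def)
  obtain b where b: "b \<in> B" "g i b = v" "g j b = v'"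
    using ex_point[OF assms(2-4)] by blast
  have "(\<Sum>b\<in>{b}. D b) = 24 - k + u i - 4 * c i v"
  proof (rule seg_sum_superset[OF assms(2)])
    show "{b} \<subseteq> seg i v" using b by simp
    fix b' assume b': "b' \<in> seg i v" "D b' \<noteq> 0"
    have "g j b' = v'"
    proof (rule ccontr)
      assume "g j b' \<noteq> v'"
      then have "D b' \<le> 0"
        using D_le_seg[OF assms(3), of b'] b' u_six[OF assms(6)] assms(1) v' by simp
      then show False using b' D_nonneg[of b'] by simp
    qed
    then show "b' \<in> {b}" using sep[OF assms(2-4)] b b' by simp
  qed
  then have "D b = 8" using assms(1) v u_six[OF assms(5)] by simp
  then show False using D_le[of b] by simp
qed

text \<open>Two points agree in only one direction, so different directions use different pairs, and
  three points form only three pairs.\<close>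

lemma pigeonhole_pairs:
  assumes "S \<subseteq> B" "card S \<le> 3" "Y \<subseteq> X" "4 \<le> card Y"
    and pair: "\<And>x. x \<in> Y \<Longrightarrow> \<exists>b\<in>S. \<exists>b'\<in>S. b \<noteq> b' \<and> g x b = g x b'"
  shows False
proof -
  have fin: "finite S" using assms(1) finite_B finite_subset by blast
  obtain F where F: "\<forall>x\<in>Y. \<exists>b\<in>S. \<exists>b'\<in>S. F x = {b, b'} \<and> b \<noteq> b' \<and> g x b = g x b'"
    using bchoice[of Y "\<lambda>x T. \<exists>b\<in>S. \<exists>b'\<in>S. T = {b, b'} \<and> b \<noteq> b' \<and> g x b = g x b'"] pair
    by metis
  have inj: "inj_on F Y"
  proof (rule inj_onI, rule ccontr)
    fix x y assume xy: "x \<in> Y" "y \<in> Y" "F x = F y" "x \<noteq> y"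
    obtain b b' where b: "b \<in> S" "b' \<in> S" "F x = {b, b'}" "b \<noteq> b'" "g x b = g x b'"
      using bspec[OF F xy(1)] by auto
    obtain a a' where a: "F y = {a, a'}" "g y a = g y a'"
      using bspec[OF F xy(2)] by auto
    have "g y b = g y b'" using a b xy(3) by (auto simp: doubleton_eq_iff)
    then show False using sep[of x y b b'] b xy assms(1,3) by blast
  qed
  have "F ` Y \<subseteq> {T. T \<subseteq> S \<and> card T = 2}"
  proof (rule image_subsetI)
    fix x assume "x \<in> Y"
    then obtain b b' where "b \<in> S" "b' \<in> S" "F x = {b, b'}" "b \<noteq> b'" using F by force
    then show "F x \<in> {T. T \<subseteq> S \<and> card T = 2}" by simp
  qed
  then have "card Y \<le> card {T. T \<subseteq> S \<and> card T = 2}"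
    using card_image[OF inj] card_mono[of "{T. T \<subseteq> S \<and> card T = 2}" "F ` Y"] fin by simp
  also have "\<dots> = card S choose 2" using fin by (simp add: n_subsets)
  also have "\<dots> \<le> 3"
  proof -
    have "card S = 0 \<or> card S = 1 \<or> card S = 2 \<or> card S = 3" using assms(2) by linarith
    then show ?thesis by (auto simp: choose_two)
  qed
  finally show False using assms(4) by simp
qed

lemma total_D: "(\<Sum>b\<in>B. D b) = 96 - 4 * k"
proof -
  obtain i where "i \<in> X" using card_X by fastforce
  then have "(\<Sum>b\<in>B. D b) = (\<Sum>v\<in>UNIV. 24 - k + u i - 4 * c i v)"
    by (simp add: sum_B_seg[of _ i] seg_sum)
  also have "\<dots> = 96 - 4 * k" by (simp add: u_def sum_gf4)
  finally show ?thesis .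
qed

text \<open>The four lines on the empty segment of \<open>i\<close> lack 29 - k points together. Two
  of them meet \<open>j\<close> in segments with 2 points and lack at most 21 - k each;
  \<open>z\<close> and \<open>z'\<close>, which meet \<open>j\<close> in its segments with 0 and 1
  points, must lack the rest.\<close>

lemma fives_zero_segment:
  assumes "i \<in> X" "j \<in> X" "i \<noteq> j" "five i" "five j"
  obtains z z' where "z \<in> B" "z' \<in> B" "z \<noteq> z'" "g i z = g i z'" "c i (g i z) = 0"
    "29 - k \<le> D z + D z' + 2 * (21 - k)" "k = 21 \<Longrightarrow> D z + D z' = 8"
proof -
  obtain v0 v1 where v: "\<And>x. c i x = (if x = v0 then 0 else if x = v1 then 1 else 2)"
    using assms(4) by (auto simp: five_def)
  obtain w0 w1 where w: "w0 \<noteq> w1" "\<And>x. c j x = (if x = w0 then 0 else if x = w1 then 1 else 2)"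
    using assms(5) by (auto simp: five_def)
  obtain z where z: "z \<in> B" "g i z = v0" "g j z = w0" using ex_point[OF assms(1-3)] by blast
  obtain z' where z': "z' \<in> B" "g i z' = v0" "g j z' = w1" using ex_point[OF assms(1-3)] by blast
  have ne: "z \<noteq> z'" using z z' w(1) by auto
  have sub: "{z, z'} \<subseteq> seg i v0" using z z' by simp
  have small: "D b \<le> 21 - k" if "b \<in> seg i v0 - {z, z'}" for b
  proof -
    have "g j b \<noteq> w0" "g j b \<noteq> w1" using sep[OF assms(1-3)] z z' that by auto
    then show ?thesis using D_le_seg[OF assms(2), of b] that w(2) u_five[OF assms(5)] by simp
  qed
  have tot: "(\<Sum>b\<in>seg i v0. D b) = 29 - k" using seg_sum[OF assms(1), of v0] v u_five[OF assms(4)] by simp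
  have split: "(\<Sum>b\<in>seg i v0. D b) = (\<Sum>b\<in>seg i v0 - {z, z'}. D b) + (D z + D z')"
    using sum.subset_diff[OF sub, of D] ne by simp
  have "card (seg i v0 - {z, z'}) = 2"
    using sub ne by (simp add: card_Diff_subset card_seg assms(1))
  then have le: "(\<Sum>b\<in>seg i v0 - {z, z'}. D b) \<le> 2 * (21 - k)"
    using sum_bounded_above[of "seg i v0 - {z, z'}" D "21 - k"] small by simp
  have "0 \<le> (\<Sum>b\<in>seg i v0 - {z, z'}. D b)" by (intro sum_nonneg) (simp add: D_nonneg)
  then show thesis
    using that[of z z'] z z' ne v tot split le by simp
qed

text \<open>A class of weight 4 would be spread 1, 1, 1, 1, which caps every deficiency at 3,
  whereas two lines on the empty segment of a five lack 8 together.\<close>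

lemma two_fives_no_four:
  assumes "k = 21" "i \<in> X" "j \<in> X" "i \<noteq> j" "five i" "five j" "m \<in> X"
  shows "u m \<noteq> 4"
proof
  assume m: "u m = 4"
  obtain z z' where z: "z \<in> B" "z' \<in> B" "D z + D z' = 8"
    by (rule fives_zero_segment[OF assms(2-6)]) (use assms(1) in auto)
  have "c m v \<le> 1" for v using c_le[OF assms(7), of v] m assms(1) by simp
  from this[of F0] this[of F1] this[of Fw] this[of Fv]
  have "c m v = 1" for v using m by (cases v) (simp_all add: u_def sum_gf4)
  then have "D b \<le> 3" if "b \<in> B" for b using D_le_seg[OF assms(7) that] m assms(1) by simp
  from this[OF z(1)] this[OF z(2)] show False using z(3) by simp
qed

text \<open>The class of weight 1 caps deficiencies at 4, and their total is 96 - 84 = 12, so at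
  most three lines lack 4. Each five has two such lines on its empty segment; four fives would need
  four pairs among three lines.\<close>

lemma not_four_fives_and_one:
  assumes "k = 21" "Y \<subseteq> X" "card Y = 4" "\<And>y. y \<in> Y \<Longrightarrow> five y" "h \<in> X" "u h = 1"
  shows False
proof -
  have le: "D b \<le> 4" if "b \<in> B" for b
    using D_le_seg[OF assms(5) that] assms(1,6) c_nonneg[of h "g h b"] by simp
  let ?S = "{b \<in> B. D b = 4}"
  have "4 * int (card ?S) = (\<Sum>b\<in>?S. D b)" by simp
  also have "\<dots> \<le> (\<Sum>b\<in>B. D b)" by (intro sum_mono2) (auto simp: D_nonneg)
  finally have "card ?S \<le> 3" by (simp add: total_D assms(1))
  then show False
  proof (rule pigeonhole_pairs[rotated])
    fix x assume x: "x \<in> Y"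
    then obtain y where y: "y \<in> Y" "x \<noteq> y" using ex_other[of Y x] assms(3) by auto
    obtain z z' where "z \<in> B" "z' \<in> B" "z \<noteq> z'" "g x z = g x z'" "D z + D z' = 8"
      by (rule fives_zero_segment[of x y]) (use x y assms(1,2,4) in auto)
    moreover from this have "D z = 4" "D z' = 4" using le[of z] le[of z'] by auto
    ultimately show "\<exists>b\<in>?S. \<exists>b'\<in>?S. b \<noteq> b' \<and> g x b = g x b'" by blast
  qed (use assms in auto)
qed

text \<open>The same pigeonhole, with the lines that lack at least 3: deficiencies are at most 4,
  and the two lines on the empty segment of a five lack at least 9 - 2 = 7 together.\<close>

lemma not_four_fives_and_zero:
  assumes "k = 20" "Y \<subseteq> X" "card Y = 4" "\<And>y. y \<in> Y \<Longrightarrow> five y" "h \<in> X" "u h = 0"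
  shows False
proof -
  have le: "D b \<le> 4" if "b \<in> B" for b
    using D_le_seg[OF assms(5) that] assms(1,6) c_nonneg[of h "g h b"] by simp
  let ?S = "{b \<in> B. 3 \<le> D b}"
  have other: "\<exists>y\<in>Y. x \<noteq> y" for x
    using ex_other[of Y x] assms(3) by simp
  have big: "c y (g y b) \<noteq> 2" if "b \<in> ?S" "y \<in> Y" for b y
  proof
    assume "c y (g y b) = 2"
    moreover have "y \<in> X" "u y = 5" using that(2) assms(2,4) u_five by auto
    ultimately show False using D_le_seg[of y b] that(1) assms(1) by simp
  qed
  \<comment> \<open>Lines of \<open>?S\<close> avoid segments with 2 points, so two fives confine
    them to a 2 by 2 grid. The segment of \<open>x\<close> with one point lacks only 5 in total and
    carries at most one of them.\<close>
  have "card ?S \<le> 3"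
  proof -
    obtain x where x: "x \<in> Y" using assms(3) by fastforce
    obtain y where y: "y \<in> Y" "x \<noteq> y" using other by blast
    have xX: "x \<in> X" and yX: "y \<in> X" using x y assms(2) by auto
    obtain v0 v1 where v: "\<And>t. c x t = (if t = v0 then 0 else if t = v1 then 1 else 2)" "v0 \<noteq> v1"
      using assms(4)[OF x] by (auto simp: five_def)
    obtain w0 w1 where w: "\<And>t. c y t = (if t = w0 then 0 else if t = w1 then 1 else 2)" "w0 \<noteq> w1"
      using assms(4)[OF y(1)] by (auto simp: five_def)
    have "?S \<subseteq> {b \<in> ?S. g x b = v0} \<union> {b \<in> ?S. g x b = v1}"
      using big[OF _ x] v(1) by (force split: if_splits)
    then have "card ?S \<le> card {b \<in> ?S. g x b = v0} + card {b \<in> ?S. g x b = v1}"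
      by (intro order_trans[OF card_mono card_Un_le]) simp_all
    moreover have "card {b \<in> ?S. g x b = v0} \<le> 2"
    proof -
      have "inj_on (g y) {b \<in> ?S. g x b = v0}"
        using sep[OF xX yX y(2)] by (auto intro!: inj_onI)
      moreover have "g y ` {b \<in> ?S. g x b = v0} \<subseteq> {w0, w1}"
        using big[OF _ y(1)] w(1) by (force split: if_splits)
      ultimately show ?thesis using card_inj_on_le[of "g y" _ "{w0, w1}"] w(2) by fastforce
    qed
    moreover have "card {b \<in> ?S. g x b = v1} \<le> 1"
    proof -
      have "3 * int (card {b \<in> ?S. g x b = v1}) \<le> (\<Sum>b\<in>{b \<in> ?S. g x b = v1}. D b)"
        using sum_bounded_below[of "{b \<in> ?S. g x b = v1}" 3 D] by (simp add: mult.commute)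
      also have "\<dots> \<le> (\<Sum>b\<in>seg x v1. D b)" by (intro sum_mono2) (auto simp: D_nonneg)
      also have "\<dots> = 5" using seg_sum[OF xX, of v1] v u_five[OF assms(4)[OF x]] assms(1) by auto
      finally show ?thesis by simp
    qed
    ultimately show ?thesis by linarith
  qed
  then show False
  proof (rule pigeonhole_pairs[rotated])
    fix x assume x: "x \<in> Y"
    then obtain y where y: "y \<in> Y" "x \<noteq> y" using other by blast
    obtain z z' where "z \<in> B" "z' \<in> B" "z \<noteq> z'" "g x z = g x z'" "29 - k \<le> D z + D z' + 2 * (21 - k)"
      by (rule fives_zero_segment[of x y]) (use x y assms(2,4) in auto)
    moreover from this have "3 \<le> D z" "3 \<le> D z'" using le[of z] le[of z'] assms(1) by auto
    ultimately show "\<exists>b\<in>?S. \<exists>b'\<in>?S. b \<noteq> b' \<and> g x b = g x b'" by blast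
  qed (use assms in auto)
qed

section \<open>Squared segment counts in nets of four-point classes\<close>

definition q :: "'i \<Rightarrow> int" where "q i = (\<Sum>v\<in>UNIV. (c i v)\<^sup>2)"

definition half :: "'i \<Rightarrow> bool" where
  "half i \<longleftrightarrow> (\<exists>x y. x \<noteq> y \<and> (\<forall>v. c i v = (if v = x \<or> v = y then 0 else 2)))"

definition mixed :: "'i \<Rightarrow> bool" where
  "mixed i \<longleftrightarrow> (\<exists>x y. x \<noteq> y \<and> (\<forall>v. c i v = (if v = x then 0 else if v = y then 2 else 1)))"

lemma u_gf4: "u i = c i F0 + c i F1 + c i Fw + c i Fv"
  by (simp add: u_def sum_gf4)

text \<open>The partitions of 4 into four parts of size at most 2 are 1+1+1+1, 0+1+1+2 and
  0+0+2+2.\<close>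

lemma four_pattern:
  assumes "u i = 4" "\<And>v. c i v \<le> 2"
  shows "(\<forall>v. c i v = 1) \<and> q i = 4 \<or> mixed i \<and> q i = 6 \<or> half i \<and> q i = 8"
proof -
  have *: "c i v = 0 \<or> c i v = 1 \<or> c i v = 2" for v
    using c_nonneg[of i v] assms(2)[of v] by linarith
  show ?thesis
    using *[of F0] *[of F1] *[of Fw] *[of Fv] assms(1)
    unfolding u_gf4 q_def sum_gf4 half_def mixed_def ex_gf4 all_gf4
    by (elim disjE) simp_all
qed

lemma four_full:
  assumes "u i = 4" "\<And>v. c i v \<le> 1"
  shows "c i v = 1"
  using assms(1) assms(2)[of F0] assms(2)[of F1] assms(2)[of Fw] assms(2)[of Fv]
  by (cases v) (simp_all add: u_gf4)

text \<open>Lines on a segment with 2 points lack nothing, so all deficiency sits on the four lines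
  over the empty segments of \<open>i\<close> and \<open>j\<close>, a 2 by 2 grid. An empty segment
  of a further class must contain a diagonal of this grid; each diagonal has only one direction, so
  the three further classes have squares at most 3 * 4 + 2 + 2.\<close>

lemma two_halves:
  assumes k: "k = 20" and u4: "\<And>i. i \<in> X \<Longrightarrow> u i = 4"
    and ij: "i \<in> X" "j \<in> X" "i \<noteq> j" "half i" "half j"
  shows "(\<Sum>m\<in>X. q m) \<le> 32 \<and> (\<forall>b\<in>B. D b = 0 \<or> D b = 4)"
proof -
  have c2: "c m v \<le> 2" if "m \<in> X" for m v using c_le[OF that, of v] k u4[OF that] by simp
  have full_seg: "D b = 0" if "m \<in> X" "b \<in> B" "c m (g m b) = 2" for m b
    using D_le_seg[OF that(1,2)] D_nonneg[OF that(2)] that k u4[OF that(1)] by simp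
  obtain x y where x: "x \<noteq> y" "\<And>v. c i v = (if v = x \<or> v = y then 0 else 2)"
    using ij(4) by (auto simp: half_def)
  obtain x' y' where x': "x' \<noteq> y'" "\<And>v. c j v = (if v = x' \<or> v = y' then 0 else 2)"
    using ij(5) by (auto simp: half_def)
  obtain z1 where z1: "z1 \<in> B" "g i z1 = x" "g j z1 = x'" using ex_point[OF ij(1-3)] by blast
  obtain z2 where z2: "z2 \<in> B" "g i z2 = x" "g j z2 = y'" using ex_point[OF ij(1-3)] by blast
  obtain z3 where z3: "z3 \<in> B" "g i z3 = y" "g j z3 = x'" using ex_point[OF ij(1-3)] by blast
  obtain z4 where z4: "z4 \<in> B" "g i z4 = y" "g j z4 = y'" using ex_point[OF ij(1-3)] by blast
  note z = z1 z2 z3 z4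
  have dist: "z1 \<noteq> z2" "z1 \<noteq> z3" "z1 \<noteq> z4" "z2 \<noteq> z3" "z2 \<noteq> z4" "z3 \<noteq> z4"
    using z x(1) x'(1) by auto
  have supp: "b \<in> {z1, z2, z3, z4}" if "b \<in> B" "D b \<noteq> 0" for b
  proof -
    have "g i b = x \<or> g i b = y" using full_seg[OF ij(1) that(1)] that(2) x(2)[of "g i b"] by presburger
    moreover have "g j b = x' \<or> g j b = y'" using full_seg[OF ij(2) that(1)] that(2) x'(2)[of "g j b"] by presburger
    ultimately show ?thesis using sep[OF ij(1-3) that(1)] z by auto
  qed
  have seg8: "(\<Sum>b\<in>{b \<in> {z1, z2, z3, z4}. g m b = v}. D b) = 8 - 4 * c m v" if "m \<in> X" for m v
  proof -
    have "(\<Sum>b\<in>{b \<in> {z1, z2, z3, z4}. g m b = v}. D b) = 24 - k + u m - 4 * c m v"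
      by (rule seg_sum_superset[OF that]) (use supp z in auto)
    then show ?thesis using k u4[OF that] by simp
  qed
  have sets: "{b \<in> {z1, z2, z3, z4}. g i b = x} = {z1, z2}" "{b \<in> {z1, z2, z3, z4}. g i b = y} = {z3, z4}"
    "{b \<in> {z1, z2, z3, z4}. g j b = x'} = {z1, z3}"
    using z x(1) x'(1) by auto
  \<comment> \<open>Opposite corners thus lack equally many points, and a diagonal on an empty
    segment has to split 8 as 4 + 4.\<close>
  have D12: "D z1 + D z2 = 8" "D z3 + D z4 = 8" "D z1 + D z3 = 8"
    using seg8[OF ij(1), of x] seg8[OF ij(1), of y] seg8[OF ij(2), of x'] dist x(2) x'(2)
    unfolding sets by simp_all
  have zero_seg: "g m z1 = v \<and> g m z4 = v \<and> D z1 = 4 \<or> g m z2 = v \<and> g m z3 = v \<and> D z2 = 4"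
    if m: "m \<in> X" "m \<noteq> i" "m \<noteq> j" and cv: "c m v = 0" for m v
  proof -
    have adj: "g m z1 \<noteq> g m z2" "g m z3 \<noteq> g m z4" "g m z1 \<noteq> g m z3" "g m z2 \<noteq> g m z4"
      using sep[of i m] sep[of j m] m ij z dist by metis+
    have s: "(\<Sum>b\<in>{b \<in> {z1, z2, z3, z4}. g m b = v}. D b) = 8" using seg8[OF m(1), of v] cv by simp
    consider "g m z1 = v" "g m z4 = v" | "g m z2 = v" "g m z3 = v"
      | b where "\<forall>b'\<in>{z1, z2, z3, z4}. g m b' = v \<longrightarrow> b' = b"
    proof -
      have "g m z1 = v \<and> g m z4 = v \<or> g m z2 = v \<and> g m z3 = v
          \<or> (\<exists>b. \<forall>b'\<in>{z1, z2, z3, z4}. g m b' = v \<longrightarrow> b' = b)"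
        by (cases "g m z1 = v"; cases "g m z2 = v"; cases "g m z3 = v"; cases "g m z4 = v") (use adj in auto)
      then show thesis using that by blast
    qed
    then show ?thesis
    proof cases
      case 1
      then have "{b \<in> {z1, z2, z3, z4}. g m b = v} = {z1, z4}" using adj by auto
      then show ?thesis using s dist D12 1 by simp
    next
      case 2
      then have "{b \<in> {z1, z2, z3, z4}. g m b = v} = {z2, z3}" using adj by auto
      then show ?thesis using s dist D12 2 by simp
    next
      \<comment> \<open>A single line lacks at most 6, but an empty segment lacks 8.\<close>
      case (3 b)
      then have "{b \<in> {z1, z2, z3, z4}. g m b = v} \<subseteq> {b}" by blast
      then have "(\<Sum>b\<in>{b \<in> {z1, z2, z3, z4}. g m b = v}. D b) \<le> 6"
        unfolding subset_singleton_iff using D_le[of b] by (elim disjE) (simp_all only: sum.empty sum.insert, simp_all)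
      then show ?thesis using s by simp
    qed
  qed
  have pat: "(\<forall>v. c m v = 1) \<and> q m = 4 \<or> mixed m \<and> q m = 6 \<or> half m \<and> q m = 8" if "m \<in> X" for m
    using four_pattern[OF u4 c2] that by blast
  have q_le: "q m \<le> 4 + (if g m z1 = g m z4 then 2 else 0) + (if g m z2 = g m z3 then 2 else 0)"
    if m: "m \<in> X - {i, j}" for m
  proof -
    have mX: "m \<in> X" "m \<noteq> i" "m \<noteq> j" using m by auto
    from pat[OF mX(1)] show ?thesis
    proof (elim disjE conjE)
      assume "mixed m" "q m = 6"
      then obtain v where "c m v = 0" unfolding mixed_def by metis
      then show ?thesis using zero_seg[OF mX, of v] \<open>q m = 6\<close> by auto
    next
      assume "half m" "q m = 8"
      then obtain v v' where "v \<noteq> v'" "c m v = 0" "c m v' = 0" unfolding half_def by metis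
      then have "g m z1 = g m z4" "g m z2 = g m z3"
        using zero_seg[OF mX, of v] zero_seg[OF mX, of v'] by metis+
      then show ?thesis using \<open>q m = 8\<close> by simp
    qed simp
  qed
  have cardX': "card (X - {i, j}) = 3" using ij card_X by (simp add: card_Diff_subset)
  have one: "(\<Sum>m\<in>X - {i, j}. if g m z = g m z' then 2 else (0::int)) \<le> 2"
    if "z \<in> B" "z' \<in> B" "z \<noteq> z'" for z z'
  proof -
    have "(\<Sum>m\<in>X - {i, j}. if g m z = g m z' then 2 else (0::int)) \<le> (\<Sum>m\<in>X. if g m z = g m z' then 2 else 0)"
      by (intro sum_mono2) auto
    also have "\<dots> = 2 * int (card {m \<in> X. g m z = g m z'})"
      by (simp add: sum.If_cases Int_def)
    finally show ?thesis using card_joining[OF that] by simp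
  qed
  have "(\<Sum>m\<in>X - {i, j}. q m) \<le> (\<Sum>m\<in>X - {i, j}. 4 + (if g m z1 = g m z4 then 2 else 0) + (if g m z2 = g m z3 then 2 else 0))"
    by (rule sum_mono) (rule q_le)
  also have "\<dots> \<le> 16"
    using one[OF z1(1) z4(1) dist(3)] one[OF z2(1) z3(1) dist(4)] cardX' by (simp add: sum.distrib)
  finally have "(\<Sum>m\<in>X - {i, j}. q m) \<le> 16" .
  moreover have "(\<Sum>m\<in>X. q m) = (\<Sum>m\<in>X - {i, j}. q m) + (q i + q j)"
    using sum.subset_diff[of "{i, j}" X q] ij by simp
  moreover have "q i \<le> 8" "q j \<le> 8" using pat[OF ij(1)] pat[OF ij(2)] by auto
  ultimately have le: "(\<Sum>m\<in>X. q m) \<le> 32" by linarith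
  \<comment> \<open>A third class fixes the corners: spread 1, 1, 1, 1 it caps each deficiency at 4,
    and otherwise one of its empty segments contains a diagonal.\<close>
  obtain m where m: "m \<in> X" "m \<noteq> i" "m \<noteq> j"
    using cardX' by (metis Diff_iff card.empty ex_in_conv insertCI zero_neq_numeral)
  have "D z1 = 4"
    using pat[OF m(1)]
  proof (elim disjE conjE)
    assume "\<forall>v. c m v = 1"
    then have "D b \<le> 4" if "b \<in> B" for b using D_le_seg[OF m(1) that] k u4[OF m(1)] by simp
    from this[OF z1(1)] this[OF z2(1)] show ?thesis using D12 by simp
  next
    assume "mixed m"
    then obtain v where "c m v = 0" unfolding mixed_def by metis
    then show ?thesis using zero_seg[OF m, of v] D12 by auto
  next
    assume "half m"
    then obtain v where "c m v = 0" unfolding half_def by metis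
    then show ?thesis using zero_seg[OF m, of v] D12 by auto
  qed
  then have "D b = 4" if "b \<in> {z1, z2, z3, z4}" for b using D12 that by auto
  then have "\<forall>b\<in>B. D b = 0 \<or> D b = 4" using supp by blast
  with le show ?thesis by blast
qed

text \<open>Without a \<open>half\<close> class the squares reach at most 5 * 6, with one of them at
  most 8 + 4 * 6. Equality outside \<open>two_halves\<close> thus means one \<open>half\<close> and
  four \<open>mixed\<close> classes, and then comparing lines over the two empty segments of the
  \<open>half\<close> class yields the deficiencies.\<close>

lemma all_four:
  assumes k: "k = 20" and u4: "\<And>i. i \<in> X \<Longrightarrow> u i = 4"
  shows "(\<Sum>m\<in>X. q m) \<le> 32" and "(\<Sum>m\<in>X. q m) = 32 \<Longrightarrow> b \<in> B \<Longrightarrow> D b = 0 \<or> D b = 4"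
proof -
  have c2: "c m v \<le> 2" if "m \<in> X" for m v using c_le[OF that, of v] k u4[OF that] by simp
  have pat: "(\<forall>v. c m v = 1) \<and> q m = 4 \<or> mixed m \<and> q m = 6 \<or> half m \<and> q m = 8" if "m \<in> X" for m
    using four_pattern[OF u4 c2] that by blast
  have "(\<Sum>m\<in>X. q m) \<le> 32 \<and> ((\<Sum>m\<in>X. q m) = 32 \<longrightarrow> (\<forall>b\<in>B. D b = 0 \<or> D b = 4))"
  proof (cases "\<exists>i\<in>X. \<exists>j\<in>X. i \<noteq> j \<and> half i \<and> half j")
    case True
    then show ?thesis using two_halves[OF k u4] by blast
  next
    case False
    show ?thesis
    proof (cases "\<exists>h\<in>X. half h")
      case False
      then have "q m \<le> 6" if "m \<in> X" for m using pat[OF that] that by auto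
      then have "(\<Sum>m\<in>X. q m) \<le> 30" using sum_bounded_above[of X q 6] card_X by simp
      then show ?thesis by simp
    next
      case True
      then obtain h where h: "h \<in> X" "half h" by blast
      have nh: "\<not> half m" if "m \<in> X - {h}" for m using False h that by blast
      have q6: "q m \<le> 6" if "m \<in> X - {h}" for m using pat[of m] nh[OF that] that by auto
      have cX: "card (X - {h}) = 4" using h card_X by simp
      have sX: "(\<Sum>m\<in>X. q m) = q h + (\<Sum>m\<in>X - {h}. q m)" using h by (simp add: sum.remove)
      have qh: "q h \<le> 8" using pat[OF h(1)] by auto
      have le24: "(\<Sum>m\<in>X - {h}. q m) \<le> 24" using sum_bounded_above[of "X - {h}" q 6] q6 cX by simp
      show ?thesis
      proof (intro conjI impI ballI)
        show "(\<Sum>m\<in>X. q m) \<le> 32" using sX qh le24 by simp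
      next
        fix b assume eq: "(\<Sum>m\<in>X. q m) = 32" and b: "b \<in> B"
        have mixed: "mixed m" if m: "m \<in> X - {h}" for m
        proof (rule ccontr)
          assume "\<not> mixed m"
          then have "q m = 4" using pat[of m] nh[OF m] m by auto
          moreover have "(\<Sum>m\<in>X - {h} - {m}. q m) \<le> 18"
            using sum_bounded_above[of "X - {h} - {m}" q 6] q6 cX m by simp
          ultimately have "(\<Sum>m\<in>X - {h}. q m) \<le> 22" using m by (simp add: sum.remove)
          then show False using eq sX qh by simp
        qed
        obtain x y where x: "x \<noteq> y" "\<And>v. c h v = (if v = x \<or> v = y then 0 else 2)"
          using h(2) by (auto simp: half_def)
        have supp: "g h b' = x \<or> g h b' = y" if "b' \<in> B" "D b' \<noteq> 0" for b'
          using D_le_seg[OF h(1) that(1)] D_nonneg[OF that(1)] that(2) k u4[OF h(1)] x(2)[of "g h b'"] by (auto split: if_splits)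
        have pair: "D b1 + D b2 = 8 - 4 * c m (g m b1)"
          if m: "m \<in> X - {h}" and b12: "b1 \<in> B" "b2 \<in> B" "g h b1 = x" "g h b2 = y" "g m b1 = g m b2" for m b1 b2
        proof -
          have mX: "m \<in> X" "m \<noteq> h" using m by auto
          have "(\<Sum>b\<in>{b1, b2}. D b) = 24 - k + u m - 4 * c m (g m b1)"
          proof (rule seg_sum_superset[OF mX(1)])
            fix b' assume "b' \<in> seg m (g m b1)" "D b' \<noteq> 0"
            then show "b' \<in> {b1, b2}" using supp[of b'] sep[OF mX(1) h(1) mX(2)] b12 by auto
          qed (use b12 in auto)
          moreover have "b1 \<noteq> b2" using b12 x(1) by auto
          ultimately show ?thesis using k u4[OF mX(1)] by simp
        qed
        have cval: "c m v = 0 \<or> c m v = 1 \<or> c m v = 2" if "m \<in> X" for m v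
          using c_nonneg[of m v] c2[OF that, of v] by linarith
        \<comment> \<open>Lines over different segments of \<open>h\<close> share a segment of
          another class. They are its only possibly deficient lines, and the segment lacks 8, 4 or
          0.\<close>
        have sums: "D b1 + D b2 \<in> {0, 4, 8}" if b12: "b1 \<in> B" "b2 \<in> B" "g h b1 = x" "g h b2 = y" for b1 b2
        proof -
          have "b1 \<noteq> b2" using b12 x(1) by auto
          then obtain m where m: "m \<in> X" "g m b1 = g m b2" using joined[OF b12(1,2)] by blast
          then have "m \<noteq> h" using b12 x(1) by auto
          then show ?thesis using pair[of m b1 b2] m b12 cval[OF m(1), of "g m b1"] by auto
        qed
        \<comment> \<open>A segment with 2 points of a \<open>mixed\<close> class supplies a line
          lacking nothing over each empty segment of \<open>h\<close>. Paired with it, any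
          deficiency becomes 0, 4 or 8, and 8 exceeds the maximum 6.\<close>
        obtain m where m: "m \<in> X" "m \<noteq> h" using other_class[OF h(1)] by blast
        have "mixed m" using mixed m by simp
        then obtain v where v: "c m v = 2" unfolding mixed_def by metis
        obtain b1 where b1: "b1 \<in> B" "g m b1 = v" "g h b1 = x" using ex_point[OF m(1) h(1) m(2)] by blast
        obtain b2 where b2: "b2 \<in> B" "g m b2 = v" "g h b2 = y" using ex_point[OF m(1) h(1) m(2)] by blast
        have "D b1 + D b2 = 0" using pair[of m b1 b2] m b1 b2 v by simp
        then have z: "D b1 = 0" "D b2 = 0" using D_nonneg[OF b1(1)] D_nonneg[OF b2(1)] by auto
        show "D b = 0 \<or> D b = 4"
        proof (rule ccontr)
          assume n: "\<not> (D b = 0 \<or> D b = 4)"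
          then have "g h b = x \<or> g h b = y" using supp[OF b] by auto
          then show False
            using sums[OF b b2(1) _ b2(3)] sums[OF b1(1) b b1(3)] z n D_le[of b] by auto
        qed
      qed
    qed
  qed
  then show "(\<Sum>m\<in>X. q m) \<le> 32" and "(\<Sum>m\<in>X. q m) = 32 \<Longrightarrow> b \<in> B \<Longrightarrow> D b = 0 \<or> D b = 4" by blast+
qed

text \<open>Exceeding 28 with summands 4, 6, 8 means four \<open>half\<close> classes, or three and
  a \<open>mixed\<close> one. A line on a segment with 2 points of these has weight 5 or 6, and
  \<open>half\<close> classes contribute even numbers; this fixes the contributions on a segment of
  \<open>h\<close> modulo 6 or modulo 4, against their known sum.\<close>

lemma four_fours_and_three:
  assumes k: "k = 19" and h: "h \<in> X" "u h = 3" and u4: "\<And>i. i \<in> X - {h} \<Longrightarrow> u i = 4"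
  shows "(\<Sum>i\<in>X - {h}. q i) \<le> 28"
proof (rule ccontr)
  assume big: "\<not> ?thesis"
  have cX: "card (X - {h}) = 4" using h card_X by simp
  have c2: "c m v \<le> 2" if "m \<in> X - {h}" for m v using c_le[of m v] k u4[OF that] that by simp
  have ch2: "c h v \<le> 2" for v using c_le[OF h(1), of v] k h(2) by simp
  have pat: "(\<forall>v. c m v = 1) \<and> q m = 4 \<or> mixed m \<and> q m = 6 \<or> half m \<and> q m = 8" if "m \<in> X - {h}" for m
    using four_pattern[OF u4 c2] that by blast
  have q8: "q m \<le> 8" if "m \<in> X - {h}" for m using pat[OF that] by auto
  have two: "5 \<le> (\<Sum>i\<in>X. c i (g i b))" if "m \<in> X - {h}" "b \<in> B" "c m (g m b) = 2" for m b
    using D_le_seg[of m b] that k u4[OF that(1)] by (simp add: D_def)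
  have w_split: "(\<Sum>i\<in>X. c i (g i b)) = c h (g h b) + (\<Sum>i\<in>X - {h}. c i (g i b))" for b
    using h(1) by (simp add: sum.remove)
  have sum_over_seg: "(\<Sum>b\<in>seg h v. \<Sum>i\<in>Y. c i (g i b)) = 4 * int (card Y)" if "Y \<subseteq> X - {h}" for v Y
  proof -
    have "(\<Sum>b\<in>seg h v. \<Sum>i\<in>Y. c i (g i b)) = (\<Sum>i\<in>Y. \<Sum>b\<in>seg h v. c i (g i b))" by (rule sum.swap)
    also have "\<dots> = (\<Sum>i\<in>Y. 4)"
    proof (rule sum.cong)
      fix i assume "i \<in> Y"
      then have "i \<in> X - {h}" using that by blast
      then show "(\<Sum>b\<in>seg h v. c i (g i b)) = 4"
        using u4[of i] h(1) sum_seg_other[of h i "c i" v] by (auto simp: u_def)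
    qed simp
    finally show ?thesis by simp
  qed
  show False
  proof (cases "\<forall>m\<in>X - {h}. half m")
    case True
    \<comment> \<open>Three points leave a segment of \<open>h\<close> empty. Each line on it gets 0
      or 6 points from the \<open>half\<close> classes, but the four lines get 4 * 4 = 16 in
      total.\<close>
    obtain v where v: "c h v = 0"
    proof -
      have "\<exists>v. c h v = 0"
        using h(2) c_nonneg[of h F0] c_nonneg[of h F1] c_nonneg[of h Fw] c_nonneg[of h Fv]
        unfolding u_gf4 ex_gf4 by linarith
      then show thesis using that by blast
    qed
    have "6 dvd (\<Sum>i\<in>X - {h}. c i (g i b))" if b: "b \<in> seg h v" for b
    proof (cases "\<exists>m\<in>X - {h}. c m (g m b) = 2")
      case False
      have "c i (g i b) = 0" if "i \<in> X - {h}" for i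
        using False True that unfolding half_def by (metis)
      then show ?thesis by simp
    next
      case ex: True
      have "even (c i (g i b))" if "i \<in> X - {h}" for i
        using True that unfolding half_def by (metis dvd_0_right dvd_refl)
      then have "even (\<Sum>i\<in>X - {h}. c i (g i b))" by (rule dvd_sum)
      moreover obtain m where "m \<in> X - {h}" "c m (g m b) = 2" using ex by (rule bexE)
      then have "5 \<le> (\<Sum>i\<in>X - {h}. c i (g i b))" using two[of m b] w_split[of b] b v by simp
      moreover have "(\<Sum>i\<in>X - {h}. c i (g i b)) \<le> 6" using weight_le[of b] w_split[of b] b v by simp
      ultimately have "(\<Sum>i\<in>X - {h}. c i (g i b)) = 6" by presburger
      then show ?thesis by simp
    qed
    then have "6 dvd (\<Sum>b\<in>seg h v. \<Sum>i\<in>X - {h}. c i (g i b))" by (rule dvd_sum)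
    then show False using sum_over_seg[of "X - {h}" v] cX by simp
  next
    case False
    then obtain t where t: "t \<in> X - {h}" "\<not> half t" by blast
    have sp: "(\<Sum>i\<in>X - {h}. q i) = q t + (\<Sum>i\<in>X - {h} - {t}. q i)" using t by (simp add: sum.remove)
    have cY: "card (X - {h} - {t}) = 3" using cX t by simp
    have "(\<Sum>i\<in>X - {h} - {t}. q i) \<le> 24"
      using sum_bounded_above[of "X - {h} - {t}" q 8] q8 cY by simp
    then have mt: "mixed t" "q t = 6" using pat[OF t(1)] t(2) sp big by auto
    have hY: "half m" if m: "m \<in> X - {h} - {t}" for m
    proof (rule ccontr)
      assume "\<not> half m"
      then have "q m \<le> 6" using pat[of m] m by auto
      moreover have "(\<Sum>i\<in>X - {h} - {t} - {m}. q i) \<le> 16"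
        using sum_bounded_above[of "X - {h} - {t} - {m}" q 8] q8 cY m by simp
      ultimately show False using sp mt(2) big m by (simp add: sum.remove)
    qed
    \<comment> \<open>Three points, at most 2 on a segment, leave some segment with exactly one. On
      it the \<open>half\<close> classes give 2 points to the line through the segment of
      \<open>t\<close> with 2 points, and 0 or 4 to the other lines, but 12 in total.\<close>
    obtain v where v: "c h v = 1"
    proof -
      have *: "c h v = 0 \<or> c h v = 1 \<or> c h v = 2" for v
        using c_nonneg[of h v] ch2[of v] by linarith
      have "\<exists>v. c h v = 1"
        using h(2) *[of F0] *[of F1] *[of Fw] *[of Fv] unfolding u_gf4 ex_gf4 by linarith
      then show thesis using that by blast
    qed
    obtain x y where xy: "x \<noteq> y" "\<And>v. c t v = (if v = x then 0 else if v = y then 2 else 1)"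
      using mt(1) by (auto simp: mixed_def)
    let ?x = "\<lambda>b. \<Sum>i\<in>X - {h} - {t}. c i (g i b)"
    have "4 dvd ?x b - (if c t (g t b) = 2 then 2 else 0)" if b: "b \<in> seg h v" for b
    proof -
      have w: "(\<Sum>i\<in>X. c i (g i b)) = 1 + c t (g t b) + ?x b"
        using w_split[of b] t b v by (simp add: sum.remove)
      have le6: "1 + c t (g t b) + ?x b \<le> 6" using weight_le[of b] w b by simp
      have ev: "even (?x b)"
        by (rule dvd_sum) (use hY in \<open>unfold half_def, metis dvd_0_right dvd_refl\<close>)
      show ?thesis
      proof (cases "c t (g t b) = 2")
        case True
        then have "?x b = 2" using two[OF t(1), of b] b w le6 ev by auto
        then show ?thesis using True by simp
      next
        case ct: False
        show ?thesis
        proof (cases "\<exists>m\<in>X - {h} - {t}. c m (g m b) = 2")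
          case False
          have "c i (g i b) = 0" if "i \<in> X - {h} - {t}" for i
            using False hY[OF that] that unfolding half_def by metis
          then show ?thesis using ct by simp
        next
          case True
          then obtain m where "m \<in> X - {h} - {t}" "c m (g m b) = 2" by (rule bexE)
          then have "5 \<le> 1 + c t (g t b) + ?x b" using two[of m b] b w by simp
          moreover have "c t (g t b) = 0 \<or> c t (g t b) = 1" using xy(2) ct by (auto split: if_splits)
          ultimately have "?x b = 4" using le6 ev by presburger
          then show ?thesis using ct by simp
        qed
      qed
    qed
    then have "4 dvd (\<Sum>b\<in>seg h v. ?x b - (if c t (g t b) = 2 then 2 else 0))" by (rule dvd_sum)
    also have "(\<Sum>b\<in>seg h v. ?x b - (if c t (g t b) = 2 then 2 else 0)) = 12 - (\<Sum>v\<in>UNIV. if c t v = 2 then 2 else 0)"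
      using sum_over_seg[of "X - {h} - {t}" v] cY sum_seg_other[of h t "\<lambda>v. if c t v = 2 then 2 else 0" v] t h(1)
      by (auto simp: sum_subtractf)
    also have "(\<Sum>v\<in>UNIV. if c t v = 2 then 2 else (0::int)) = 2"
    proof -
      have "(\<Sum>v\<in>UNIV. if c t v = 2 then 2 else (0::int)) = (\<Sum>v\<in>UNIV. if v = y then 2 else 0)"
        using xy by (intro sum.cong) auto
      then show ?thesis by simp
    qed
    finally show False by simp
  qed
qed

end

section \<open>Arcs with 84 points\<close>

text \<open>P and L are the sets of neighbour classes. The pairs (p, a) and (l, b) are the points and lines of
  the Hjelmslev plane, incident iff I p l and f p l a = g l p b: lines of class l cut class p into four
  parallel segments, labelled by gf4.\<close>
locale hjelmslev4 =
  fixes P :: "'p set" and L :: "'l set" and I :: "'p \<Rightarrow> 'l \<Rightarrow> bool"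
    and A :: "'a set" and B :: "'b set"
    and f :: "'p \<Rightarrow> 'l \<Rightarrow> 'a \<Rightarrow> gf4" and g :: "'l \<Rightarrow> 'p \<Rightarrow> 'b \<Rightarrow> gf4"
  assumes card_P: "card P = 21" and card_L: "card L = 21"
    and point_net: "p \<in> P \<Longrightarrow> net4 {l \<in> L. I p l} A (f p)"
    and line_net: "l \<in> L \<Longrightarrow> net4 {p \<in> P. I p l} B (g l)"
    and join: "\<lbrakk>p \<in> P; q \<in> P; p \<noteq> q\<rbrakk> \<Longrightarrow> \<exists>l\<in>L. I p l \<and> I q l"
    and join_unique: "\<lbrakk>p \<in> P; q \<in> P; p \<noteq> q; l \<in> L; l' \<in> L; I p l; I q l; I p l'; I q l'\<rbrakk> \<Longrightarrow> l = l'"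
begin

definition lns :: "'p \<Rightarrow> 'l set" where "lns p = {l \<in> L. I p l}"
definition pts :: "'l \<Rightarrow> 'p set" where "pts l = {p \<in> P. I p l}"

lemma finite_P [simp]: "finite P"
  using card_P by (intro card_ge_0_finite) simp

lemma finite_L [simp]: "finite L"
  using card_L by (intro card_ge_0_finite) simp

lemma in_lns [simp]: "l \<in> lns p \<longleftrightarrow> l \<in> L \<and> I p l"
  by (simp add: lns_def)

lemma in_pts [simp]: "p \<in> pts l \<longleftrightarrow> p \<in> P \<and> I p l"
  by (simp add: pts_def)

lemma finite_lns [simp]: "finite (lns p)" and finite_pts [simp]: "finite (pts l)"
  by (simp_all add: lns_def pts_def)

lemma card_lns: "p \<in> P \<Longrightarrow> card (lns p) = 5"
  using net4.card_X[OF point_net] by (simp add: lns_def)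

lemma card_pts: "l \<in> L \<Longrightarrow> card (pts l) = 5"
  using net4.card_X[OF line_net] by (simp add: pts_def)

lemma sum_flags: "(\<Sum>l\<in>L. \<Sum>p\<in>pts l. F p l) = (\<Sum>p\<in>P. \<Sum>l\<in>lns p. F p l)"
  unfolding lns_def pts_def by (rule sum.swap_restrict) simp_all

lemma meet_unique:
  assumes "l \<in> L" "l' \<in> L" "l \<noteq> l'" "p \<in> pts l" "p \<in> pts l'" "q \<in> pts l" "q \<in> pts l'"
  shows "p = q"
  using join_unique[of p q l l'] assms by auto

text \<open>The five line classes through \<open>p\<close> cover every other point class once and
  \<open>p\<close> five times.\<close>

lemma sum_lns_pts:
  fixes h :: "'p \<Rightarrow> int"
  assumes "p \<in> P"
  shows "(\<Sum>l\<in>lns p. \<Sum>q\<in>pts l. h q) = 4 * h p + (\<Sum>q\<in>P. h q)"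
proof -
  have "(\<Sum>l\<in>lns p. \<Sum>q\<in>pts l. h q) = (\<Sum>q\<in>P. \<Sum>l\<in>{l \<in> lns p. I q l}. h q)"
    unfolding pts_def by (rule sum.swap_restrict) simp_all
  also have "\<dots> = (\<Sum>q\<in>P. h q + (if q = p then 4 * h p else 0))"
  proof (rule sum.cong)
    fix q assume q: "q \<in> P"
    show "(\<Sum>l\<in>{l \<in> lns p. I q l}. h q) = h q + (if q = p then 4 * h p else 0)"
    proof (cases "q = p")
      case True
      then have "{l \<in> lns p. I q l} = lns p" by auto
      then show ?thesis using True card_lns[OF assms] by simp
    next
      case False
      obtain l where "l \<in> L" "I p l" "I q l" using join[OF assms q] False by auto
      then have "{l \<in> lns p. I q l} = {l}" using join_unique[OF assms q] False by auto
      then show ?thesis using False by simp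
    qed
  qed simp
  also have "\<dots> = 4 * h p + (\<Sum>q\<in>P. h q)" using assms by (simp add: sum.distrib)
  finally show ?thesis .
qed

definition jn :: "'p \<Rightarrow> 'p \<Rightarrow> 'l" where "jn p q = (SOME l. l \<in> L \<and> I p l \<and> I q l)"

lemma jn:
  assumes "p \<in> P" "q \<in> P" "p \<noteq> q"
  shows "jn p q \<in> L" "I p (jn p q)" "I q (jn p q)"
proof -
  have "\<exists>l. l \<in> L \<and> I p l \<and> I q l" using join[OF assms] by blast
  from someI_ex[OF this] show "jn p q \<in> L" "I p (jn p q)" "I q (jn p q)" by (simp_all add: jn_def)
qed

lemma jn_eq:
  assumes "p \<in> pts l" "q \<in> pts l" "p \<noteq> q" "l \<in> L"
  shows "jn p q = l"
  using join_unique[of p q "jn p q" l] jn[of p q] assms by simp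

end

locale hjelmslev4_arc = hjelmslev4 P L I A B f g
  for P :: "'p set" and L :: "'l set" and I :: "'p \<Rightarrow> 'l \<Rightarrow> bool"
    and A :: "'a set" and B :: "'b set"
    and f :: "'p \<Rightarrow> 'l \<Rightarrow> 'a \<Rightarrow> gf4" and g :: "'l \<Rightarrow> 'p \<Rightarrow> 'b \<Rightarrow> gf4" +
  fixes K :: "('p \<times> 'a) set"
  assumes K_sub: "K \<subseteq> P \<times> A"
    and arc: "\<lbrakk>l \<in> L; b \<in> B\<rbrakk> \<Longrightarrow> card {x \<in> K. I (fst x) l \<and> f (fst x) l (snd x) = g l (fst x) b} \<le> 6"
    and card_K: "card K = 84"
begin

definition cls :: "'p \<Rightarrow> 'a set" where "cls p = {a. (p, a) \<in> K}"
definition cnt :: "'p \<Rightarrow> 'l \<Rightarrow> gf4 \<Rightarrow> int" where "cnt p l v = int (card {a \<in> cls p. f p l a = v})"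
definition d :: "'p \<Rightarrow> int" where "d p = int (card (cls p)) - 4"
definition e :: "'l \<Rightarrow> int" where "e l = (\<Sum>p\<in>pts l. d p)"
definition Q :: "'p \<Rightarrow> 'l \<Rightarrow> int" where "Q p l = (\<Sum>v\<in>UNIV. (cnt p l v)\<^sup>2)"

lemma finite_K [simp]: "finite K"
  using card_K by (intro card_ge_0_finite) simp

lemma finite_cls [simp]: "finite (cls p)"
proof -
  have "cls p \<subseteq> snd ` K" by (force simp: cls_def)
  then show ?thesis by (rule finite_subset) simp
qed

lemma cls_sub: "cls p \<subseteq> A"
  using K_sub by (auto simp: cls_def)

lemma K_eq: "K = Sigma P cls"
  using K_sub by (auto simp: cls_def)

lemma cnt_nonneg: "0 \<le> cnt p l v"
  by (simp add: cnt_def)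

lemma sum_cnt: "(\<Sum>v\<in>UNIV. cnt p l v) = d p + 4"
proof -
  have "(\<Sum>v\<in>UNIV. card {a \<in> cls p. f p l a = v}) = card (cls p)"
    using sum.group[of "cls p" UNIV "f p l" "\<lambda>_. 1 :: nat"] by simp
  moreover have "(\<Sum>v\<in>UNIV. cnt p l v) = int (\<Sum>v\<in>UNIV. card {a \<in> cls p. f p l a = v})"
    by (simp add: cnt_def)
  ultimately show ?thesis by (simp add: d_def)
qed

lemma weight_eq: "(\<Sum>p\<in>pts l. cnt p l (g l p b)) =
   int (card {x \<in> K. I (fst x) l \<and> f (fst x) l (snd x) = g l (fst x) b})"
proof -
  have "{x \<in> K. I (fst x) l \<and> f (fst x) l (snd x) = g l (fst x) b}
      = Sigma (pts l) (\<lambda>p. {a \<in> cls p. f p l a = g l p b})"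
    using K_sub by (auto simp: cls_def)
  then show ?thesis by (simp add: cnt_def)
qed

lemma net: "l \<in> L \<Longrightarrow> weighted_net4 (pts l) B (g l) (\<lambda>p. cnt p l)"
  unfolding weighted_net4_def weighted_net4_axioms_def
  using line_net[of l] arc[of l] weight_eq[of l] by (auto simp: pts_def cnt_nonneg)

lemma u_eq: "l \<in> L \<Longrightarrow> weighted_net4.u (\<lambda>p. cnt p l) p = d p + 4"
  by (simp add: weighted_net4.u_def[OF net] sum_cnt)

lemma k_eq: "l \<in> L \<Longrightarrow> weighted_net4.k (pts l) (\<lambda>p. cnt p l) = e l + 20"
  by (simp add: weighted_net4.k_def[OF net] u_eq e_def sum.distrib card_pts)

lemma q_eq: "l \<in> L \<Longrightarrow> weighted_net4.q (\<lambda>p. cnt p l) p = Q p l"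
  by (simp add: weighted_net4.q_def[OF net] Q_def)

lemma sum_d: "(\<Sum>p\<in>P. d p) = 0"
proof -
  have "card (Sigma P cls) = card K"
    by (rule arg_cong[OF K_eq[symmetric]])
  then have "(\<Sum>p\<in>P. card (cls p)) = 84" using card_K by simp
  moreover have "(\<Sum>p\<in>P. d p) = int (\<Sum>p\<in>P. card (cls p)) - 84"
    by (simp add: d_def sum_subtractf card_P)
  ultimately show ?thesis by simp
qed

lemma sum_e_lns: "p \<in> P \<Longrightarrow> (\<Sum>l\<in>lns p. e l) = 4 * d p"
  by (simp add: e_def sum_lns_pts sum_d)

lemma sum_e: "(\<Sum>l\<in>L. e l) = 0"
  by (simp add: e_def sum_flags card_lns sum_d flip: sum_distrib_left)

lemma cnt_le:
  assumes "l \<in> L" "p \<in> pts l"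
  shows "4 * cnt p l v \<le> 8 + d p - e l"
  using weighted_net4.c_le[OF net[OF assms(1)] assms(2), of v] assms(1) by (simp add: u_eq k_eq)

lemma sum_Q: "p \<in> P \<Longrightarrow> (\<Sum>l\<in>lns p. Q p l) = (d p + 4)\<^sup>2 + 4 * (d p + 4)"
  using net4.sum_squares[OF point_net cls_sub, of p] by (simp add: Q_def cnt_def d_def lns_def)

section \<open>Class sizes and excesses of line classes\<close>

lemma d_ge: "- 4 \<le> d p"
  by (simp add: d_def)

lemma sum_cnt_gf4: "cnt p l F0 + cnt p l F1 + cnt p l Fw + cnt p l Fv = d p + 4"
  using sum_cnt by (simp add: sum_gf4)

text \<open>Weighting \<open>cnt_le\<close> by the segment counts bounds four times the sum of
  squares by (40 + d)(d + 4). Its exact value 4 (d + 4)(d + 8) then gives 3 d \<le> 8.\<close>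

lemma d_le:
  assumes "p \<in> P"
  shows "d p \<le> 2"
proof -
  have "4 * Q p l \<le> (8 + d p - e l) * (d p + 4)" if l: "l \<in> lns p" for l
  proof -
    have "4 * Q p l = (\<Sum>v\<in>UNIV. 4 * cnt p l v * cnt p l v)"
      by (simp add: Q_def power2_eq_square sum_distrib_left mult.assoc)
    also have "\<dots> \<le> (\<Sum>v\<in>UNIV. (8 + d p - e l) * cnt p l v)"
      using cnt_le[of l p] l assms by (intro sum_mono mult_right_mono) (simp_all add: cnt_nonneg)
    finally show ?thesis by (simp add: sum_cnt flip: sum_distrib_left)
  qed
  then have "(\<Sum>l\<in>lns p. 4 * Q p l) \<le> (\<Sum>l\<in>lns p. (8 + d p - e l) * (d p + 4))"
    by (rule sum_mono)
  also have "\<dots> = (40 + d p) * (d p + 4)"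
    using assms by (simp add: sum_subtractf card_lns sum_e_lns flip: sum_distrib_right)
  finally have "4 * ((d p + 4)\<^sup>2 + 4 * (d p + 4)) \<le> (40 + d p) * (d p + 4)"
    using sum_Q[OF assms] by (simp flip: sum_distrib_left)
  then have "(d p + 4) * (3 * d p - 8) \<le> 0"
    by (simp add: power2_eq_square algebra_simps)
  then have "3 * d p - 8 \<le> 0 \<or> d p + 4 \<le> 0" by (metis linorder_not_le mult_pos_pos)
  then show ?thesis by auto
qed

lemma pos_cases: "p \<in> P \<Longrightarrow> 0 < d p \<Longrightarrow> d p = 1 \<or> d p = 2"
  using d_le[of p] by linarith

text \<open>More than four points on four segments put two on one segment, hence 8 \<le> 8 + d -
  e.\<close>

lemma e_le_d:
  assumes "p \<in> P" "0 < d p" "l \<in> lns p"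
  shows "e l \<le> d p"
proof -
  have le: "4 * cnt p l v \<le> 8 + d p - e l" for v using cnt_le[of l p] assms by simp
  have "cnt p l F0 \<ge> 2 \<or> cnt p l F1 \<ge> 2 \<or> cnt p l Fw \<ge> 2 \<or> cnt p l Fv \<ge> 2"
    using sum_cnt_gf4[of p l] assms(2) by linarith
  then show ?thesis using le[of F0] le[of F1] le[of Fw] le[of Fv] by linarith
qed

text \<open>Three points on a segment force \<open>e l \<le> d p - 4\<close>. The other four line
  classes have excess at most \<open>d p\<close> each, so the required sum 4 d is missed.\<close>

lemma cnt_le2_pos:
  assumes "p \<in> P" "0 < d p" "l \<in> lns p"
  shows "cnt p l v \<le> 2"
proof (rule ccontr)
  assume "\<not> ?thesis"
  then have "e l \<le> d p - 4" using cnt_le[of l p v] assms by simp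
  moreover have "(\<Sum>l\<in>lns p - {l}. e l) \<le> 4 * d p"
    using sum_bounded_above[of "lns p - {l}" e "d p"] e_le_d[OF assms(1,2)] assms card_lns by simp
  moreover have "(\<Sum>l\<in>lns p. e l) = e l + (\<Sum>l\<in>lns p - {l}. e l)" using assms(3) by (intro sum.remove) simp_all
  ultimately show False using sum_e_lns[OF assms(1)] pos_cases[OF assms(1,2)] by auto
qed

lemma cnt_cases2:
  assumes "cnt p l v \<le> 2"
  shows "cnt p l v = 0 \<or> cnt p l v = 1 \<or> cnt p l v = 2"
  using assms cnt_nonneg[of p l v] by linarith

text \<open>The distributions 0, 2, 2, 2 and 1, 1, 2, 2 have squares 12 and 10, and the five
  directions must reach 60 = 5 * 12.\<close>

lemma six_pattern:
  assumes "p \<in> P" "d p = 2" "l \<in> lns p"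
  shows "weighted_net4.six (\<lambda>p. cnt p l) p"
proof -
  have *: "cnt p l v = 0 \<or> cnt p l v = 1 \<or> cnt p l v = 2" if "l \<in> lns p" for l v
    using cnt_cases2 cnt_le2_pos[OF assms(1) _ that] assms(2) by simp
  have pat: "Q p l = 10 \<or> Q p l = 12 \<and> (\<exists>v0. \<forall>v. cnt p l v = (if v = v0 then 0 else 2))"
    if "l \<in> lns p" for l
    using *[OF that, of F0] *[OF that, of F1] *[OF that, of Fw] *[OF that, of Fv] sum_cnt_gf4[of p l] assms(2)
    unfolding Q_def sum_gf4 ex_gf4 all_gf4 by (elim disjE) simp_all
  have "Q p l = 12"
  proof (rule sum_tight[of "lns p"])
    show "\<And>l. l \<in> lns p \<Longrightarrow> Q p l \<le> 12" using pat by force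
    show "int (card (lns p)) * 12 \<le> (\<Sum>l\<in>lns p. Q p l)"
      using card_lns[OF assms(1)] sum_Q[OF assms(1)] assms(2) by simp
  qed (use assms in simp_all)
  then show ?thesis using pat[OF assms(3)] weighted_net4.six_def[OF net] assms(3) by simp
qed

text \<open>The distributions 0, 1, 2, 2 and 1, 1, 1, 2 have squares 9 and 7, and the five
  directions must reach 45 = 5 * 9.\<close>

lemma five_pattern:
  assumes "p \<in> P" "d p = 1" "l \<in> lns p"
  shows "weighted_net4.five (\<lambda>p. cnt p l) p"
proof -
  have *: "cnt p l v = 0 \<or> cnt p l v = 1 \<or> cnt p l v = 2" if "l \<in> lns p" for l v
    using cnt_cases2 cnt_le2_pos[OF assms(1) _ that] assms(2) by simp
  have pat: "Q p l = 7 \<or> Q p l = 9 \<and> (\<exists>v0 v1. v0 \<noteq> v1 \<and> (\<forall>v. cnt p l v = (if v = v0 then 0 else if v = v1 then 1 else 2)))"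
    if "l \<in> lns p" for l
    using *[OF that, of F0] *[OF that, of F1] *[OF that, of Fw] *[OF that, of Fv] sum_cnt_gf4[of p l] assms(2)
    unfolding Q_def sum_gf4 ex_gf4 all_gf4 by (elim disjE) simp_all
  have "Q p l = 9"
  proof (rule sum_tight[of "lns p"])
    show "\<And>l. l \<in> lns p \<Longrightarrow> Q p l \<le> 9" using pat by force
    show "int (card (lns p)) * 9 \<le> (\<Sum>l\<in>lns p. Q p l)"
      using card_lns[OF assms(1)] sum_Q[OF assms(1)] assms(2) by simp
  qed (use assms in simp_all)
  then show ?thesis using pat[OF assms(3)] weighted_net4.five_def[OF net] assms(3) by simp
qed

lemma heavy_has_pos:
  assumes "1 \<le> e l"
  obtains p where "p \<in> pts l" "0 < d p"
proof -
  have "\<exists>p\<in>pts l. 0 < d p"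
  proof (rule ccontr)
    assume "\<not> ?thesis"
    then have "e l \<le> 0" unfolding e_def by (intro sum_nonpos) (meson not_less)
    then show False using assms by simp
  qed
  then show thesis using that by blast
qed

lemma e_le2:
  assumes "l \<in> L"
  shows "e l \<le> 2"
proof (rule ccontr)
  assume "\<not> ?thesis"
  then obtain p where "p \<in> pts l" "0 < d p" using heavy_has_pos[of l] by auto
  then show False using e_le_d[of p l] d_le[of p] \<open>\<not> e l \<le> 2\<close> assms by simp
qed

text \<open>By \<open>e_le_d\<close> every class with d > 0 on \<open>l\<close> is a six, and
  \<open>not_two_sixes\<close> admits only one; the remaining values are nonpositive with sum
  0.\<close>

lemma e_two:
  assumes "l \<in> L" "e l = 2"
  obtains p where "p \<in> pts l" "d p = 2" "\<And>q. q \<in> pts l \<Longrightarrow> q \<noteq> p \<Longrightarrow> d q = 0"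
proof -
  obtain p where p: "p \<in> pts l" "0 < d p" using heavy_has_pos[of l] assms(2) by auto
  have two: "d q = 2" if "q \<in> pts l" "0 < d q" for q
    using e_le_d[of q l] d_le[of q] that assms by auto
  have "d q \<le> 0" if q: "q \<in> pts l" "q \<noteq> p" for q
  proof (rule ccontr)
    assume "\<not> d q \<le> 0"
    then have "d q = 2" "d p = 2" using two[OF q(1)] two[OF p] by simp_all
    then show False
      using weighted_net4.not_two_sixes[OF net[OF assms(1)], of p q] k_eq[OF assms(1)] assms q(2)
        six_pattern[of p l] six_pattern[of q l] p q by auto
  qed
  moreover have "(\<Sum>q\<in>pts l - {p}. d q) = 0"
    using assms(2) p two[OF p] by (simp add: e_def sum_diff1)
  ultimately have "d q = 0" if "q \<in> pts l" "q \<noteq> p" for q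
    using nonpos_sum_zero[of "pts l - {p}" d q] that by simp
  then show thesis using that[of p] p two by blast
qed

text \<open>Four points on a segment force \<open>e l0 = - 8\<close> and excess 2 on the other line
  classes through \<open>y\<close>, so classes off \<open>l0\<close> have d = 0 or d = 2. Projecting
  \<open>l0\<close> from a six \<open>p\<close> off it then exhibits two empty classes on
  \<open>l0\<close>, and by parity the line classes joining \<open>p\<close> to them are too
  light.\<close>

lemma no_four_collinear:
  assumes y: "y \<in> P" "d y = 0" and l0: "l0 \<in> lns y" "cnt y l0 v = 4"
  shows False
proof -
  have e0: "e l0 \<le> - 8" using cnt_le[of l0 y v] y l0 by simp
  have split: "(\<Sum>l\<in>lns y. e l) = e l0 + (\<Sum>l\<in>lns y - {l0}. e l)"
    using l0(1) by (intro sum.remove) simp_all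
  have card4: "card (lns y - {l0}) = 4" using card_lns[OF y(1)] l0(1) by simp
  have two: "e l = 2" if "l \<in> lns y - {l0}" for l
    using sum_tight[of "lns y - {l0}" e 2 l] e_le2 split sum_e_lns[OF y(1)] y(2) e0 card4 that by simp
  have e0': "e l0 = - 8"
    using split sum_e_lns[OF y(1)] y(2) card4 two by simp
  have off: "d q = 0 \<or> d q = 2" if q: "q \<in> P" "q \<notin> pts l0" for q
  proof -
    have "q \<noteq> y" using q l0(1) y(1) by auto
    then obtain l where l: "l \<in> L" "I q l" "I y l" using join[OF q(1) y(1)] by blast
    then have "l \<in> lns y - {l0}" using q by auto
    from e_two[OF l(1) two[OF this]] l(2) q(1) show ?thesis by (metis in_pts)
  qed
  have "lns y - {l0} \<noteq> {}" using card4 by (metis card.empty zero_neq_numeral)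
  then obtain l1 where l1: "l1 \<in> lns y - {l0}" by blast
  obtain p where p: "p \<in> pts l1" "d p = 2" using e_two[OF _ two[OF l1]] l1 by auto
  have pP: "p \<in> P" using p by simp
  have p0: "p \<notin> pts l0"
    using meet_unique[of l1 l0 p y] l1 l0(1) p y by auto
  have in2: "d q = 0 \<or> d q = 2" if l: "l \<in> L" "e l = 2" "q \<in> pts l" for l q
    using e_two[OF l(1,2)] l(3) by metis
  define ln where "ln = jn p"
  have ln: "ln a \<in> L" "I p (ln a)" "I a (ln a)" if "a \<in> pts l0" for a
    unfolding ln_def using jn[OF pP, of a] that p0 by auto
  have inj: "inj_on ln (pts l0)"
  proof (rule inj_onI, rule ccontr)
    fix a b assume ab: "a \<in> pts l0" "b \<in> pts l0" "ln a = ln b" "a \<noteq> b"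
    then have "ln a = l0" using join_unique[of a b "ln a" l0] ln[OF ab(1)] ln[OF ab(2)] l0(1) by auto
    then show False using ln(2)[OF ab(1)] p0 pP by simp
  qed
  have l0L: "l0 \<in> L" and ypts: "y \<in> pts l0" using l0(1) y(1) by auto
  have im: "ln ` pts l0 = lns p"
  proof (rule card_subset_eq)
    show "ln ` pts l0 \<subseteq> lns p" using ln by auto
    show "card (ln ` pts l0) = card (lns p)"
      using card_image[OF inj] card_pts[OF l0L] card_lns[OF pP] by simp
  qed simp
  have "(\<Sum>a\<in>pts l0. e (ln a)) = 8"
    using sum.reindex[OF inj, of e] sum_e_lns[OF pP] p(2) by (simp add: im)
  moreover have "ln y = l1" using join_unique[of p y "ln y" l1] ln[OF ypts] p0 ypts l1 p y(1) by auto
  ultimately have s6: "(\<Sum>a\<in>pts l0 - {y}. e (ln a)) = 6"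
    using two[OF l1] ypts by (simp add: sum.remove)
  have s8: "(\<Sum>a\<in>pts l0 - {y}. d a) = - 8"
    using e0' y(2) ypts by (simp add: e_def sum.remove)
  have card4': "card (pts l0 - {y}) = 4" using card_pts[OF l0L] ypts by simp
  \<comment> \<open>Excess 2 towards \<open>a\<close> makes \<open>d a\<close> nonnegative, so the
    total -8 of \<open>d\<close> comes from \<open>?S\<close>. The total excess 6 allows
    \<open>?S\<close> at most two members, which must then both be empty classes.\<close>
  let ?T = "{a \<in> pts l0 - {y}. e (ln a) = 2}"
  let ?S = "{a \<in> pts l0 - {y}. e (ln a) \<noteq> 2}"
  have TS: "pts l0 - {y} = ?T \<union> ?S" "?T \<inter> ?S = {}" by auto
  have sumTS: "(\<Sum>a\<in>pts l0 - {y}. h a) = (\<Sum>a\<in>?T. h a) + (\<Sum>a\<in>?S. h a)" for h :: "'p \<Rightarrow> int"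
    by (subst TS(1)) (rule sum.union_disjoint, auto)
  have cTS: "card ?T + card ?S = 4"
    using sumTS[of "\<lambda>_. 1"] card4' by simp
  have dT: "0 \<le> d a" if "a \<in> ?T" for a
    using in2[of "ln a" a] ln[of a] that by auto
  have S1: "e (ln a) \<le> 1" if "a \<in> ?S" for a
    using e_le2[of "ln a"] ln[of a] that by auto
  have "6 \<le> 2 * int (card ?T) + int (card ?S)"
    using s6 sumTS[of "\<lambda>a. e (ln a)"] sum_bounded_above[of ?S "\<lambda>a. e (ln a)" 1] S1 by simp
  then have cT: "2 \<le> card ?T" "card ?S \<le> 2" using cTS by auto
  have "0 \<le> (\<Sum>a\<in>?T. d a)" by (rule sum_nonneg) (rule dT)
  then have S8: "(\<Sum>a\<in>?S. d a) \<le> - 8" using s8 sumTS[of d] by simp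
  have ge: "- 4 * int (card ?S) \<le> (\<Sum>a\<in>?S. d a)"
    using sum_bounded_below[of ?S "-4" d] d_ge by (simp add: mult.commute)
  have cS: "card ?S = 2" using S8 ge cT by simp
  have dS: "d a = - 4" if "a \<in> ?S" for a
    using sum_tight[of ?S "\<lambda>a. - d a" 4 a] that d_ge S8 cS by (simp add: sum_negf minus_le_iff)
  have "e (ln a) \<le> 0" if a: "a \<in> ?S" for a
  proof -
    \<comment> \<open>The line class \<open>ln a\<close> meets \<open>l0\<close> only in
      \<open>a\<close>, so its other classes have d = 0 or d = 2.\<close>
    have "even (\<Sum>q\<in>pts (ln a) - {a}. d q)"
    proof (rule dvd_sum)
      fix q assume q: "q \<in> pts (ln a) - {a}"
      have "q \<notin> pts l0"
        using meet_unique[of "ln a" l0 q a] ln[of a] q a l0L p0 pP by auto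
      then show "even (d q)" using off[of q] q by auto
    qed
    moreover have "e (ln a) = - 4 + (\<Sum>q\<in>pts (ln a) - {a}. d q)"
      unfolding e_def dS[OF a, symmetric] using ln[of a] a by (intro sum.remove) auto
    ultimately have "even (e (ln a))" by simp
    then show ?thesis using S1[OF a] by presburger
  qed
  then have "(\<Sum>a\<in>?S. e (ln a)) \<le> 0" by (rule sum_nonpos)
  moreover have "(\<Sum>a\<in>?T. e (ln a)) = 2 * int (card ?T)" by simp
  ultimately show False using s6 sumTS[of "\<lambda>a. e (ln a)"] cS cTS by simp
qed

text \<open>In another direction the three points have distinct labels, so the counts are 1, 1, 1, 1
  or, if \<open>z\<close> repeats a label, 2, 1, 1, 0 with e \<le> 0; both give
  \<open>Q y l \<le> 6 - e l\<close>. Together with 10 for \<open>l0\<close> the squares stay at 30,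
  below 32.\<close>

lemma no_three_collinear:
  assumes y: "y \<in> P" "d y = 0" and l0: "l0 \<in> lns y" "cnt y l0 v = 3"
  shows False
proof -
  let ?T = "{a \<in> cls y. f y l0 a = v}"
  have cT: "card ?T = 3" using l0(2) by (simp add: cnt_def)
  have "card (cls y) = 4" using y(2) by (simp add: d_def)
  then have "card (cls y - ?T) = 1" using cT by (subst card_Diff_subset) auto
  then obtain z where z: "cls y - ?T = {z}" using card_1_singletonE by blast
  have e0: "e l0 \<le> - 4" using cnt_le[of l0 y v] y l0 by simp
  have Q0: "Q y l0 = 10"
  proof -
    have nn: "cnt y l0 x \<ge> 0" for x by (rule cnt_nonneg)
    have s: "cnt y l0 F0 + cnt y l0 F1 + cnt y l0 Fw + cnt y l0 Fv = 4"
      using sum_cnt_gf4[of y l0] y(2) by simp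
    have "\<exists>x. x \<noteq> v \<and> cnt y l0 x = 1 \<and> (\<forall>t. t \<noteq> v \<longrightarrow> t \<noteq> x \<longrightarrow> cnt y l0 t = 0)"
      using s l0(2) nn[of F0] nn[of F1] nn[of Fw] nn[of Fv]
      unfolding ex_gf4 all_gf4 by (cases v; simp; linarith)
    then obtain x where x: "x \<noteq> v" "cnt y l0 x = 1" "\<And>t. t \<noteq> v \<Longrightarrow> t \<noteq> x \<Longrightarrow> cnt y l0 t = 0" by blast
    show ?thesis unfolding Q_def
      using l0(2) x(1,2) x(3)[of F0] x(3)[of F1] x(3)[of Fw] x(3)[of Fv]
      by (cases v; cases x) (simp_all add: sum_gf4)
  qed
  have other: "Q y l \<le> 6 - e l" if l: "l \<in> lns y - {l0}" for l
  proof -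
    have le: "cnt y l x \<le> (if x = f y l z then 2 else 1)" for x
    proof -
      have "card ({a \<in> cls y. f y l a = x} \<inter> ?T) \<le> 1"
      proof -
        have "a = a'" if "a \<in> {a \<in> cls y. f y l a = x} \<inter> ?T" "a' \<in> {a \<in> cls y. f y l a = x} \<inter> ?T" for a a'
          using net4.sep[OF point_net[OF y(1)], of l0 l a a'] that l l0(1) cls_sub by auto
        then show ?thesis unfolding One_nat_def by (subst card_le_Suc0_iff_eq) (simp, blast)
      qed
      moreover have "{a \<in> cls y. f y l a = x} \<subseteq> ({a \<in> cls y. f y l a = x} \<inter> ?T) \<union> (if x = f y l z then {z} else {})"
        using z by auto
      then have "card {a \<in> cls y. f y l a = x} \<le> card ({a \<in> cls y. f y l a = x} \<inter> ?T) + card (if x = f y l z then {z} else {})"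
        by (intro order_trans[OF card_mono card_Un_le]) simp_all
      ultimately show ?thesis by (auto simp: cnt_def split: if_splits)
    qed
    have nn: "cnt y l x \<ge> 0" for x by (rule cnt_nonneg)
    have s: "cnt y l F0 + cnt y l F1 + cnt y l Fw + cnt y l Fv = 4"
      using sum_cnt_gf4[of y l] y(2) by simp
    have c01: "cnt y l x = 0 \<or> cnt y l x = 1 \<or> cnt y l x = 2 \<and> x = f y l z" for x
      using le[of x] nn[of x] by (auto split: if_splits)
    have "Q y l = 4 \<or> Q y l = 6 \<and> (\<exists>x. cnt y l x = 2)"
      using c01[of F0] c01[of F1] c01[of Fw] c01[of Fv] s
      unfolding Q_def sum_gf4 ex_gf4 by (elim disjE conjE) simp_all
    then show ?thesis
    proof (elim disjE conjE exE)
      assume "Q y l = 4" then show ?thesis using e_le2[of l] l by simp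
    next
      fix x assume "Q y l = 6" "cnt y l x = 2"
      then show ?thesis using cnt_le[of l y x] l y by simp
    qed
  qed
  have "(\<Sum>l\<in>lns y - {l0}. Q y l) \<le> (\<Sum>l\<in>lns y - {l0}. 6 - e l)" by (rule sum_mono) (rule other)
  moreover have "(\<Sum>l\<in>lns y. Q y l) = Q y l0 + (\<Sum>l\<in>lns y - {l0}. Q y l)"
    "(\<Sum>l\<in>lns y. e l) = e l0 + (\<Sum>l\<in>lns y - {l0}. e l)"
    using l0(1) by (simp_all add: sum.remove)
  ultimately show False
    using sum_Q[OF y(1)] sum_e_lns[OF y(1)] y(2) Q0 e0 card_lns[OF y(1)] l0(1) by (simp add: sum_subtractf)
qed

lemma cnt_le2_four:
  assumes y: "y \<in> P" "d y = 0" "l \<in> lns y"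
  shows "cnt y l v \<le> 2"
proof -
  have "cnt y l v \<le> 4"
    using sum_cnt_gf4[of y l] y(2) cnt_nonneg[of y l F0] cnt_nonneg[of y l F1] cnt_nonneg[of y l Fw]
      cnt_nonneg[of y l Fv] by (cases v) simp_all
  moreover have "cnt y l v \<noteq> 3" "cnt y l v \<noteq> 4"
    using no_three_collinear[OF y] no_four_collinear[OF y] by blast+
  ultimately show ?thesis by linarith
qed

section \<open>Slack of four-point classes\<close>

lemma Q_le8:
  assumes "y \<in> P" "d y = 0" "l \<in> lns y"
  shows "Q y l \<le> 8"
proof -
  have lL: "l \<in> L" using assms by simp
  show ?thesis
    using weighted_net4.four_pattern[OF net[OF lL], of y] u_eq[OF lL, of y] q_eq[OF lL, of y]
      cnt_le2_four[OF assms] assms(2) by auto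
qed

text \<open>Here 4 c \<le> 8 - e < 8, so each segment carries exactly one point.\<close>

lemma Q_heavy:
  assumes "y \<in> P" "d y = 0" "l \<in> lns y" "1 \<le> e l"
  shows "Q y l = 4"
proof -
  have lL: "l \<in> L" using assms by simp
  have "cnt y l v \<le> 1" for v using cnt_le[of l y v] assms by simp
  then have "cnt y l v = 1" for v
    using weighted_net4.four_full[OF net[OF lL], of y] u_eq[OF lL, of y] assms(2) by simp
  then show ?thesis by (simp add: Q_def card_gf4)
qed

lemma sum_Q_four: "y \<in> P \<Longrightarrow> d y = 0 \<Longrightarrow> (\<Sum>l\<in>lns y. 8 - Q y l) = 8"
  using sum_Q[of y] card_lns[of y] by (simp add: sum_subtractf)

text \<open>The five slacks 8 - \<open>Q\<close> are nonnegative with sum 40 - 32 = 8, and positive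
  excess costs 4.\<close>

lemma heavy_le2:
  assumes y: "y \<in> P" "d y = 0"
  shows "card {l \<in> lns y. 1 \<le> e l} \<le> 2"
proof -
  have "4 * int (card {l \<in> lns y. 1 \<le> e l}) = (\<Sum>l\<in>{l \<in> lns y. 1 \<le> e l}. 8 - Q y l)"
    using Q_heavy[OF y] by simp
  also have "\<dots> \<le> (\<Sum>l\<in>lns y. 8 - Q y l)"
    using Q_le8[OF y] by (intro sum_mono2) auto
  finally show ?thesis using sum_Q_four[OF y] by simp
qed

text \<open>The sum 4 d of the excesses cannot be reached by three line classes, as each contributes
  at most d.\<close>

lemma light_le1:
  assumes p: "p \<in> P" "0 < d p"
  shows "card {l \<in> lns p. e l \<le> 0} \<le> 1"
proof (rule ccontr)
  assume "\<not> ?thesis"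
  then have n: "2 \<le> card {l \<in> lns p. e l \<le> 0}" by simp
  have eq: "lns p = {l \<in> lns p. e l \<le> 0} \<union> {l \<in> lns p. \<not> e l \<le> 0}" by auto
  have c: "card {l \<in> lns p. e l \<le> 0} + card {l \<in> lns p. \<not> e l \<le> 0} = 5"
    unfolding card_lns[OF p(1), symmetric] by (subst (3) eq, rule card_Un_disjoint[symmetric]) auto
  have "(\<Sum>l\<in>lns p. e l) = (\<Sum>l\<in>{l \<in> lns p. e l \<le> 0}. e l) + (\<Sum>l\<in>{l \<in> lns p. \<not> e l \<le> 0}. e l)"
    by (subst eq, rule sum.union_disjoint) auto
  moreover have "(\<Sum>l\<in>{l \<in> lns p. e l \<le> 0}. e l) \<le> 0" by (rule sum_nonpos) simp
  moreover have "(\<Sum>l\<in>{l \<in> lns p. \<not> e l \<le> 0}. e l) \<le> int (card {l \<in> lns p. \<not> e l \<le> 0}) * d p"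
    using e_le_d[OF p] by (intro sum_bounded_above) auto
  moreover have "int (card {l \<in> lns p. \<not> e l \<le> 0}) * d p \<le> 3 * d p"
    using n c p(2) by (intro mult_right_mono) auto
  ultimately show False using sum_e_lns[OF p(1)] p(2) by linarith
qed

text \<open>Excess 0 means five fours, with slack at least 40 - 32 by \<open>all_four\<close>;
  excess -1 means four fours and a three, with slack at least 32 - 28 by
  \<open>four_fours_and_three\<close>. For smaller excess the bound is not positive.\<close>

lemma nonpos_line:
  assumes l: "l \<in> L" and np: "\<And>p. p \<in> pts l \<Longrightarrow> d p \<le> 0"
  shows "8 + 4 * e l \<le> (\<Sum>y\<in>{y \<in> pts l. d y = 0}. 8 - Q y l)"
proof -
  have nn: "0 \<le> (\<Sum>y\<in>{y \<in> pts l. d y = 0}. 8 - Q y l)"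
    using Q_le8[of _ l] l by (intro sum_nonneg) auto
  consider "e l \<le> - 2" | "e l = - 1" | "0 \<le> e l" by linarith
  then show ?thesis
  proof cases
    case 1
    then show ?thesis using nn by simp
  next
    case 3
    have z: "d p = 0" if "p \<in> pts l" for p
      using nonpos_sum_zero[of "pts l" d p] np that 3 by (simp add: e_def)
    then have e0: "e l = 0" by (simp add: e_def)
    have "(\<Sum>m\<in>pts l. Q m l) \<le> 32"
      using weighted_net4.all_four(1)[OF net[OF l]] k_eq[OF l] u_eq[OF l] q_eq[OF l] z e0 by simp
    moreover have "{y \<in> pts l. d y = 0} = pts l" using z by auto
    ultimately show ?thesis using e0 card_pts[OF l] by (simp add: sum_subtractf)
  next
    case 2
    obtain h where h: "h \<in> pts l" "d h < 0"
    proof -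
      have "\<exists>h\<in>pts l. d h < 0"
      proof (rule ccontr)
        assume "\<not> ?thesis"
        then have "0 \<le> e l" unfolding e_def by (intro sum_nonneg) (meson not_less)
        then show False using 2 by simp
      qed
      then show thesis using that by blast
    qed
    have sp: "e l = d h + (\<Sum>p\<in>pts l - {h}. d p)" using h by (simp add: e_def sum.remove)
    have z: "d p = 0" if "p \<in> pts l - {h}" for p
      using nonpos_sum_zero[of "pts l - {h}" d p] np that h 2 sp by simp
    have dh: "d h = - 1" using sp 2 z by simp
    have "(\<Sum>m\<in>pts l - {h}. Q m l) \<le> 28"
      using weighted_net4.four_fours_and_three[OF net[OF l] _ h(1)] k_eq[OF l] u_eq[OF l] q_eq[OF l] z dh 2 by simp
    moreover have "{y \<in> pts l. d y = 0} = pts l - {h}" using z dh by auto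
    ultimately show ?thesis using 2 card_pts[OF l] h by (simp add: sum_subtractf)
  qed
qed

section \<open>Eliminating classes with more than four points\<close>

definition Z :: "'p set" where "Z = {y \<in> P. d y = 0}"
definition n4 :: "'l \<Rightarrow> int" where "n4 l = int (card {y \<in> pts l. d y = 0})"

lemma finite_Z [simp]: "finite Z"
  by (simp add: Z_def)

lemma n4_nonneg: "0 \<le> n4 l"
  by (simp add: n4_def)

lemma n4_le:
  assumes "l \<in> L" "S \<subseteq> pts l" "\<forall>p\<in>S. d p \<noteq> 0"
  shows "n4 l \<le> 5 - int (card S)"
proof -
  have "finite S" using assms(2) finite_subset by fastforce
  have "card {y \<in> pts l. d y = 0} \<le> card (pts l - S)"
    using assms(3) by (intro card_mono) auto
  also have "\<dots> = 5 - card S" using \<open>finite S\<close> assms(2) card_pts[OF assms(1)] by (simp add: card_Diff_subset)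
  finally show ?thesis using card_mono[OF _ assms(2)] card_pts[OF assms(1)] by (simp add: n4_def)
qed

lemma sum_n4_lns:
  assumes "p \<in> P" "d p \<noteq> 0"
  shows "(\<Sum>l\<in>lns p. n4 l) = int (card Z)"
proof -
  have "n4 l = (\<Sum>q\<in>pts l. if d q = 0 then 1 else 0)" for l
    unfolding n4_def by (subst sum_if_const) simp_all
  moreover have "(\<Sum>q\<in>P. if d q = 0 then 1 else (0::int)) = int (card Z)"
    unfolding Z_def by (subst sum_if_const) simp_all
  ultimately show ?thesis using sum_lns_pts[OF assms(1), of "\<lambda>q. if d q = 0 then 1 else 0"] assms(2) by simp
qed

text \<open>Every class with four points distributes a total of 8 among its five directions (8 minus the
  sum of the squared segment counts); a line with e > 0 claims 4 of it, and a line without classes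
  d > 0 claims at least 8 + 4 e in total.\<close>
lemma count_four_classes:
  "(\<Sum>l\<in>{l \<in> L. 1 \<le> e l}. n4 l) + (\<Sum>l\<in>{l \<in> L. \<forall>p\<in>pts l. d p \<le> 0}. 2 + e l) \<le> 2 * int (card Z)"
proof -
  let ?h = "\<lambda>p l. if d p = 0 then 8 - Q p l else 0"
  let ?F = "\<lambda>l. (if 1 \<le> e l then 4 * n4 l else 0) + (if \<forall>p\<in>pts l. d p \<le> 0 then 8 + 4 * e l else 0)"
  have le: "?F l \<le> (\<Sum>p\<in>pts l. ?h p l)" if l: "l \<in> L" for l
  proof -
    have eq: "(\<Sum>p\<in>pts l. ?h p l) = (\<Sum>y\<in>{y \<in> pts l. d y = 0}. 8 - Q y l)"
      by (rule sum.inter_filter[symmetric]) simp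
    consider "1 \<le> e l" | "\<not> 1 \<le> e l" "\<forall>p\<in>pts l. d p \<le> 0" | "\<not> 1 \<le> e l" "\<not> (\<forall>p\<in>pts l. d p \<le> 0)"
      by argo
    then show ?thesis
    proof cases
      case 1
      obtain p where "p \<in> pts l" "0 < d p" using heavy_has_pos[OF 1] by blast
      then have "\<not> (\<forall>p\<in>pts l. d p \<le> 0)" by (meson not_less)
      moreover have "(\<Sum>y\<in>{y \<in> pts l. d y = 0}. 8 - Q y l) = (\<Sum>y\<in>{y \<in> pts l. d y = 0}. 4)"
        using Q_heavy[of _ l] 1 l by (intro sum.cong) auto
      ultimately show ?thesis using 1 eq by (simp add: n4_def)
    next
      case 2
      then show ?thesis using nonpos_line[OF l] eq by auto
    next
      case 3
      have "0 \<le> (\<Sum>y\<in>{y \<in> pts l. d y = 0}. 8 - Q y l)"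
        using Q_le8[of _ l] l by (intro sum_nonneg) auto
      then show ?thesis unfolding eq if_not_P[OF 3(1)] if_not_P[OF 3(2)] by simp
    qed
  qed
  have "(\<Sum>l\<in>L. ?F l) \<le> (\<Sum>l\<in>L. \<Sum>p\<in>pts l. ?h p l)" by (rule sum_mono) (rule le)
  also have "\<dots> = (\<Sum>p\<in>P. \<Sum>l\<in>lns p. ?h p l)" by (rule sum_flags)
  also have "\<dots> = (\<Sum>p\<in>P. if d p = 0 then 8 else 0)"
    using sum_Q_four by (intro sum.cong) auto
  also have "\<dots> = 8 * int (card Z)" unfolding Z_def by (subst sum_if_const) simp_all
  finally have "(\<Sum>l\<in>L. ?F l) \<le> 8 * int (card Z)" .
  moreover have "(\<Sum>l\<in>L. ?F l) = 4 * (\<Sum>l\<in>{l \<in> L. 1 \<le> e l}. n4 l) + 4 * (\<Sum>l\<in>{l \<in> L. \<forall>p\<in>pts l. d p \<le> 0}. 2 + e l)"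
    unfolding sum.distrib by (simp add: sum.inter_filter[symmetric] sum_distrib_left sum.distrib)
  ultimately show ?thesis by simp
qed

text \<open>At most one of the five line classes through \<open>p\<close> has e \<le> 0, so
  \<open>count_four_classes\<close> yields (|Z| - 4) + (32 - 4 d) \<le> 2 |Z|. This leaves d = 2 and
  |Z| = 20, but then the values of \<open>d\<close> add up to 2 instead of 0.\<close>

lemma not_one_pos:
  assumes p: "p \<in> P" "0 < d p" and np: "\<And>q. q \<in> P \<Longrightarrow> q \<noteq> p \<Longrightarrow> d q \<le> 0"
  shows False
proof -
  have N: "{l \<in> L. \<forall>p\<in>pts l. d p \<le> 0} = L - lns p"
  proof (intro equalityI subsetI)
    fix l assume "l \<in> {l \<in> L. \<forall>p\<in>pts l. d p \<le> 0}"
    then show "l \<in> L - lns p" using p by force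
  next
    fix l assume l: "l \<in> L - lns p"
    then have "d q \<le> 0" if "q \<in> pts l" for q using np[of q] that by auto
    then show "l \<in> {l \<in> L. \<forall>p\<in>pts l. d p \<le> 0}" using l by simp
  qed
  have "(\<Sum>l\<in>L - lns p. 2 + e l) = (\<Sum>l\<in>L. 2 + e l) - (\<Sum>l\<in>lns p. 2 + e l)"
    by (rule sum_diff) (simp, auto)
  also have "\<dots> = 32 - 4 * d p"
    using sum_e sum_e_lns[OF p(1)] card_lns[OF p(1)] card_L by (simp add: sum.distrib)
  finally have sN: "(\<Sum>l\<in>L - lns p. 2 + e l) = 32 - 4 * d p" .
  have H: "{l \<in> L. 1 \<le> e l} = lns p - {l \<in> lns p. e l \<le> 0}"
  proof (intro equalityI subsetI)
    fix l assume l: "l \<in> {l \<in> L. 1 \<le> e l}"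
    obtain q where q: "q \<in> pts l" "0 < d q" using heavy_has_pos[of l] l by auto
    then have "q = p" using np[of q] by force
    then show "l \<in> lns p - {l \<in> lns p. e l \<le> 0}" using q l by auto
  qed auto
  have "(\<Sum>l\<in>{l \<in> lns p. e l \<le> 0}. n4 l) \<le> int (card {l \<in> lns p. e l \<le> 0}) * 4"
  proof (rule sum_bounded_above)
    fix l assume "l \<in> {l \<in> lns p. e l \<le> 0}"
    then show "n4 l \<le> 4" using n4_le[of l "{p}"] p by auto
  qed
  then have "(\<Sum>l\<in>{l \<in> lns p. e l \<le> 0}. n4 l) \<le> 4" using light_le1[OF p] by simp
  then have sH: "int (card Z) - 4 \<le> (\<Sum>l\<in>{l \<in> L. 1 \<le> e l}. n4 l)"
    unfolding H using sum_n4_lns[of p] p by (subst sum_diff) auto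
  have "28 - 4 * d p \<le> int (card Z)"
    using count_four_classes sN sH unfolding N by linarith
  moreover have ZP: "Z \<subseteq> P - {p}" using p by (auto simp: Z_def)
  then have "card Z \<le> 20" using card_mono[OF _ ZP] card_P p by simp
  ultimately have "d p = 2" "card Z = 20" using pos_cases[OF p] by auto
  then have "Z = P - {p}" using card_subset_eq[OF _ ZP] card_P p by simp
  then have "(\<Sum>q\<in>P - {p}. d q) = 0" by (intro sum.neutral) (auto simp: Z_def)
  then show False using sum_d p by (simp add: sum.remove)
qed

text \<open>The same count with the nine line classes through \<open>p\<close> or \<open>q\<close>,
  of which \<open>l0\<close> is the common one. It reduces to \<open>key\<close>, whose right side
  is small because few of these nine have e \<le> 0.\<close>

lemma not_two_pos:
  assumes p: "p \<in> P" "0 < d p" and q: "q \<in> P" "0 < d q" and "p \<noteq> q"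
    and np: "\<And>r. r \<in> P \<Longrightarrow> r \<noteq> p \<Longrightarrow> r \<noteq> q \<Longrightarrow> d r \<le> 0"
  shows False
proof -
  define l0 where "l0 = jn p q"
  have l0: "l0 \<in> L" "I p l0" "I q l0" using jn[OF p(1) q(1) \<open>p \<noteq> q\<close>] by (simp_all add: l0_def)
  have int: "lns p \<inter> lns q = {l0}"
  proof (intro equalityI subsetI)
    fix l assume "l \<in> lns p \<inter> lns q"
    then show "l \<in> {l0}" using jn_eq[of p l q] p q \<open>p \<noteq> q\<close> by (simp add: l0_def)
  qed (use l0 in simp)
  have N: "{l \<in> L. \<forall>p\<in>pts l. d p \<le> 0} = L - (lns p \<union> lns q)"
  proof (intro equalityI subsetI)
    fix l assume "l \<in> {l \<in> L. \<forall>p\<in>pts l. d p \<le> 0}"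
    then show "l \<in> L - (lns p \<union> lns q)" using p q by force
  next
    fix l assume l: "l \<in> L - (lns p \<union> lns q)"
    then have "d r \<le> 0" if "r \<in> pts l" for r using np[of r] that by auto
    then show "l \<in> {l \<in> L. \<forall>p\<in>pts l. d p \<le> 0}" using l by simp
  qed
  have un: "(\<Sum>l\<in>lns p \<union> lns q. h l) = (\<Sum>l\<in>lns p. h l) + (\<Sum>l\<in>lns q. h l) - h l0" for h :: "'l \<Rightarrow> int"
    using sum_Un[of "lns p" "lns q" h] int by simp
  have "(\<Sum>l\<in>L - (lns p \<union> lns q). 2 + e l) = (\<Sum>l\<in>L. 2 + e l) - (\<Sum>l\<in>lns p \<union> lns q. 2 + e l)"
    by (rule sum_diff) (simp, auto)
  also have "\<dots> = 24 - 4 * (d p + d q) + e l0"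
    unfolding un using sum_e sum_e_lns[OF p(1)] sum_e_lns[OF q(1)] card_lns[OF p(1)] card_lns[OF q(1)] card_L
    by (simp add: sum.distrib)
  finally have sN: "(\<Sum>l\<in>L - (lns p \<union> lns q). 2 + e l) = 24 - 4 * (d p + d q) + e l0" .
  let ?Lt = "{l \<in> lns p \<union> lns q. e l \<le> 0}"
  have H: "{l \<in> L. 1 \<le> e l} = (lns p \<union> lns q) - ?Lt"
  proof (intro equalityI subsetI)
    fix l assume l: "l \<in> {l \<in> L. 1 \<le> e l}"
    obtain r where r: "r \<in> pts l" "0 < d r" using heavy_has_pos[of l] l by auto
    then have "r = p \<or> r = q" using np[of r] by force
    then show "l \<in> (lns p \<union> lns q) - ?Lt" using r l by auto
  qed auto
  have "(\<Sum>l\<in>{l \<in> L. 1 \<le> e l}. n4 l) = (\<Sum>l\<in>lns p \<union> lns q. n4 l) - (\<Sum>l\<in>?Lt. n4 l)"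
    unfolding H by (rule sum_diff) auto
  also have "(\<Sum>l\<in>lns p \<union> lns q. n4 l) = 2 * int (card Z) - n4 l0"
    unfolding un using sum_n4_lns[of p] sum_n4_lns[of q] p q by simp
  finally have key: "24 - 4 * (d p + d q) + e l0 \<le> n4 l0 + (\<Sum>l\<in>?Lt. n4 l)"
    using count_four_classes sN unfolding N by linarith
  have n0: "n4 l0 \<le> 3"
    using n4_le[of l0 "{p, q}"] p q l0 \<open>p \<noteq> q\<close> by auto
  have cases: "d p = 1 \<or> d p = 2" "d q = 1 \<or> d q = 2" using pos_cases p q by auto
  show False
  proof (cases "1 \<le> e l0")
    case True
    have "e l0 \<noteq> 2"
    proof
      assume "e l0 = 2"
      from e_two[OF l0(1) this] obtain r where "\<And>s. s \<in> pts l0 \<Longrightarrow> s \<noteq> r \<Longrightarrow> d s = 0" by metis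
      then show False using p q l0 \<open>p \<noteq> q\<close> by (metis in_pts less_irrefl)
    qed
    then have e1: "e l0 = 1" using True e_le2[OF l0(1)] by simp
    \<comment> \<open>Unless both are sixes, the left side of \<open>key\<close> is at least 13 and
      the right side at most 3 + 8. If both are sixes, the left side is 9, and the excess sum 8
      through each leaves no line class with e \<le> 0.\<close>
    show False
    proof (cases "d p + d q = 4")
      case False
      have n4l: "n4 l \<le> 4" if "l \<in> lns p \<union> lns q" for l
        using that
      proof
        assume "l \<in> lns p"
        then show ?thesis using n4_le[of l "{p}"] p by simp
      next
        assume "l \<in> lns q"
        then show ?thesis using n4_le[of l "{q}"] q by simp
      qed
      have "?Lt = {l \<in> lns p. e l \<le> 0} \<union> {l \<in> lns q. e l \<le> 0}" by auto
      then have "card ?Lt \<le> card {l \<in> lns p. e l \<le> 0} + card {l \<in> lns q. e l \<le> 0}"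
        by (simp only: card_Un_le)
      then have "card ?Lt \<le> 2" using light_le1[OF p] light_le1[OF q] by simp
      moreover have "(\<Sum>l\<in>?Lt. n4 l) \<le> int (card ?Lt) * 4"
        by (rule sum_bounded_above) (rule n4l, simp)
      ultimately have "(\<Sum>l\<in>?Lt. n4 l) \<le> 8" by simp
      then show False using key n0 e1 cases False by auto
    next
      case True
      then have dd: "d p = 2" "d q = 2" using cases by auto
      have none: "1 \<le> e l" if r: "r \<in> P" "d r = 2" "r \<in> pts l0" "l \<in> lns r" for l r
      proof (rule ccontr)
        assume "\<not> 1 \<le> e l"
        then have "e l \<le> 0" "l \<noteq> l0" using e1 by auto
        have l0r: "l0 \<in> lns r - {l}" using r l0 \<open>l \<noteq> l0\<close> by auto
        have "(\<Sum>m\<in>lns r. e m) = e l + (e l0 + (\<Sum>m\<in>lns r - {l} - {l0}. e m))"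
          using r(4) l0r by (simp add: sum.remove)
        moreover have "(\<Sum>m\<in>lns r - {l} - {l0}. e m) \<le> int (card (lns r - {l} - {l0})) * 2"
          using e_le2 by (intro sum_bounded_above) auto
        moreover have "card (lns r - {l} - {l0}) = 3" using card_lns[OF r(1)] r(4) l0r by simp
        ultimately show False using sum_e_lns[OF r(1)] r(2) \<open>e l \<le> 0\<close> e1 by simp
      qed
      have "?Lt = {}" using none[OF p(1) dd(1)] none[OF q(1) dd(2)] l0 p q by force
      then have s0: "(\<Sum>l\<in>?Lt. n4 l) = 0" by (simp only: sum.empty)
      show False using key n0 unfolding s0 e1 dd by simp
    qed
  next
    case False
    \<comment> \<open>Hence \<open>e l0 = 0\<close>, and \<open>l0\<close> is the only line class
      with e \<le> 0 through \<open>p\<close> as well as through \<open>q\<close>. In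
      \<open>key\<close> at least 8 now faces at most 3 + 3.\<close>
    have e0: "e l0 \<ge> 0"
    proof -
      have "e l \<le> d p" if "l \<in> lns p - {l0}" for l using e_le_d[OF p] that by simp
      then have "(\<Sum>l\<in>lns p - {l0}. e l) \<le> int (card (lns p - {l0})) * d p" by (rule sum_bounded_above)
      moreover have "card (lns p - {l0}) = 4" using card_lns[OF p(1)] p l0 by simp
      moreover have "(\<Sum>l\<in>lns p. e l) = e l0 + (\<Sum>l\<in>lns p - {l0}. e l)"
        using p l0 by (intro sum.remove) simp_all
      ultimately show ?thesis using sum_e_lns[OF p(1)] by simp
    qed
    have "?Lt \<subseteq> {l0}"
    proof
      fix l assume "l \<in> ?Lt"
      then consider "l \<in> {l \<in> lns p. e l \<le> 0}" | "l \<in> {l \<in> lns q. e l \<le> 0}" by blast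
      then show "l \<in> {l0}"
      proof cases
        case 1
        have "l0 \<in> {l \<in> lns p. e l \<le> 0}" using False l0 by simp
        then show ?thesis using 1 light_le1[OF p] card_le_Suc0_iff_eq[of "{l \<in> lns p. e l \<le> 0}"] by auto
      next
        case 2
        have "l0 \<in> {l \<in> lns q. e l \<le> 0}" using False l0 by simp
        then show ?thesis using 2 light_le1[OF q] card_le_Suc0_iff_eq[of "{l \<in> lns q. e l \<le> 0}"] by auto
      qed
    qed
    then have "(\<Sum>l\<in>?Lt. n4 l) \<le> (\<Sum>l\<in>{l0}. n4 l)" using n4_nonneg by (intro sum_mono2) simp_all
    then show False using key n0 e0 cases by auto
  qed
qed

text \<open>By \<open>light_le1\<close> each of \<open>p\<close> and \<open>q\<close> is joined to
  at most one of the four-point classes of \<open>n\<close> without positive excess. At least two of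
  these classes thus have positive excess towards both; besides \<open>n\<close> only one such line
  class fits (\<open>heavy_le2\<close>), so it joins \<open>p\<close> and \<open>q\<close>.
  Containing two classes of \<open>n\<close>, it would be \<open>n\<close>.\<close>

lemma nice_line:
  assumes n: "n \<in> L" "1 \<le> e n" "p0 \<in> pts n" and z: "\<And>y. y \<in> pts n \<Longrightarrow> y \<noteq> p0 \<Longrightarrow> d y = 0"
    and p: "p \<in> P" "0 < d p" "p \<noteq> p0" and q: "q \<in> P" "0 < d q" "q \<noteq> p0"
  shows "p = q"
proof (rule ccontr)
  assume pq: "p \<noteq> q"
  have off: "r \<notin> pts n" if "r \<in> P" "0 < d r" "r \<noteq> p0" for r using z[of r] that by auto
  let ?S = "pts n - {p0}"
  have cS: "card ?S = 4" using card_pts[OF n(1)] n(3) by simp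
  have light: "card {y \<in> ?S. e (jn y r) \<le> 0} \<le> 1" if r: "r \<in> P" "0 < d r" "r \<noteq> p0" for r
  proof -
    have yr: "y \<noteq> r" if "y \<in> ?S" for y using off[OF r] that by auto
    have "inj_on (\<lambda>y. jn y r) {y \<in> ?S. e (jn y r) \<le> 0}"
    proof (rule inj_onI, rule ccontr)
      fix y y' assume a: "y \<in> {y \<in> ?S. e (jn y r) \<le> 0}" "y' \<in> {y \<in> ?S. e (jn y r) \<le> 0}" "jn y r = jn y' r" "y \<noteq> y'"
      have y: "y \<in> P" "I y n" "y \<noteq> r" and y': "y' \<in> P" "I y' n" "y' \<noteq> r" using a(1,2) yr by simp_all
      note j = jn[OF y(1) r(1) y(3)] and j' = jn[OF y'(1) r(1) y'(3)]
      have "jn y r = n"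
        by (rule join_unique[OF y(1) y'(1) a(4) j(1) n(1) j(2) _ y(2) y'(2)]) (use j'(2) a(3) in simp)
      then show False using j(3) r(1) off[OF r] by simp
    qed
    moreover have "(\<lambda>y. jn y r) ` {y \<in> ?S. e (jn y r) \<le> 0} \<subseteq> {l \<in> lns r. e l \<le> 0}"
    proof (rule image_subsetI)
      fix y assume y: "y \<in> {y \<in> ?S. e (jn y r) \<le> 0}"
      then have "y \<in> P" "y \<noteq> r" using yr by simp_all
      then show "jn y r \<in> {l \<in> lns r. e l \<le> 0}" using jn[of y r] r(1) y by simp
    qed
    ultimately have "card {y \<in> ?S. e (jn y r) \<le> 0} \<le> card {l \<in> lns r. e l \<le> 0}"
      by (rule card_inj_on_le) simp
    then show ?thesis using light_le1[OF r(1,2)] by simp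
  qed
  let ?G = "?S - ({y \<in> ?S. e (jn y p) \<le> 0} \<union> {y \<in> ?S. e (jn y q) \<le> 0})"
  have "card ({y \<in> ?S. e (jn y p) \<le> 0} \<union> {y \<in> ?S. e (jn y q) \<le> 0}) \<le> 2"
    using card_Un_le[of "{y \<in> ?S. e (jn y p) \<le> 0}" "{y \<in> ?S. e (jn y q) \<le> 0}"] light[OF p] light[OF q] by linarith
  then have G2: "2 \<le> card ?G" by (subst card_Diff_subset) (auto simp: cS)
  obtain y where y: "y \<in> ?G" using ex_other[OF G2] by (rule bexE)
  obtain y' where y': "y' \<in> ?G" "y \<noteq> y'" using ex_other[OF G2, of y] by (rule bexE)
  have thru: "jn x p = jn p q" if x: "x \<in> ?G" for x
  proof -
    have xn: "x \<in> pts n" "d x = 0" "x \<noteq> p" "x \<noteq> q" using x z off[OF p] off[OF q] by auto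
    have jp: "jn x p \<in> L" "I x (jn x p)" "I p (jn x p)" using jn[of x p] xn p by auto
    have jq: "jn x q \<in> L" "I x (jn x q)" "I q (jn x q)" using jn[of x q] xn q by auto
    have ne: "jn x p \<noteq> n" "jn x q \<noteq> n" using jp jq off[OF p] off[OF q] p q by auto
    have "{n, jn x p, jn x q} \<subseteq> {l \<in> lns x. 1 \<le> e l}" using x xn n jp jq by auto
    then have "card {n, jn x p, jn x q} \<le> card {l \<in> lns x. 1 \<le> e l}" by (rule card_mono[rotated]) simp
    also have "\<dots> \<le> 2" using heavy_le2[of x] xn(1,2) by simp
    finally have "card {n, jn x p, jn x q} \<le> 2" .
    then have "jn x p = jn x q" using ne by (auto simp: card_insert_if split: if_splits)
    then show ?thesis using jn_eq[of p "jn x p" q] jp jq p q pq by simp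
  qed
  have yn: "y \<in> pts n" "y' \<in> pts n" "y \<noteq> p" "y' \<noteq> p" using y y' off[OF p] by auto
  have "I y (jn p q)" "I y' (jn p q)" "jn p q \<in> L"
    using thru[OF y] thru[OF y'(1)] jn[of y p] jn[of y' p] yn p by auto
  then have "jn p q = n" using join_unique[of y y' "jn p q" n] yn y'(2) n by auto
  then show False using jn[OF p(1) q(1) pq] off[OF p] p by simp
qed

text \<open>By \<open>two_fives_no_four\<close> no value of \<open>d\<close> is 0, so values at most
  1 with sum 1 include at least three ones. Five ones overshoot, and four leave a class with a
  single point, which \<open>not_four_fives_and_one\<close> excludes.\<close>

lemma two_fives_line:
  assumes l: "l \<in> L" "e l = 1" and le1: "\<And>p. p \<in> pts l \<Longrightarrow> d p \<le> 1"
    and p: "p \<in> pts l" "d p = 1" and q: "q \<in> pts l" "d q = 1" "p \<noteq> q"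
  shows "\<And>r. r \<in> pts l \<Longrightarrow> d r = 1 \<or> d r = - 1" and "card {r \<in> pts l. d r = 1} = 3"
proof -
  have five: "weighted_net4.five (\<lambda>p. cnt p l) r" if "r \<in> pts l" "d r = 1" for r
    using five_pattern[of r l] that l by simp
  have nz: "d r \<noteq> 0" if "r \<in> pts l" for r
    using weighted_net4.two_fives_no_four[OF net[OF l(1)] _ p(1) q(1,3) five[OF p] five[OF q(1,2)] that]
      k_eq[OF l(1)] u_eq[OF l(1)] l(2) by simp
  let ?F = "{r \<in> pts l. d r = 1}"
  let ?N = "{r \<in> pts l. d r \<noteq> 1}"
  have FN: "pts l = ?F \<union> ?N" by auto
  have c: "card ?F + card ?N = 5"
    unfolding card_pts[OF l(1), symmetric] by (subst (3) FN, rule card_Un_disjoint[symmetric]) auto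
  have "(\<Sum>r\<in>pts l. d r) = (\<Sum>r\<in>?F. d r) + (\<Sum>r\<in>?N. d r)"
    by (subst FN, rule sum.union_disjoint) auto
  then have s: "(\<Sum>r\<in>?F. d r) + (\<Sum>r\<in>?N. d r) = 1" using l(2) by (simp only: e_def)
  have neg: "d r \<le> - 1" if "r \<in> ?N" for r using le1[of r] nz[of r] that by auto
  have sF: "(\<Sum>r\<in>?F. d r) = int (card ?F)" by simp
  have "(\<Sum>r\<in>?N. d r) \<le> int (card ?N) * (- 1)" by (rule sum_bounded_above) (rule neg)
  then have ge3: "3 \<le> card ?F" using s sF c by linarith
  have ne5: "card ?N \<noteq> 0"
  proof
    assume N0: "card ?N = 0"
    then have "?N = {}" by (subst (asm) card_0_eq) simp_all
    then have "(\<Sum>r\<in>?N. d r) = 0" by (simp only: sum.empty)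
    then show False using s sF c N0 by linarith
  qed
  have ne4: "card ?N \<noteq> 1"
  proof
    assume N1: "card ?N = 1"
    then obtain h where h: "?N = {h}" using card_1_singletonE by blast
    then have hl: "h \<in> pts l" by blast
    have "(\<Sum>r\<in>?N. d r) = d h" unfolding h by simp
    then have dh: "d h = - 3" using s sF c N1 by linarith
    have uh: "weighted_net4.u (\<lambda>p. cnt p l) h = 1" using u_eq[OF l(1), of h] dh by linarith
    show False
    proof (rule weighted_net4.not_four_fives_and_one[OF net[OF l(1)]])
      show "?F \<subseteq> pts l" by blast
      show "card ?F = 4" using c N1 by linarith
    qed (use k_eq[OF l(1)] uh l(2) five hl in simp_all)
  qed
  show c3: "card ?F = 3" using ge3 ne5 ne4 c by linarith
  show "d r = 1 \<or> d r = - 1" if r: "r \<in> pts l" for r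
  proof (cases "d r = 1")
    case False
    then show ?thesis using sum_tight[of ?N d "- 1" r] neg s sF c c3 r by simp
  qed simp
qed

text \<open>When every positive excess comes from sizes 5, 5, 5, 3, 3, each five has a unique line
  class \<open>n0\<close> of excess 0. Parity puts one class \<open>r\<close> with even
  \<open>d\<close> on all of these, and divisibility by 3 makes \<open>r\<close> empty.\<close>

lemma all_d_zero:
  assumes "p \<in> P"
  shows "d p = 0"
proof -
  have no_nice: False
    if n: "n \<in> L" "1 \<le> e n" "p0 \<in> pts n" "0 < d p0" "\<And>y. y \<in> pts n \<Longrightarrow> y \<noteq> p0 \<Longrightarrow> d y = 0" for n p0
  proof (cases "\<exists>q\<in>P. q \<noteq> p0 \<and> 0 < d q")
    case False
    then show False using not_one_pos[of p0] n by (meson in_pts not_less)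
  next
    case True
    then obtain q where q: "q \<in> P" "q \<noteq> p0" "0 < d q" by blast
    have "d r \<le> 0" if "r \<in> P" "r \<noteq> p0" "r \<noteq> q" for r
    proof (rule ccontr)
      assume "\<not> d r \<le> 0"
      then show False using nice_line[OF n(1,2,3) n(5), of r q] that q by auto
    qed
    then show False using not_two_pos[of p0 q] n q by auto
  qed
  have d1: "d p \<le> 1" if "p \<in> P" for p
  proof (rule ccontr)
    assume "\<not> d p \<le> 1"
    then have d2: "d p = 2" using d_le[OF that] by simp
    have "\<exists>l\<in>lns p. e l = 2"
    proof (rule ccontr)
      assume "\<not> ?thesis"
      then have "\<And>l. l \<in> lns p \<Longrightarrow> e l \<le> 1" using e_le2 by (force simp: order.order_iff_strict)
      then have "(\<Sum>l\<in>lns p. e l) \<le> int (card (lns p)) * 1" by (rule sum_bounded_above)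
      then show False using sum_e_lns[OF that] d2 card_lns[OF that] by simp
    qed
    then obtain l where l: "l \<in> L" "e l = 2" by auto
    from e_two[OF l] obtain p0 where "p0 \<in> pts l" "d p0 = 2" "\<And>q. q \<in> pts l \<Longrightarrow> q \<noteq> p0 \<Longrightarrow> d q = 0" by metis
    then show False using no_nice[of l p0] l by simp
  qed
  have line: "e l = 1 \<and> (\<forall>r\<in>pts l. d r = 1 \<or> d r = - 1) \<and> card {r \<in> pts l. d r = 1} = 3"
    if l: "l \<in> L" "1 \<le> e l" for l
  proof -
    obtain p where p: "p \<in> pts l" "0 < d p" using heavy_has_pos[OF l(2)] by blast
    then have dp: "d p = 1" using d1[of p] by simp
    have e1: "e l = 1" using e_le_d[of p l] p dp l by simp
    have "\<exists>q\<in>pts l. q \<noteq> p \<and> d q = 1"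
    proof (rule ccontr)
      assume "\<not> ?thesis"
      then have le0: "\<And>q. q \<in> pts l - {p} \<Longrightarrow> d q \<le> 0" using d1 by force
      have "(\<Sum>q\<in>pts l - {p}. d q) = 0" using p e1 dp by (simp add: e_def sum.remove)
      then have "d q = 0" if "q \<in> pts l" "q \<noteq> p" for q
        using nonpos_sum_zero[of "pts l - {p}" d q] le0 that by simp
      then show False using no_nice[of l p] l p by simp
    qed
    then obtain q where q: "q \<in> pts l" "q \<noteq> p" "d q = 1" by blast
    show ?thesis using two_fives_line[OF l(1) e1 _ p(1) dp q(1,3)] d1 q(2) e1 by auto
  qed
  have "d p \<le> 0" if "p \<in> P" for p
  proof (rule ccontr)
    let ?F = "{p \<in> P. d p = 1}"
    assume "\<not> d p \<le> 0"
    then have pF: "p \<in> ?F" using d1[OF that] that by auto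
    have ex_light: "\<exists>l. {l \<in> lns p. e l \<le> 0} = {l} \<and> e l = 0" if "p \<in> ?F" for p
    proof -
      have p: "p \<in> P" "0 < d p" "d p = 1" using that by auto
      have "{l \<in> lns p. e l \<le> 0} \<noteq> {}"
      proof
        assume "{l \<in> lns p. e l \<le> 0} = {}"
        then have "\<And>l. l \<in> lns p \<Longrightarrow> e l = 1" using line by force
        then show False using sum_e_lns[OF p(1)] p card_lns[OF p(1)] by simp
      qed
      then have "card {l \<in> lns p. e l \<le> 0} \<noteq> 0" by (subst card_0_eq) simp_all
      then have "card {l \<in> lns p. e l \<le> 0} = 1" using light_le1[OF p(1,2)] by linarith
      then obtain l where l: "{l \<in> lns p. e l \<le> 0} = {l}" using card_1_singletonE by blast
      then have ll: "l \<in> lns p" by blast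
      have "e m = 1" if "m \<in> lns p - {l}" for m
      proof -
        have "\<not> e m \<le> 0" using l that by blast
        then show ?thesis using line[of m] that by auto
      qed
      then have "(\<Sum>m\<in>lns p - {l}. e m) = 4" using card_lns[OF p(1)] ll by simp
      then have "e l = 0" using sum_e_lns[OF p(1)] p ll by (simp add: sum.remove)
      then show ?thesis using l by blast
    qed
    define n0 where "n0 p = (THE l. {l \<in> lns p. e l \<le> 0} = {l})" for p
    have n0: "{l \<in> lns p. e l \<le> 0} = {n0 p}" "e (n0 p) = 0" if "p \<in> ?F" for p
    proof -
      obtain l where l: "{l \<in> lns p. e l \<le> 0} = {l}" "e l = 0" using ex_light[OF \<open>p \<in> ?F\<close>] by blast
      then have "n0 p = l" unfolding n0_def by (intro the_equality) auto
      then show "{l \<in> lns p. e l \<le> 0} = {n0 p}" "e (n0 p) = 0" using l by auto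
    qed
    have n0L: "n0 p \<in> L" "p \<in> pts (n0 p)" if "p \<in> ?F" for p
      using n0(1)[OF that] that by auto
    have heavy: "1 \<le> e l" if "p \<in> ?F" "l \<in> lns p" "l \<noteq> n0 p" for p l
      using n0(1)[OF that(1)] that(2,3) by force
    have off: "d r = 1 \<or> d r = - 1" if p: "p \<in> ?F" and r: "r \<in> P" "r \<notin> pts (n0 p)" for p r
    proof -
      have pr: "p \<noteq> r" "p \<in> P" using r n0L[OF p] p by auto
      have j: "jn p r \<in> lns p" "r \<in> pts (jn p r)" using jn[OF pr(2) r(1) pr(1)] r by auto
      then have "jn p r \<noteq> n0 p" using r by auto
      then show ?thesis using line[of "jn p r"] heavy[OF p j(1)] j by auto
    qed
    \<comment> \<open>Five odd numbers cannot add up to the excess 0.\<close>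
    have ex_even: "\<exists>r\<in>pts (n0 p). even (d r)" if p: "p \<in> ?F" for p
    proof (rule ccontr)
      assume "\<not> ?thesis"
      then have "even (\<Sum>r\<in>pts (n0 p). d r + 1)" by (intro dvd_sum) auto
      then show False using n0(2)[OF p] card_pts[OF n0L(1)[OF p]] by (simp add: e_def sum.distrib)
    qed
    obtain r where r: "r \<in> P" "even (d r)" using ex_even[OF pF] by auto
    have rn: "r \<in> pts (n0 p)" if "p \<in> ?F" for p
    proof (rule ccontr)
      assume "r \<notin> pts (n0 p)"
      from off[OF that r(1) this] r(2) show False by auto
    qed
    have rF: "r \<notin> ?F" using r by auto
    \<comment> \<open>\<open>p\<close> and two further fives on each of its four line classes with
      positive excess. As a line class has only five members, \<open>n0\<close> cannot be constant,
      which makes \<open>r\<close> the only class with even \<open>d\<close>.\<close>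
    have cF: "9 \<le> card ?F"
    proof -
      let ?H = "lns p - {n0 p}"
      have cH: "card ?H = 4" using card_lns[of p] pF n0L[OF pF] by simp
      let ?G = "\<lambda>l. {r \<in> pts l. d r = 1} - {p}"
      have "card (\<Union>l\<in>?H. ?G l) = (\<Sum>l\<in>?H. card (?G l))"
      proof (rule card_UN_disjoint)
        show "\<forall>i\<in>?H. \<forall>j\<in>?H. i \<noteq> j \<longrightarrow> ?G i \<inter> ?G j = {}"
        proof (intro ballI impI, rule ccontr)
          fix i j assume ij: "i \<in> ?H" "j \<in> ?H" "i \<noteq> j" "?G i \<inter> ?G j \<noteq> {}"
          then obtain x where "x \<in> ?G i" "x \<in> ?G j" by blast
          then show False using meet_unique[of i j x p] ij pF by auto
        qed
      qed auto
      also have "\<dots> = (\<Sum>l\<in>?H. 2)"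
      proof (rule sum.cong)
        fix l assume l: "l \<in> ?H"
        then have "card {r \<in> pts l. d r = 1} = 3" using line[of l] heavy[OF pF, of l] by auto
        then show "card (?G l) = 2" using l pF by simp
      qed simp
      finally have "card (\<Union>l\<in>?H. ?G l) = 8" using cH by simp
      then have "card (insert p (\<Union>l\<in>?H. ?G l)) = 9" by (subst card_insert_disjoint) auto
      moreover have "insert p (\<Union>l\<in>?H. ?G l) \<subseteq> ?F" using pF by auto
      ultimately show ?thesis using card_mono[of ?F "insert p (\<Union>l\<in>?H. ?G l)"] by simp
    qed
    obtain p' where p': "p' \<in> ?F" "n0 p' \<noteq> n0 p"
    proof -
      have "\<not> ?F \<subseteq> pts (n0 p)"
      proof
        assume "?F \<subseteq> pts (n0 p)"
        then have "card ?F \<le> 5" using card_mono[of "pts (n0 p)" ?F] card_pts[OF n0L(1)[OF pF]] by simp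
        then show False using cF by simp
      qed
      then obtain p' where "p' \<in> ?F" "p' \<notin> pts (n0 p)" by blast
      moreover from this have "n0 p' \<noteq> n0 p" using n0L[of p'] by auto
      ultimately show thesis using that by blast
    qed
    have pm: "d s = 1 \<or> d s = - 1" if s: "s \<in> P" "s \<noteq> r" for s
    proof (cases "s \<in> pts (n0 p)")
      case True
      have "s \<notin> pts (n0 p')"
        using meet_unique[of "n0 p'" "n0 p" s r] p' n0L[OF pF] n0L[OF p'(1)] rn[OF pF] rn[OF p'(1)] True s by auto
      then show ?thesis using off[OF p'(1) s(1)] by blast
    qed (use off[OF pF s(1)] in blast)
    have sumF: "2 * int (card ?F) = 20 - d r"
    proof -
      have "(\<Sum>s\<in>P - {r}. d s + 1) = (\<Sum>s\<in>P - {r}. if d s = 1 then 2 else 0)"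
      proof (rule sum.cong)
        fix s assume "s \<in> P - {r}"
        then show "d s + 1 = (if d s = 1 then 2 else 0)" using pm[of s] by auto
      qed simp
      also have "\<dots> = (\<Sum>s\<in>{s \<in> P - {r}. d s = 1}. 2)"
        by (rule sum.inter_filter[symmetric]) simp
      also have "{s \<in> P - {r}. d s = 1} = ?F" using rF r(1) by auto
      finally have "(\<Sum>s\<in>P - {r}. d s + 1) = 2 * int (card ?F)" by simp
      moreover have "(\<Sum>s\<in>P - {r}. d s + 1) = 20 - d r"
        using sum_d r card_P by (simp add: sum.distrib sum_diff1)
      ultimately show ?thesis by simp
    qed
    \<comment> \<open>Incidences of fives with line classes of positive excess: four for each five,
      three for each line class.\<close>
    have "4 * card ?F = 3 * card {l \<in> L. 1 \<le> e l}"
    proof -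
      have "(\<Sum>l\<in>L. \<Sum>p\<in>pts l. if d p = 1 \<and> 1 \<le> e l then 1 else 0)
          = (\<Sum>p\<in>P. \<Sum>l\<in>lns p. if d p = 1 \<and> 1 \<le> e l then 1 else (0::nat))"
        by (rule sum_flags)
      also have "\<dots> = (\<Sum>p\<in>P. if d p = 1 then 4 else 0)"
      proof (rule sum.cong)
        fix p assume "p \<in> P"
        show "(\<Sum>l\<in>lns p. if d p = 1 \<and> 1 \<le> e l then 1 else (0::nat)) = (if d p = 1 then 4 else 0)"
        proof (cases "d p = 1")
          case True
          then have p: "p \<in> ?F" using \<open>p \<in> P\<close> by simp
          have "{l \<in> lns p. d p = 1 \<and> 1 \<le> e l} = lns p - {n0 p}"
          proof (intro equalityI subsetI)
            fix l assume "l \<in> {l \<in> lns p. d p = 1 \<and> 1 \<le> e l}"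
            then show "l \<in> lns p - {n0 p}" using n0(2)[OF p] by auto
          next
            fix l assume "l \<in> lns p - {n0 p}"
            then show "l \<in> {l \<in> lns p. d p = 1 \<and> 1 \<le> e l}" using heavy[OF p, of l] True by simp
          qed
          moreover have "card (lns p - {n0 p}) = 4" using card_lns[OF \<open>p \<in> P\<close>] n0L[OF p] \<open>p \<in> P\<close> by simp
          ultimately show ?thesis using True by (simp only: sum_if_const finite_lns) simp
        qed simp
      qed simp
      also have "\<dots> = 4 * card ?F" by (subst sum_if_const) simp_all
      finally have "(\<Sum>l\<in>L. \<Sum>p\<in>pts l. if d p = 1 \<and> 1 \<le> e l then 1 else (0::nat)) = 4 * card ?F" .
      moreover have "(\<Sum>l\<in>L. \<Sum>p\<in>pts l. if d p = 1 \<and> 1 \<le> e l then 1 else (0::nat))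
          = (\<Sum>l\<in>L. if 1 \<le> e l then 3 else 0)"
      proof (rule sum.cong)
        fix l assume l: "l \<in> L"
        show "(\<Sum>p\<in>pts l. if d p = 1 \<and> 1 \<le> e l then 1 else (0::nat)) = (if 1 \<le> e l then 3 else 0)"
        proof (cases "1 \<le> e l")
          case True
          then have "card {p \<in> pts l. d p = 1 \<and> 1 \<le> e l} = 3" using line[OF l True] by simp
          then show ?thesis using True by (simp only: sum_if_const finite_pts) simp
        qed simp
      qed simp
      moreover have "(\<Sum>l\<in>L. if 1 \<le> e l then 3 else 0) = 3 * card {l \<in> L. 1 \<le> e l}"
        by (subst sum_if_const) simp_all
      ultimately show ?thesis by (simp only:)
    qed
    then have "3 dvd 4 * card ?F" by (metis dvd_triv_left)
    \<comment> \<open>The values 0, -2, -4 of \<open>d r\<close> correspond to 10, 11, 12 fives;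
      only 12 is a multiple of 3.\<close>
    then have "3 dvd card ?F" by presburger
    moreover have "d r \<le> 0" using d1[OF r(1)] r(2) by presburger
    ultimately have dr: "d r = - 4" using sumF d_ge[of r] by presburger
    have pl: "n0 p \<in> L" using n0L[OF pF] by simp
    have rp: "r \<in> pts (n0 p)" using rn[OF pF] .
    have sum4: "(\<Sum>s\<in>pts (n0 p) - {r}. d s) = 4" using n0(2)[OF pF] dr rp by (simp add: e_def sum.remove)
    have c4: "card (pts (n0 p) - {r}) = 4" using card_pts[OF pl] rp by simp
    have "d s = 1" if "s \<in> pts (n0 p) - {r}" for s
      using sum_tight[of "pts (n0 p) - {r}" d 1 s] d1 sum4 c4 that by simp
    then have fives: "weighted_net4.five (\<lambda>s. cnt s (n0 p)) s" if "s \<in> pts (n0 p) - {r}" for s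
      using five_pattern[of s "n0 p"] that pl by simp
    have ur: "weighted_net4.u (\<lambda>s. cnt s (n0 p)) r = 0" using u_eq[OF pl, of r] dr by linarith
    show False
    proof (rule weighted_net4.not_four_fives_and_zero[OF net[OF pl] _ _ c4])
      show "pts (n0 p) - {r} \<subseteq> pts (n0 p)" by blast
    qed (use k_eq[OF pl] ur n0(2)[OF pF] fives rp in simp_all)
  qed
  then show ?thesis using nonpos_sum_zero[of P d p] sum_d assms by simp
qed

text \<open>Summed by point classes the squares give 21 * 32, and each of the 21 line classes gives
  at most 32; so the equality case of \<open>all_four\<close> applies to all of them.\<close>

lemma weight_two_or_six:
  assumes l: "l \<in> L" and b: "b \<in> B"
  shows "(\<Sum>p\<in>pts l. cnt p l (g l p b)) = 2 \<or> (\<Sum>p\<in>pts l. cnt p l (g l p b)) = 6"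
proof -
  have e0: "e l = 0" if "l \<in> L" for l using all_d_zero by (simp add: e_def)
  have le: "(\<Sum>m\<in>pts l. Q m l) \<le> 32" if "l \<in> L" for l
    using weighted_net4.all_four(1)[OF net[OF that]] k_eq[OF that] u_eq[OF that] q_eq[OF that] all_d_zero e0[OF that] by simp
  have "(\<Sum>l\<in>L. \<Sum>p\<in>pts l. Q p l) = (\<Sum>p\<in>P. 32)"
    unfolding sum_flags using sum_Q all_d_zero by (intro sum.cong) auto
  then have "(\<Sum>m\<in>pts l. Q m l) = 32"
    using sum_tight[of L "\<lambda>l. \<Sum>m\<in>pts l. Q m l" 32 l] le l card_P card_L by simp
  then have "weighted_net4.D (pts l) (g l) (\<lambda>p. cnt p l) b = 0 \<or> weighted_net4.D (pts l) (g l) (\<lambda>p. cnt p l) b = 4"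
    using weighted_net4.all_four(2)[OF net[OF l]] k_eq[OF l] u_eq[OF l] q_eq[OF l] all_d_zero e0[OF l] b by simp
  then show ?thesis by (auto simp: weighted_net4.D_def[OF net[OF l]])
qed

text \<open>A Baer-like section: one point and one line per neighbour class, forming a projective plane of
  order 4. Counting incidences of the arc with its 21 lines gives 0 modulo 4, while every line
  has weight 2 modulo 4.\<close>
lemma no_section:
  assumes opt: "\<And>p. p \<in> P \<Longrightarrow> opt p \<in> A" and oln: "\<And>l. l \<in> L \<Longrightarrow> oln l \<in> B"
    and inc: "\<And>p l. p \<in> P \<Longrightarrow> l \<in> L \<Longrightarrow> I p l \<Longrightarrow> f p l (opt p) = g l p (oln l)"
  shows False
proof -
  have pt: "4 dvd (\<Sum>l\<in>lns p. cnt p l (f p l (opt p)))" if p: "p \<in> P" for p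
  proof -
    have c4: "card (cls p) = 4" using all_d_zero[OF p] by (simp add: d_def)
    have "(\<Sum>l\<in>lns p. cnt p l (f p l (opt p))) = (\<Sum>l\<in>lns p. \<Sum>a\<in>cls p. if f p l a = f p l (opt p) then 1 else 0)"
      by (simp add: cnt_def sum_if_const)
    also have "\<dots> = (\<Sum>a\<in>cls p. \<Sum>l\<in>lns p. if f p l a = f p l (opt p) then 1 else 0)"
      by (rule sum.swap)
    \<comment> \<open>Another point shares a segment with \<open>opt p\<close> in one direction,
      \<open>opt p\<close> itself in all five.\<close>
    also have "\<dots> = (\<Sum>a\<in>cls p. 1 + (if a = opt p then 4 else 0))"
    proof (rule sum.cong)
      fix a assume a: "a \<in> cls p"
      have "(\<Sum>l\<in>lns p. if f p l a = f p l (opt p) then 1 else (0::int)) = int (card {l \<in> lns p. f p l a = f p l (opt p)})"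
        by (subst sum_if_const) simp_all
      then show "(\<Sum>l\<in>lns p. if f p l a = f p l (opt p) then 1 else (0::int)) = 1 + (if a = opt p then 4 else 0)"
        using net4.card_joining[OF point_net[OF p], of a "opt p"] a cls_sub[of p] opt[OF p] card_lns[OF p]
        by (auto simp: lns_def)
    qed simp
    also have "\<dots> = 4 + (if opt p \<in> cls p then 4 else 0)" by (simp add: sum.distrib c4)
    finally show ?thesis by simp
  qed
  have "(\<Sum>l\<in>L. \<Sum>p\<in>pts l. cnt p l (g l p (oln l))) = (\<Sum>p\<in>P. \<Sum>l\<in>lns p. cnt p l (g l p (oln l)))"
    by (rule sum_flags)
  also have "\<dots> = (\<Sum>p\<in>P. \<Sum>l\<in>lns p. cnt p l (f p l (opt p)))"
    using inc by (intro sum.cong) auto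
  finally have "4 dvd (\<Sum>l\<in>L. \<Sum>p\<in>pts l. cnt p l (g l p (oln l)))"
    using dvd_sum[of P 4 "\<lambda>p. \<Sum>l\<in>lns p. cnt p l (f p l (opt p))"] pt by simp
  moreover have "4 dvd (\<Sum>l\<in>L. (\<Sum>p\<in>pts l. cnt p l (g l p (oln l))) - 2)"
    by (rule dvd_sum) (use weight_two_or_six[OF _ oln] in force)
  \<comment> \<open>This difference is 2 * 21 = 42.\<close>
  ultimately have "4 dvd (\<Sum>l\<in>L. \<Sum>p\<in>pts l. cnt p l (g l p (oln l))) - (\<Sum>l\<in>L. (\<Sum>p\<in>pts l. cnt p l (g l p (oln l))) - 2)"
    by (rule dvd_diff)
  then show False by (simp add: sum_subtractf card_L)
qed

end

text \<open>Some class has at least five points. Deleting a point outside it leaves an arc of 84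
  points that still has this class, against \<open>all_d_zero\<close>.\<close>

lemma (in hjelmslev4) no_arc_85:
  assumes K: "K \<subseteq> P \<times> A" and K85: "card K = 85"
    and arc: "\<And>l b. l \<in> L \<Longrightarrow> b \<in> B \<Longrightarrow> card {x \<in> K. I (fst x) l \<and> f (fst x) l (snd x) = g l (fst x) b} \<le> 6"
  shows False
proof -
  have fin: "finite K" using K85 by (intro card_ge_0_finite) simp
  have cls_fin: "finite {a. (p, a) \<in> K}" for p
    by (rule finite_subset[OF _ finite_imageI[OF fin, of snd]]) force
  have sumK: "(\<Sum>p\<in>P. card {a. (p, a) \<in> K}) = 85"
  proof -
    have "Sigma P (\<lambda>p. {a. (p, a) \<in> K}) = K" using K by auto
    then have "card (Sigma P (\<lambda>p. {a. (p, a) \<in> K})) = 85" using K85 by simp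
    then show ?thesis using cls_fin by simp
  qed
  obtain p where p: "p \<in> P" "5 \<le> card {a. (p, a) \<in> K}"
  proof -
    have "\<exists>p\<in>P. 5 \<le> card {a. (p, a) \<in> K}"
    proof (rule ccontr)
      assume "\<not> ?thesis"
      then have "\<And>p. p \<in> P \<Longrightarrow> card {a. (p, a) \<in> K} \<le> 4" by force
      then have "(\<Sum>p\<in>P. card {a. (p, a) \<in> K}) \<le> of_nat (card P) * 4" by (rule sum_bounded_above)
      then show False using sumK card_P by simp
    qed
    then show thesis using that by blast
  qed
  have A16: "card A = 16" "finite A" using net4.card_B[OF point_net[OF p(1)]] net4.finite_B[OF point_net[OF p(1)]] by auto
  have "\<not> K \<subseteq> {p} \<times> A"
  proof
    assume "K \<subseteq> {p} \<times> A"
    then have "card K \<le> card ({p} \<times> A)" using A16(2) by (intro card_mono) auto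
    then show False using K85 A16 by simp
  qed
  then obtain x where x: "x \<in> K" "fst x \<noteq> p" using K by fastforce
  interpret hjelmslev4_arc P L I A B f g "K - {x}"
  proof
    show "K - {x} \<subseteq> P \<times> A" using K by blast
    show "card (K - {x}) = 84" using K85 x fin by simp
    fix l b assume "l \<in> L" "b \<in> B"
    have "card {y \<in> K - {x}. I (fst y) l \<and> f (fst y) l (snd y) = g l (fst y) b}
        \<le> card {y \<in> K. I (fst y) l \<and> f (fst y) l (snd y) = g l (fst y) b}"
      using fin by (intro card_mono) auto
    then show "card {y \<in> K - {x}. I (fst y) l \<and> f (fst y) l (snd y) = g l (fst y) b} \<le> 6"
      using arc[OF \<open>l \<in> L\<close> \<open>b \<in> B\<close>] by linarith
  qed
  have "cls p = {a. (p, a) \<in> K}" using x by (auto simp: cls_def)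
  then show False using all_d_zero[OF p(1)] p(2) by (simp add: d_def)
qed

section \<open>The field with four elements and its projective plane\<close>

instantiation gf4 :: comm_ring_1
begin

definition zero_gf4 :: gf4 where "0 = F0"
definition one_gf4 :: gf4 where "1 = F1"
definition plus_gf4 :: "gf4 \<Rightarrow> gf4 \<Rightarrow> gf4" where
  "x + y = (case x of F0 \<Rightarrow> y
    | F1 \<Rightarrow> (case y of F0 \<Rightarrow> F1 | F1 \<Rightarrow> F0 | Fw \<Rightarrow> Fv | Fv \<Rightarrow> Fw)
    | Fw \<Rightarrow> (case y of F0 \<Rightarrow> Fw | F1 \<Rightarrow> Fv | Fw \<Rightarrow> F0 | Fv \<Rightarrow> F1)
    | Fv \<Rightarrow> (case y of F0 \<Rightarrow> Fv | F1 \<Rightarrow> Fw | Fw \<Rightarrow> F1 | Fv \<Rightarrow> F0))"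
definition times_gf4 :: "gf4 \<Rightarrow> gf4 \<Rightarrow> gf4" where
  "x * y = (case x of F0 \<Rightarrow> F0 | F1 \<Rightarrow> y
    | Fw \<Rightarrow> (case y of F0 \<Rightarrow> F0 | F1 \<Rightarrow> Fw | Fw \<Rightarrow> Fv | Fv \<Rightarrow> F1)
    | Fv \<Rightarrow> (case y of F0 \<Rightarrow> F0 | F1 \<Rightarrow> Fv | Fw \<Rightarrow> F1 | Fv \<Rightarrow> Fw))"
definition uminus_gf4 :: "gf4 \<Rightarrow> gf4" where "- (x :: gf4) = x"
definition minus_gf4 :: "gf4 \<Rightarrow> gf4 \<Rightarrow> gf4" where "(x :: gf4) - y = x + y"

lemmas gf4_defs = zero_gf4_def one_gf4_def plus_gf4_def times_gf4_def uminus_gf4_def minus_gf4_def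

instance
proof
  fix a b c :: gf4
  show "a + b + c = a + (b + c)" by (cases a; cases b; cases c) (simp_all add: gf4_defs)
  show "a + b = b + a" by (cases a; cases b) (simp_all add: gf4_defs)
  show "0 + a = a" by (simp add: gf4_defs)
  show "- a + a = 0" by (cases a) (simp_all add: gf4_defs)
  show "a - b = a + - b" by (simp add: gf4_defs)
  show "a * b * c = a * (b * c)" by (cases a; cases b; cases c) (simp_all add: gf4_defs)
  show "a * b = b * a" by (cases a; cases b) (simp_all add: gf4_defs)
  show "1 * a = a" by (simp add: gf4_defs)
  show "(a + b) * c = a * c + b * c" by (cases a; cases b; cases c) (simp_all add: gf4_defs)
  show "(0::gf4) \<noteq> 1" by (simp add: gf4_defs)
qed

end

lemma gf4_add_self [simp]: "x + x = (0::gf4)"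
  by (cases x) (simp_all add: gf4_defs)

lemma gf4_two [simp]: "(2::gf4) = 0"
  by (simp only: one_add_one[symmetric] gf4_add_self)

lemma gf4_add_eq_0 [simp]: "x + y = (0::gf4) \<longleftrightarrow> x = y"
  by (cases x; cases y) (simp_all add: gf4_defs)

lemma gf4_cube: "x \<noteq> (0::gf4) \<Longrightarrow> x * (x * x) = 1"
  by (cases x) (simp_all add: gf4_defs)

type_synonym vec3 = "gf4 \<times> gf4 \<times> gf4"

fun dot :: "vec3 \<Rightarrow> vec3 \<Rightarrow> gf4" where
  "dot (x, y, z) (x', y', z') = x * x' + y * y' + z * z'"

text \<open>Vectors whose first nonzero entry is 1 represent the points, and dually the lines, of the
  projective plane of order 4. The function ins places the two free coordinates of a point over p,
  leaving 0 at the pivot of p.\<close>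
definition nvecs :: "vec3 list" where
  "nvecs = map (\<lambda>(a, b). (F1, a, b)) (List.product [F0, F1, Fw, Fv] [F0, F1, Fw, Fv])
    @ map (\<lambda>b. (F0, F1, b)) [F0, F1, Fw, Fv] @ [(F0, F0, F1)]"

fun ins :: "vec3 \<Rightarrow> gf4 \<times> gf4 \<Rightarrow> vec3" where
  "ins (x, y, z) (s, t) = (if x \<noteq> F0 then (F0, s, t) else if y \<noteq> F0 then (s, F0, t) else (s, t, F0))"

definition pairs4 :: "(gf4 \<times> gf4) list" where
  "pairs4 = List.product [F0, F1, Fw, Fv] [F0, F1, Fw, Fv]"

lemma nvecs_card: "distinct nvecs \<and> length nvecs = 21"
  by code_simp

lemma nvecs_five: "\<forall>p\<in>set nvecs. length (filter (\<lambda>l. dot l p = F0) nvecs) = 5"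
  by code_simp

lemma nvecs_join: "\<forall>p\<in>set nvecs. \<forall>q\<in>set nvecs. p = q \<or> length (filter (\<lambda>l. dot l p = F0 \<and> dot l q = F0) nvecs) = 1"
  by code_simp

text \<open>Two distinct lines through \<open>p\<close> share only the multiples of
  \<open>p\<close>, and \<open>ins p c\<close> is 0 at the pivot of \<open>p\<close>, where a
  nonzero multiple is not.\<close>

lemma nvecs_kernel: "\<forall>p\<in>set nvecs. \<forall>l\<in>set (filter (\<lambda>l. dot l p = F0) nvecs). \<forall>l'\<in>set (filter (\<lambda>l. dot l p = F0) nvecs).
   l = l' \<or> (\<forall>c\<in>set pairs4. dot l (ins p c) = F0 \<and> dot l' (ins p c) = F0 \<longrightarrow> c = (F0, F0))"
  by code_simp

lemma in_pairs4: "c \<in> set pairs4"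
  by (cases c; cases "fst c"; cases "snd c") (auto simp: pairs4_def)

lemma in_nvecs: "(x, y, z) \<in> set nvecs \<longleftrightarrow> x = 1 \<or> x = 0 \<and> y = 1 \<or> x = 0 \<and> y = 0 \<and> z = 1"
  by (cases x; cases y; cases z) (auto simp: nvecs_def one_gf4_def zero_gf4_def)

lemma dot_commute: "dot u v = dot v u"
  by (cases u; cases v) (simp add: mult.commute)

lemma dot_ins_add: "dot l (ins p (s, t)) + dot l (ins p (s', t')) = dot l (ins p (s + s', t + t'))"
  by (cases l; cases p) (auto simp: algebra_simps zero_gf4_def[symmetric])

lemma card_filter_nvecs: "card {l \<in> set nvecs. Q l} = length (filter Q nvecs)"
  using nvecs_card by (metis distinct_card distinct_filter set_filter)

text \<open>By additivity, equal labels at \<open>a\<close> and \<open>b\<close> put their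
  difference, which is their sum in characteristic 2, into the common kernel. This is the
  \<open>sep\<close> axiom of the point nets and, with roles exchanged, of the line nets.\<close>

lemma kernel:
  assumes "p \<in> set nvecs" "l \<in> set nvecs" "l' \<in> set nvecs" "l \<noteq> l'" "dot l p = 0" "dot l' p = 0"
    "dot l (ins p a) = dot l (ins p b)" "dot l' (ins p a) = dot l' (ins p b)"
  shows "a = b"
proof -
  obtain s t where a: "a = (s, t)" by (cases a)
  obtain s' t' where b: "b = (s', t')" by (cases b)
  have "dot l (ins p (s + s', t + t')) = 0" "dot l' (ins p (s + s', t + t')) = 0"
    using assms(7,8) unfolding a b by (simp_all flip: dot_ins_add)
  moreover have m: "l \<in> set (filter (\<lambda>l. dot l p = F0) nvecs)" "l' \<in> set (filter (\<lambda>l. dot l p = F0) nvecs)"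
    using assms by (simp_all add: zero_gf4_def)
  ultimately have "(s + s', t + t') = (F0, F0)"
    using bspec[OF bspec[OF bspec[OF nvecs_kernel assms(1)] m(1)] m(2)] assms(4) in_pairs4
    unfolding zero_gf4_def by blast
  then show ?thesis unfolding a b by (simp flip: zero_gf4_def)
qed

lemma join_card:
  assumes "p \<in> set nvecs" "q \<in> set nvecs" "p \<noteq> q"
  shows "card {l \<in> set nvecs. dot l p = 0 \<and> dot l q = 0} = 1"
  unfolding card_filter_nvecs using nvecs_join assms unfolding zero_gf4_def by blast

fun map3 :: "(gf4 \<Rightarrow> gf4) \<Rightarrow> vec3 \<Rightarrow> vec3" where
  "map3 h (x, y, z) = (h x, h y, h z)"

text \<open>Each of the three rings is modelled on gf4 \<times> gf4 with product (a c, a d + b tau c) and sum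
  (a + c, b + d + kap a c) of (a, b) and (c, d): tau is the Frobenius map for T4 and the identity
  otherwise, and kap is the carry of the Galois ring and 0 otherwise.\<close>
locale gf4_twist =
  fixes tau :: "gf4 \<Rightarrow> gf4" and kap :: "gf4 \<Rightarrow> gf4 \<Rightarrow> gf4"
  assumes tau_add: "tau (x + y) = tau x + tau y"
    and tau_mult: "tau (x * y) = tau x * tau y"
    and tau_one: "tau 1 = 1"
    and kap_commute: "kap x y = kap y x"
    and kap_cocycle: "kap x y + kap (x + y) z = kap y z + kap x (y + z)"
    and kap_left: "x * kap y z = kap (x * y) (x * z)"
    and kap_right: "kap y z * tau x = kap (y * x) (z * x)"
    and kap_zero: "kap 0 x = 0"
begin

lemma tau_zero [simp]: "tau 0 = 0"
  using tau_add[of 0 0] by simp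

lemma tau_eq_0: "tau x = 0 \<longleftrightarrow> x = 0"
proof
  assume "tau x = 0"
  show "x = 0"
  proof (rule ccontr)
    assume "x \<noteq> 0"
    then have "tau (x * (x * x)) = 1" using gf4_cube tau_one by simp
    then show False using \<open>tau x = 0\<close> by (simp add: tau_mult)
  qed
qed simp

lemma tau_inj: "tau x = tau y \<longleftrightarrow> x = y"
  using tau_eq_0[of "x + y"] by (simp add: tau_add)

definition ff :: "vec3 \<Rightarrow> vec3 \<Rightarrow> gf4 \<times> gf4 \<Rightarrow> gf4" where
  "ff p l a = dot l (ins p a)"

text \<open>The carries arising when the three products of leading digits are added; they depend
  only on the two classes.\<close>

fun gam :: "vec3 \<Rightarrow> vec3 \<Rightarrow> gf4" where
  "gam (l1, l2, l3) (p1, p2, p3) = kap (l1 * p1) (l2 * p2) + kap (l1 * p1 + l2 * p2) (l3 * p3)"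

text \<open>Expanding the equation of a line at a point, the second digit is \<open>ff p l a\<close>
  plus this term, and in characteristic 2 it vanishes iff the two agree.\<close>

definition gg :: "vec3 \<Rightarrow> vec3 \<Rightarrow> gf4 \<times> gf4 \<Rightarrow> gf4" where
  "gg l p b = dot (ins l b) (map3 tau p) + gam l p"

lemma tau_nvecs: "map3 tau p \<in> set nvecs \<longleftrightarrow> p \<in> set nvecs"
  using tau_inj[of _ 1] by (cases p) (auto simp: in_nvecs tau_eq_0 tau_one)

lemma map3_inj: "map3 tau p = map3 tau q \<longleftrightarrow> p = q"
  by (cases p; cases q) (auto simp: tau_inj)

lemma ins_map3: "ins (map3 tau l) b = ins l b"
  by (cases l; cases b) (auto simp: tau_eq_0 simp flip: zero_gf4_def)

lemma dot_map3: "dot (map3 tau p) (map3 tau l) = tau (dot p l)"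
  by (cases p; cases l) (simp add: tau_add tau_mult)

text \<open>For the line nets \<open>kernel\<close> is applied to the images under
  \<open>tau\<close>, which keep pivots and incidence; the shift \<open>gam\<close> cancels from
  both labels.\<close>

lemma hjelmslev4: "hjelmslev4 (set nvecs) (set nvecs) (\<lambda>p l. dot l p = 0) UNIV UNIV ff gg"
proof (rule hjelmslev4.intro)
  show "card (set nvecs) = 21" "card (set nvecs) = 21" using nvecs_card by (simp_all add: distinct_card)
  have c16: "card (UNIV :: (gf4 \<times> gf4) set) = 16"
    by (simp add: card_gf4 flip: UNIV_Times_UNIV)
  have five: "card {l \<in> set nvecs. dot l p = 0} = 5" if "p \<in> set nvecs" for p
    unfolding card_filter_nvecs using nvecs_five that by (simp add: zero_gf4_def)
  fix p assume p: "p \<in> set nvecs"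
  show "net4 {l \<in> set nvecs. dot l p = 0} UNIV (ff p)"
  proof
    fix l l' a a'
    assume "l \<in> {l \<in> set nvecs. dot l p = 0}" "l' \<in> {l \<in> set nvecs. dot l p = 0}" "l \<noteq> l'"
      "ff p l a = ff p l a'" "ff p l' a = ff p l' a'"
    then show "a = a'" using kernel[OF p, of l l' a a'] by (simp add: ff_def)
  qed (rule five[OF p], rule c16)
next
  have c16: "card (UNIV :: (gf4 \<times> gf4) set) = 16"
    by (simp add: card_gf4 flip: UNIV_Times_UNIV)
  fix l assume l: "l \<in> set nvecs"
  show "net4 {p \<in> set nvecs. dot l p = 0} UNIV (gg l)"
  proof
    show "card {p \<in> set nvecs. dot l p = 0} = 5"
      unfolding dot_commute[of l] card_filter_nvecs using nvecs_five l by (simp add: zero_gf4_def)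
    show "card (UNIV :: (gf4 \<times> gf4) set) = 16" by (rule c16)
    fix p p' b b'
    assume *: "p \<in> {p \<in> set nvecs. dot l p = 0}" "p' \<in> {p \<in> set nvecs. dot l p = 0}" "p \<noteq> p'"
      "gg l p b = gg l p b'" "gg l p' b = gg l p' b'"
    show "b = b'"
    proof (rule kernel)
      show "map3 tau l \<in> set nvecs" "map3 tau p \<in> set nvecs" "map3 tau p' \<in> set nvecs"
        using l * by (simp_all add: tau_nvecs)
      show "map3 tau p \<noteq> map3 tau p'" using * by (simp add: map3_inj)
      show "dot (map3 tau p) (map3 tau l) = 0" "dot (map3 tau p') (map3 tau l) = 0"
        unfolding dot_map3 dot_commute[of p] dot_commute[of p'] using * by simp_all
      show "dot (map3 tau p) (ins (map3 tau l) b) = dot (map3 tau p) (ins (map3 tau l) b')"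
        "dot (map3 tau p') (ins (map3 tau l) b) = dot (map3 tau p') (ins (map3 tau l) b')"
        unfolding ins_map3 dot_commute[of "map3 tau p"] dot_commute[of "map3 tau p'"] using * by (simp_all add: gg_def)
    qed
  qed
next
  fix p q assume pq: "p \<in> set nvecs" "q \<in> set nvecs" "p \<noteq> q"
  obtain l where l: "{l \<in> set nvecs. dot l p = 0 \<and> dot l q = 0} = {l}"
    using join_card[OF pq] card_1_singletonE by blast
  then show "\<exists>l\<in>set nvecs. dot l p = 0 \<and> dot l q = 0" by blast
  fix m m' assume "m \<in> set nvecs" "m' \<in> set nvecs" "dot m p = 0" "dot m q = 0" "dot m' p = 0" "dot m' q = 0"
  then have "m \<in> {l}" "m' \<in> {l}" unfolding l[symmetric] by simp_all
  then show "m = m'" by simp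
qed

end

section \<open>Coordinates for the three rings\<close>

locale coord_ring = gf4_twist tau kap
  for tau :: "gf4 \<Rightarrow> gf4" and kap :: "gf4 \<Rightarrow> gf4 \<Rightarrow> gf4" +
  fixes R :: "('r, 'm) ring_scheme" (structure) and enc :: "gf4 \<Rightarrow> gf4 \<Rightarrow> 'r"
  assumes carrier_enc: "carrier R = {enc a b |a b. True}"
    and enc_inj: "enc a b = enc c d \<longleftrightarrow> a = c \<and> b = d"
    and enc_mult: "enc a b \<otimes> enc c d = enc (a * c) (a * d + b * tau c)"
    and enc_add: "enc a b \<oplus> enc c d = enc (a + c) (b + d + kap a c)"
    and enc_zero: "\<zero> = enc 0 0"
    and enc_one: "\<one> = enc 1 0"
begin

lemma enc_closed [simp]: "enc a b \<in> carrier R"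
  by (auto simp: carrier_enc)

lemma enc_cases:
  assumes "x \<in> carrier R"
  obtains a b where "x = enc a b"
  using assms by (auto simp: carrier_enc)

sublocale ring R
proof (rule ringI)
  show "abelian_group R"
  proof (rule abelian_groupI)
    fix x y z assume "x \<in> carrier R" "y \<in> carrier R" "z \<in> carrier R"
    then obtain a b c d e f where xyz: "x = enc a b" "y = enc c d" "z = enc e f"
      by (metis enc_cases)
    show "x \<oplus> y \<oplus> z = x \<oplus> (y \<oplus> z)"
      using kap_cocycle[of a c e] unfolding xyz enc_add enc_inj by (simp add: algebra_simps)
  next
    fix x y assume "x \<in> carrier R" "y \<in> carrier R"
    then obtain a b c d where xy: "x = enc a b" "y = enc c d" by (metis enc_cases)
    show "x \<oplus> y \<in> carrier R" by (simp add: xy enc_add)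
    show "x \<oplus> y = y \<oplus> x" unfolding xy enc_add enc_inj by (simp add: add.commute kap_commute)
  next
    fix x assume "x \<in> carrier R"
    then obtain a b where x: "x = enc a b" by (metis enc_cases)
    show "\<zero> \<oplus> x = x" by (simp add: x enc_zero enc_add kap_zero)
    have "enc a (b + kap a a) \<oplus> x = \<zero>" by (simp add: x enc_zero enc_add enc_inj add.assoc add.left_commute)
    then show "\<exists>y\<in>carrier R. y \<oplus> x = \<zero>" by (rule bexI) simp
  qed (simp add: enc_zero)
  show "monoid R"
  proof (rule monoidI)
    fix x y z assume "x \<in> carrier R" "y \<in> carrier R" "z \<in> carrier R"
    then obtain a b c d e f where xyz: "x = enc a b" "y = enc c d" "z = enc e f"
      by (metis enc_cases)
    show "x \<otimes> y \<otimes> z = x \<otimes> (y \<otimes> z)"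
      unfolding xyz enc_mult enc_inj by (simp add: algebra_simps tau_mult)
  next
    fix x y assume "x \<in> carrier R" "y \<in> carrier R"
    then obtain a b c d where xy: "x = enc a b" "y = enc c d" by (metis enc_cases)
    show "x \<otimes> y \<in> carrier R" by (simp add: xy enc_mult)
  next
    fix x assume "x \<in> carrier R"
    then obtain a b where x: "x = enc a b" by (metis enc_cases)
    show "\<one> \<otimes> x = x" "x \<otimes> \<one> = x" by (simp_all add: x enc_one enc_mult tau_one)
  qed (simp add: enc_one)
next
  fix x y z assume "x \<in> carrier R" "y \<in> carrier R" "z \<in> carrier R"
  then obtain a b c d e f where xyz: "x = enc a b" "y = enc c d" "z = enc e f"
    by (metis enc_cases)
  show "(x \<oplus> y) \<otimes> z = x \<otimes> z \<oplus> y \<otimes> z"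
    using kap_right[of a c e] unfolding xyz enc_add enc_mult enc_inj by (simp add: algebra_simps)
  show "z \<otimes> (x \<oplus> y) = z \<otimes> x \<oplus> z \<otimes> y"
    using kap_left[of e a c] unfolding xyz enc_add enc_mult enc_inj by (simp add: algebra_simps tau_add)
qed

section \<open>Points and lines as right submodules\<close>

lemma vecs3: "v \<in> vecs R 3 \<longleftrightarrow> (\<exists>x y z. v = [x, y, z] \<and> x \<in> carrier R \<and> y \<in> carrier R \<and> z \<in> carrier R)"
  unfolding vecs_def by (auto simp: length_Suc_conv numeral_3_eq_3)

lemma vecs2: "v \<in> vecs R 2 \<longleftrightarrow> (\<exists>x y. v = [x, y] \<and> x \<in> carrier R \<and> y \<in> carrier R)"
  unfolding vecs_def by (auto simp: length_Suc_conv numeral_2_eq_2)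

lemma vecs1: "v \<in> vecs R 1 \<longleftrightarrow> (\<exists>x. v = [x] \<and> x \<in> carrier R)"
  unfolding vecs_def by (auto simp: length_Suc_conv)

text \<open>Coefficients stand on the left so that the solutions are closed under right
  multiplication.\<close>

definition lset :: "'r list \<Rightarrow> 'r list set" where
  "lset u = {v \<in> vecs R 3. u ! 0 \<otimes> v ! 0 \<oplus> u ! 1 \<otimes> v ! 1 \<oplus> u ! 2 \<otimes> v ! 2 = \<zero>}"

definition pset :: "'r list \<Rightarrow> 'r list set" where
  "pset v = {vsmul R v r |r. r \<in> carrier R}"

lemma vzero_eq: "vzero R = [\<zero>, \<zero>, \<zero>]"
  by (simp add: vzero_def numeral_3_eq_3)

lemma in_lset: "[x, y, z] \<in> lset [a, b, c] \<longleftrightarrow> x \<in> carrier R \<and> y \<in> carrier R \<and> z \<in> carrier R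
    \<and> a \<otimes> x \<oplus> b \<otimes> y \<oplus> c \<otimes> z = \<zero>"
  by (auto simp: lset_def vecs3)

lemma lset_cases:
  assumes "v \<in> lset u"
  obtains x y z where "v = [x, y, z]" "x \<in> carrier R" "y \<in> carrier R" "z \<in> carrier R"
  using assms by (auto simp: lset_def vecs3)

lemma right_submodule_lset:
  assumes abc: "a \<in> carrier R" "b \<in> carrier R" "c \<in> carrier R"
  shows "right_submodule R (lset [a, b, c])"
  unfolding right_submodule_def
proof (intro conjI ballI)
  show "lset [a, b, c] \<subseteq> vecs R 3" by (auto simp: lset_def)
  show "vzero R \<in> lset [a, b, c]" using abc by (simp add: vzero_eq in_lset)
next
  fix v w assume v: "v \<in> lset [a, b, c]" and w: "w \<in> lset [a, b, c]"
  from lset_cases[OF v] obtain x y z where v': "v = [x, y, z]" "x \<in> carrier R" "y \<in> carrier R" "z \<in> carrier R" .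
  from lset_cases[OF w] obtain x' y' z' where w': "w = [x', y', z']" "x' \<in> carrier R" "y' \<in> carrier R" "z' \<in> carrier R" .
  have "a \<otimes> (x \<oplus> x') \<oplus> b \<otimes> (y \<oplus> y') \<oplus> c \<otimes> (z \<oplus> z')
      = (a \<otimes> x \<oplus> b \<otimes> y \<oplus> c \<otimes> z) \<oplus> (a \<otimes> x' \<oplus> b \<otimes> y' \<oplus> c \<otimes> z')"
    using v' w' abc by (simp add: r_distr a_ac)
  also have "\<dots> = \<zero>" using v w unfolding v'(1) w'(1) in_lset by simp
  finally show "vadd R v w \<in> lset [a, b, c]" using v' w' by (simp add: vadd_def in_lset)
next
  fix v r assume v: "v \<in> lset [a, b, c]" and r: "r \<in> carrier R"
  from lset_cases[OF v] obtain x y z where v': "v = [x, y, z]" "x \<in> carrier R" "y \<in> carrier R" "z \<in> carrier R" .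
  have "a \<otimes> (x \<otimes> r) \<oplus> b \<otimes> (y \<otimes> r) \<oplus> c \<otimes> (z \<otimes> r) = (a \<otimes> x \<oplus> b \<otimes> y \<oplus> c \<otimes> z) \<otimes> r"
    using v' r abc by (simp add: l_distr m_assoc)
  also have "\<dots> = \<zero>" using v r unfolding v'(1) in_lset by simp
  finally show "vsmul R v r \<in> lset [a, b, c]" using v' r by (simp add: vsmul_def in_lset)
qed

lemma lincomb2:
  "lincomb R [[a, b, c], [a', b', c']] [r, s]
    = [a \<otimes> r \<oplus> (a' \<otimes> s \<oplus> \<zero>), b \<otimes> r \<oplus> (b' \<otimes> s \<oplus> \<zero>), c \<otimes> r \<oplus> (c' \<otimes> s \<oplus> \<zero>)]"
  by (simp add: lincomb_def vadd_def vsmul_def vzero_eq)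

lemma free_lset:
  assumes abc: "a \<in> carrier R" "b \<in> carrier R" "c \<in> carrier R"
    and bs: "b1 \<in> lset [a, b, c]" "b2 \<in> lset [a, b, c]"
    and sol: "\<And>x y z. [x, y, z] \<in> lset [a, b, c] \<Longrightarrow>
      \<exists>r\<in>carrier R. \<exists>s\<in>carrier R. lincomb R [b1, b2] [r, s] = [x, y, z]"
    and inj: "\<And>r s r' s'. \<lbrakk>r \<in> carrier R; s \<in> carrier R; r' \<in> carrier R; s' \<in> carrier R;
      lincomb R [b1, b2] [r, s] = lincomb R [b1, b2] [r', s']\<rbrakk> \<Longrightarrow> r = r' \<and> s = s'"
  shows "lset [a, b, c] \<in> hlines R"
proof -
  have sub: "right_submodule R (lset [a, b, c])" by (rule right_submodule_lset[OF abc])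
  have "bij_betw (lincomb R [b1, b2]) (vecs R 2) (lset [a, b, c])"
    unfolding bij_betw_def
  proof
    show "inj_on (lincomb R [b1, b2]) (vecs R 2)"
    proof (rule inj_onI)
      fix v w assume "v \<in> vecs R 2" "w \<in> vecs R 2" "lincomb R [b1, b2] v = lincomb R [b1, b2] w"
      then show "v = w" using inj unfolding vecs2 by (elim exE conjE) (metis)
    qed
    have "lincomb R [b1, b2] [r, s] \<in> lset [a, b, c]" if "r \<in> carrier R" "s \<in> carrier R" for r s
    proof -
      have "vsmul R b2 s \<in> lset [a, b, c]" "vzero R \<in> lset [a, b, c]" "vsmul R b1 r \<in> lset [a, b, c]"
        using sub bs that unfolding right_submodule_def by blast+
      then have "vadd R (vsmul R b1 r) (vadd R (vsmul R b2 s) (vzero R)) \<in> lset [a, b, c]"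
        using sub unfolding right_submodule_def by blast
      then show ?thesis by (simp add: lincomb_def)
    qed
    then have "lincomb R [b1, b2] ` vecs R 2 \<subseteq> lset [a, b, c]" using vecs2 by auto
    moreover have "lset [a, b, c] \<subseteq> lincomb R [b1, b2] ` vecs R 2"
    proof
      fix v assume v: "v \<in> lset [a, b, c]"
      from lset_cases[OF v] obtain x y z where v': "v = [x, y, z]" .
      obtain r s where "r \<in> carrier R" "s \<in> carrier R" "lincomb R [b1, b2] [r, s] = v"
        using sol[of x y z] v unfolding v' by blast
      then show "v \<in> lincomb R [b1, b2] ` vecs R 2" using vecs2 by (metis image_eqI)
    qed
    ultimately show "lincomb R [b1, b2] ` vecs R 2 = lset [a, b, c]" by blast
  qed
  moreover have "length [b1, b2] = 2" "set [b1, b2] \<subseteq> lset [a, b, c]" using bs by simp_all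
  ultimately show ?thesis using sub unfolding hlines_def free_submodule_def by blast
qed

text \<open>A coefficient 1 allows solving for its variable; the other two variables are free
  coordinates and give the basis.\<close>

lemma lset_line:
  assumes "a \<in> carrier R" "b \<in> carrier R" "c \<in> carrier R" "a = \<one> \<or> b = \<one> \<or> c = \<one>"
  shows "lset [a, b, c] \<in> hlines R"
  using assms(4)
proof (elim disjE)
  assume a: "a = \<one>"
  show ?thesis
  proof (rule free_lset[OF assms(1-3), of "[\<ominus> b, \<one>, \<zero>]" "[\<ominus> c, \<zero>, \<one>]"])
    show "[\<ominus> b, \<one>, \<zero>] \<in> lset [a, b, c]" "[\<ominus> c, \<zero>, \<one>] \<in> lset [a, b, c]"
      using assms a by (simp_all add: in_lset l_neg)
    fix x y z assume v: "[x, y, z] \<in> lset [a, b, c]"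
    then have xyz: "x \<in> carrier R" "y \<in> carrier R" "z \<in> carrier R" "x \<oplus> b \<otimes> y \<oplus> c \<otimes> z = \<zero>"
      using a by (auto simp: in_lset)
    then have "x = \<ominus> (b \<otimes> y \<oplus> c \<otimes> z)" using assms by (intro minus_equality[symmetric]) (simp_all add: a_assoc)
    then show "\<exists>r\<in>carrier R. \<exists>s\<in>carrier R. lincomb R [[\<ominus> b, \<one>, \<zero>], [\<ominus> c, \<zero>, \<one>]] [r, s] = [x, y, z]"
      using xyz assms by (intro bexI[of _ y] bexI[of _ z]) (simp_all add: lincomb2 l_minus minus_add)
  qed (use assms in \<open>simp_all add: lincomb2\<close>)
next
  assume b: "b = \<one>"
  show ?thesis
  proof (rule free_lset[OF assms(1-3), of "[\<one>, \<ominus> a, \<zero>]" "[\<zero>, \<ominus> c, \<one>]"])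
    show "[\<one>, \<ominus> a, \<zero>] \<in> lset [a, b, c]" "[\<zero>, \<ominus> c, \<one>] \<in> lset [a, b, c]"
      using assms b by (simp_all add: in_lset l_neg r_neg)
    fix x y z assume v: "[x, y, z] \<in> lset [a, b, c]"
    then have xyz: "x \<in> carrier R" "y \<in> carrier R" "z \<in> carrier R" "a \<otimes> x \<oplus> y \<oplus> c \<otimes> z = \<zero>"
      using b by (auto simp: in_lset)
    then have "y = \<ominus> (a \<otimes> x \<oplus> c \<otimes> z)" using assms by (intro minus_equality[symmetric]) (simp_all add: a_ac)
    then show "\<exists>r\<in>carrier R. \<exists>s\<in>carrier R. lincomb R [[\<one>, \<ominus> a, \<zero>], [\<zero>, \<ominus> c, \<one>]] [r, s] = [x, y, z]"
      using xyz assms by (intro bexI[of _ x] bexI[of _ z]) (simp_all add: lincomb2 l_minus minus_add)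
  qed (use assms in \<open>simp_all add: lincomb2\<close>)
next
  assume c: "c = \<one>"
  show ?thesis
  proof (rule free_lset[OF assms(1-3), of "[\<one>, \<zero>, \<ominus> a]" "[\<zero>, \<one>, \<ominus> b]"])
    show "[\<one>, \<zero>, \<ominus> a] \<in> lset [a, b, c]" "[\<zero>, \<one>, \<ominus> b] \<in> lset [a, b, c]"
      using assms c by (simp_all add: in_lset r_neg)
    fix x y z assume v: "[x, y, z] \<in> lset [a, b, c]"
    then have xyz: "x \<in> carrier R" "y \<in> carrier R" "z \<in> carrier R" "a \<otimes> x \<oplus> b \<otimes> y \<oplus> z = \<zero>"
      using c by (auto simp: in_lset)
    then have "z = \<ominus> (a \<otimes> x \<oplus> b \<otimes> y)" using assms by (intro minus_equality[symmetric]) (simp_all add: a_ac)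
    then show "\<exists>r\<in>carrier R. \<exists>s\<in>carrier R. lincomb R [[\<one>, \<zero>, \<ominus> a], [\<zero>, \<one>, \<ominus> b]] [r, s] = [x, y, z]"
      using xyz assms by (intro bexI[of _ x] bexI[of _ y]) (simp_all add: lincomb2 l_minus minus_add)
  qed (use assms in \<open>simp_all add: lincomb2\<close>)
qed

fun zip3 :: "vec3 \<Rightarrow> vec3 \<Rightarrow> 'r list" where
  "zip3 (x, y, z) (x', y', z') = [enc x x', enc y y', enc z z']"

text \<open>\<open>ins\<close> leaves 0 as second digit at the pivot, so for a normalised class
  vector the pivot entry is the one of the ring.\<close>

definition hvec :: "vec3 \<times> (gf4 \<times> gf4) \<Rightarrow> 'r list" where
  "hvec x = zip3 (fst x) (ins (fst x) (snd x))"

lemma lset_hvec: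
  assumes "l \<in> set nvecs"
  shows "lset (hvec (l, b)) \<in> hlines R"
proof -
  obtain x y z where l: "l = (x, y, z)" by (cases l)
  obtain s t where b: "b = (s, t)" by (cases b)
  have "x = 1 \<or> x = 0 \<and> y = 1 \<or> x = 0 \<and> y = 0 \<and> z = 1" using assms unfolding l in_nvecs .
  then show ?thesis
    unfolding l b hvec_def
    by (elim disjE conjE) (simp_all add: zero_gf4_def[symmetric] lset_line enc_one)
qed

text \<open>Both digits of the left side of the line equation vanish, the second one as a sum of two
  equal labels. This direction carries the bound 6 from the plane to coordinates.\<close>

lemma incident:
  assumes "dot l p = 0" "ff p l a = gg l p b"
  shows "pset (hvec (p, a)) \<subseteq> lset (hvec (l, b))"
proof -
  obtain p1 p2 p3 where p: "p = (p1, p2, p3)" by (cases p)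
  obtain l1 l2 l3 where l: "l = (l1, l2, l3)" by (cases l)
  obtain a1 a2 a3 where a: "ins p a = (a1, a2, a3)" by (cases "ins p a")
  obtain b1 b2 b3 where b: "ins l b = (b1, b2, b3)" by (cases "ins l b")
  have pv: "hvec (p, a) = [enc p1 a1, enc p2 a2, enc p3 a3]" unfolding hvec_def fst_conv snd_conv a by (simp add: p)
  have lv: "hvec (l, b) = [enc l1 b1, enc l2 b2, enc l3 b3]" unfolding hvec_def fst_conv snd_conv b by (simp add: l)
  have d0: "l1 * p1 + l2 * p2 + l3 * p3 = 0" using assms(1) by (simp add: p l)
  have fg: "l1 * a1 + l2 * a2 + l3 * a3 = b1 * tau p1 + b2 * tau p2 + b3 * tau p3
      + (kap (l1 * p1) (l2 * p2) + kap (l1 * p1 + l2 * p2) (l3 * p3))"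
    using assms(2) unfolding ff_def gg_def a b by (simp add: p l)
  have "enc l1 b1 \<otimes> enc p1 a1 \<oplus> enc l2 b2 \<otimes> enc p2 a2 \<oplus> enc l3 b3 \<otimes> enc p3 a3
      = enc (l1 * p1 + l2 * p2 + l3 * p3) ((l1 * a1 + l2 * a2 + l3 * a3) + (b1 * tau p1 + b2 * tau p2 + b3 * tau p3
      + (kap (l1 * p1) (l2 * p2) + kap (l1 * p1 + l2 * p2) (l3 * p3))))"
    unfolding enc_mult enc_add enc_inj by (simp add: ac_simps)
  also have "\<dots> = \<zero>" unfolding d0 fg by (simp add: enc_zero)
  finally have "hvec (p, a) \<in> lset (hvec (l, b))" unfolding pv lv in_lset by simp
  moreover have "right_submodule R (lset (hvec (l, b)))" unfolding lv by (rule right_submodule_lset) simp_all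
  ultimately show ?thesis unfolding right_submodule_def pset_def by blast
qed

text \<open>The generator of a free module is not annihilated by the radical, so some entry has
  nonzero first digit and is a unit; scaling on the right by its inverse normalises the first such
  entry.\<close>

lemma hpoint_hvec:
  assumes "U \<in> hpoints R"
  obtains x where "fst x \<in> set nvecs" "U = pset (hvec x)"
proof -
  have sub: "right_submodule R U" and ex: "\<exists>bs. length bs = 1 \<and> set bs \<subseteq> U \<and> bij_betw (lincomb R bs) (vecs R 1) U"
    using assms unfolding hpoints_def free_submodule_def by blast+
  from ex obtain bs where bs: "length bs = 1" "set bs \<subseteq> U" "bij_betw (lincomb R bs) (vecs R 1) U" by blast
  obtain v where v: "bs = [v]" using bs(1) by (auto simp: length_Suc_conv)
  have "v \<in> vecs R 3" using bs(2) sub v unfolding right_submodule_def by auto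
  then obtain x1 x2 x3 where x: "v = [x1, x2, x3]" "x1 \<in> carrier R" "x2 \<in> carrier R" "x3 \<in> carrier R"
    unfolding vecs3 by blast
  obtain p1 a1 where e1: "x1 = enc p1 a1" using enc_cases[OF x(2)] .
  obtain p2 a2 where e2: "x2 = enc p2 a2" using enc_cases[OF x(3)] .
  obtain p3 a3 where e3: "x3 = enc p3 a3" using enc_cases[OF x(4)] .
  have lc: "lincomb R bs [c] = vsmul R v c" if "c \<in> carrier R" for c
    using that x by (simp add: v lincomb_def vadd_def vsmul_def vzero_eq)
  have U: "U = pset v"
  proof -
    have "U = lincomb R bs ` vecs R 1" using bs(3) by (simp add: bij_betw_def)
    also have "vecs R 1 = (\<lambda>c. [c]) ` carrier R" using vecs1 by auto
    also have "lincomb R bs ` (\<lambda>c. [c]) ` carrier R = pset v"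
      unfolding pset_def image_image using lc by (auto simp: image_iff)
    finally show ?thesis .
  qed
  have unit: "U = pset (hvec (q, c))"
    if r: "s \<in> carrier R" "t \<in> carrier R" "s \<otimes> t = \<one>" and q: "hvec (q, c) = vsmul R v s" for q c s t
  proof -
    have assoc: "vsmul R (vsmul R v s) r = vsmul R v (s \<otimes> r)" if "r \<in> carrier R" for r
      using that r x by (simp add: vsmul_def m_assoc)
    have cancel: "vsmul R (vsmul R v s) (t \<otimes> r) = vsmul R v r" if "r \<in> carrier R" for r
    proof -
      have "s \<otimes> (t \<otimes> r) = r" using r that by (simp flip: m_assoc)
      then show ?thesis using assoc[of "t \<otimes> r"] that r by simp
    qed
    show ?thesis unfolding U q
    proof (intro equalityI subsetI)
      fix w assume "w \<in> pset v"
      then obtain r where "r \<in> carrier R" "w = vsmul R v r" unfolding pset_def by blast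
      then have "t \<otimes> r \<in> carrier R" "w = vsmul R (vsmul R v s) (t \<otimes> r)" using cancel r by simp_all
      then show "w \<in> pset (vsmul R v s)" unfolding pset_def by blast
    next
      fix w assume "w \<in> pset (vsmul R v s)"
      then obtain r' where "r' \<in> carrier R" "w = vsmul R (vsmul R v s) r'" unfolding pset_def by blast
      then have "s \<otimes> r' \<in> carrier R" "w = vsmul R v (s \<otimes> r')" using assoc r by simp_all
      then show "w \<in> pset v" unfolding pset_def by blast
    qed
  qed
  have nz: "\<not> (p1 = 0 \<and> p2 = 0 \<and> p3 = 0)"
  proof
    assume z: "p1 = 0 \<and> p2 = 0 \<and> p3 = 0"
    \<comment> \<open>With all first digits 0 the nonzero element \<open>enc 0 1\<close> annihilates
      the generator.\<close>
    have "lincomb R bs [enc 0 1] = lincomb R bs [enc 0 0]"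
      using z by (simp add: lc x(1) e1 e2 e3 vsmul_def enc_mult)
    moreover have "[enc 0 1] \<in> vecs R 1" "[enc 0 0] \<in> vecs R 1" unfolding vecs1 by simp_all
    ultimately have "[enc 0 1] = [enc 0 0]" using bs(3) unfolding bij_betw_def inj_on_def by blast
    then show False by (simp add: enc_inj)
  qed
  have inverse: "\<exists>s c d. s = enc c d \<and> c \<noteq> 0 \<and> enc y z \<otimes> s = \<one> \<and> s \<otimes> enc y z = \<one>" if "y \<noteq> 0" for y z
  proof -
    have y: "y * (y * y) = 1" by (rule gf4_cube[OF that])
    have ty: "tau y * (tau y * tau y) = 1" using y tau_one by (metis tau_mult)
    have "y * y \<noteq> 0" using y by auto
    \<comment> \<open>As the cube of \<open>y\<close> is 1, \<open>y * y\<close> is its inverse; the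
      second digit is the usual correction, with its sign absorbed by characteristic 2.\<close>
    moreover have "enc y z \<otimes> enc (y * y) (y * y * z * tau (y * y)) = \<one>"
    proof -
      have "y * (y * y * z * tau (y * y)) + z * tau (y * y) = (y * (y * y)) * (z * tau (y * y)) + z * tau (y * y)"
        by (simp add: ac_simps)
      then show ?thesis by (simp add: enc_mult enc_one enc_inj y)
    qed
    moreover have "enc (y * y) (y * y * z * tau (y * y)) \<otimes> enc y z = \<one>"
    proof -
      have "y * y * z + y * y * z * tau (y * y) * tau y = y * y * z + y * y * z * (tau y * (tau y * tau y))"
        by (simp add: ac_simps tau_mult)
      moreover have "y * y * y = 1" using y by (simp add: ac_simps)
      ultimately show ?thesis by (simp add: enc_mult enc_one enc_inj ty)
    qed
    ultimately show ?thesis by blast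
  qed
  consider "p1 \<noteq> 0" | "p1 = 0" "p2 \<noteq> 0" | "p1 = 0" "p2 = 0" "p3 \<noteq> 0" using nz by blast
  then show thesis
  proof cases
    case 1
    obtain s c d where s: "s = enc c d" "c \<noteq> 0" "x1 \<otimes> s = \<one>" "s \<otimes> x1 = \<one>" using inverse[OF 1, of a1] e1 by blast
    have c1: "x1 \<otimes> s = enc 1 0" using s by (simp add: enc_one)
    let ?q = "(1, p2 * c, p3 * c)" and ?a = "(p2 * d + a2 * tau c, p3 * d + a3 * tau c)"
    have "hvec (?q, ?a) = vsmul R v s"
      using c1 by (simp add: hvec_def x(1) vsmul_def e2 e3 s(1) enc_mult zero_gf4_def[symmetric])
    then have "U = pset (hvec (?q, ?a))" using unit[of s x1] s x by simp
    then show thesis using that[of "(?q, ?a)"] by (simp add: in_nvecs)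
  next
    case 2
    obtain s c d where s: "s = enc c d" "c \<noteq> 0" "x2 \<otimes> s = \<one>" "s \<otimes> x2 = \<one>" using inverse[OF 2(2), of a2] e2 by blast
    have c1: "x2 \<otimes> s = enc 1 0" using s by (simp add: enc_one)
    let ?q = "(0, 1, p3 * c)" and ?a = "(a1 * tau c, p3 * d + a3 * tau c)"
    have "hvec (?q, ?a) = vsmul R v s"
      using c1 2 by (simp add: hvec_def x(1) vsmul_def e1 e3 s(1) enc_mult zero_gf4_def[symmetric])
    then have "U = pset (hvec (?q, ?a))" using unit[of s x2] s x by simp
    then show thesis using that[of "(?q, ?a)"] by (simp add: in_nvecs)
  next
    case 3
    obtain s c d where s: "s = enc c d" "c \<noteq> 0" "x3 \<otimes> s = \<one>" "s \<otimes> x3 = \<one>" using inverse[OF 3(3), of a3] e3 by blast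
    have c1: "x3 \<otimes> s = enc 1 0" using s by (simp add: enc_one)
    let ?q = "(0, 0, 1)" and ?a = "(a1 * tau c, a2 * tau c)"
    have "hvec (?q, ?a) = vsmul R v s"
      using c1 3 by (simp add: hvec_def x(1) vsmul_def e1 e2 s(1) enc_mult zero_gf4_def[symmetric])
    then have "U = pset (hvec (?q, ?a))" using unit[of s x3] s x by simp
    then show thesis using that[of "(?q, ?a)"] by (simp add: in_nvecs)
  qed
qed

lemma arc_coordinates:
  assumes K: "K \<subseteq> hpoints R" "finite K" and arc: "\<And>L. L \<in> hlines R \<Longrightarrow> card {U \<in> K. U \<subseteq> L} \<le> 6"
  obtains K' where "K' \<subseteq> set nvecs \<times> UNIV" "card K' = card K"
    "\<forall>l\<in>set nvecs. \<forall>b. card {x \<in> K'. dot l (fst x) = 0 \<and> ff (fst x) l (snd x) = gg l (fst x) b} \<le> 6"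
proof -
  have "\<forall>U\<in>K. \<exists>x. fst x \<in> set nvecs \<and> U = pset (hvec x)" using hpoint_hvec K by (metis subsetD)
  then obtain rep where rep: "\<And>U. U \<in> K \<Longrightarrow> fst (rep U) \<in> set nvecs \<and> U = pset (hvec (rep U))" by metis
  have inj: "inj_on rep K" by (metis inj_onI rep)
  show thesis
  proof (rule that[of "rep ` K"])
    show "rep ` K \<subseteq> set nvecs \<times> UNIV" by (rule image_subsetI) (simp add: mem_Times_iff rep)
    show "card (rep ` K) = card K" by (rule card_image[OF inj])
    show "\<forall>l\<in>set nvecs. \<forall>b. card {x \<in> rep ` K. dot l (fst x) = 0 \<and> ff (fst x) l (snd x) = gg l (fst x) b} \<le> 6"
    proof (intro ballI allI)
      fix l b assume l: "l \<in> set nvecs"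
    let ?S = "{x \<in> rep ` K. dot l (fst x) = 0 \<and> ff (fst x) l (snd x) = gg l (fst x) b}"
    have "?S \<subseteq> rep ` {U \<in> K. U \<subseteq> lset (hvec (l, b))}"
    proof
      fix x assume x: "x \<in> ?S"
      then obtain U where U: "U \<in> K" "x = rep U" by blast
      have "pset (hvec (fst x, snd x)) \<subseteq> lset (hvec (l, b))" using incident x by blast
      then have "U \<subseteq> lset (hvec (l, b))" using rep[OF U(1)] U(2) by simp
      then show "x \<in> rep ` {U \<in> K. U \<subseteq> lset (hvec (l, b))}" using U by blast
    qed
    then have "card ?S \<le> card (rep ` {U \<in> K. U \<subseteq> lset (hvec (l, b))})" using K(2) by (intro card_mono) simp_all
    also have "\<dots> \<le> card {U \<in> K. U \<subseteq> lset (hvec (l, b))}" using K(2) by (intro card_image_le) simp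
    also have "\<dots> \<le> 6" by (rule arc[OF lset_hvec[OF l]])
    finally show "card ?S \<le> 6" .
    qed
  qed
qed

text \<open>Subsets of arcs are arcs, so arcs can be cut down to exactly 84 or 85 points. Positive
  \<open>m\<close> forces \<open>K\<close> to be finite, since infinite sets have cardinality
  0.\<close>

lemma subarc:
  assumes "proj_arc R k 6 K" "m \<le> k" "0 < m"
  obtains K' where "K' \<subseteq> set nvecs \<times> UNIV" "card K' = m"
    "\<forall>l\<in>set nvecs. \<forall>b. card {x \<in> K'. dot l (fst x) = 0 \<and> ff (fst x) l (snd x) = gg l (fst x) b} \<le> 6"
proof -
  have K: "K \<subseteq> hpoints R" "card K = k" "\<And>L. L \<in> hlines R \<Longrightarrow> card {U \<in> K. U \<subseteq> L} \<le> 6"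
    using assms(1) by (auto simp: proj_arc_def)
  have fin: "finite K" using K(2) assms(2,3) by (intro card_ge_0_finite) simp
  obtain K0 where K0: "K0 \<subseteq> K" "card K0 = m" using obtain_subset_with_card_n[of m K] K(2) assms(2) by blast
  have fin0: "finite K0" using K0(1) fin finite_subset by blast
  have arc0: "card {U \<in> K0. U \<subseteq> L} \<le> 6" if "L \<in> hlines R" for L
  proof -
    have "card {U \<in> K0. U \<subseteq> L} \<le> card {U \<in> K. U \<subseteq> L}" using K0(1) fin by (intro card_mono) auto
    then show ?thesis using K(3)[OF that] by simp
  qed
  have sub: "K0 \<subseteq> hpoints R" using K0(1) K(1) by blast
  show thesis by (rule arc_coordinates[OF sub fin0 arc0]) (assumption, rule that, simp_all add: K0(2))
qed

lemma arc_le_84: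
  assumes "proj_arc R k 6 K"
  shows "k \<le> 84"
proof (rule ccontr)
  assume "\<not> k \<le> 84"
  then have k: "85 \<le> k" "0 < (85::nat)" by auto
  obtain K' where K': "K' \<subseteq> set nvecs \<times> UNIV" "card K' = 85"
    "\<forall>l\<in>set nvecs. \<forall>b. card {x \<in> K'. dot l (fst x) = 0 \<and> ff (fst x) l (snd x) = gg l (fst x) b} \<le> 6"
    using subarc[OF assms k] .
  show False by (rule hjelmslev4.no_arc_85[OF hjelmslev4 K'(1,2)]) (use K'(3) in blast)
qed

text \<open>Without carries the elements \<open>enc a 0\<close> form a subfield with four elements;
  the points and lines with label pair (0, 0) are its projective plane, as \<open>no_section\<close>
  demands.\<close>

lemma arc_less_84:
  assumes "proj_arc R k 6 K" and kap: "\<And>x y. kap x y = 0"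
  shows "k < 84"
proof (rule ccontr)
  assume "\<not> k < 84"
  then have k: "84 \<le> k" "0 < (84::nat)" by auto
  obtain K' where K': "K' \<subseteq> set nvecs \<times> UNIV" "card K' = 84"
    "\<forall>l\<in>set nvecs. \<forall>b. card {x \<in> K'. dot l (fst x) = 0 \<and> ff (fst x) l (snd x) = gg l (fst x) b} \<le> 6"
    using subarc[OF assms(1) k] .
  interpret hjelmslev4_arc "set nvecs" "set nvecs" "\<lambda>p l. dot l p = 0" UNIV UNIV ff gg K'
    by (intro hjelmslev4_arc.intro hjelmslev4 hjelmslev4_arc_axioms.intro) (use K' in auto)
  show False
  proof (rule no_section[of "\<lambda>_. (0, 0)" "\<lambda>_. (0, 0)"])
    fix p l
    show "ff p l (0, 0) = gg l p (0, 0)"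
      by (cases p; cases l) (simp add: ff_def gg_def kap zero_gf4_def[symmetric])
  qed simp_all
qed

text \<open>\<open>Max\<close> is meaningful because the bound makes the set finite and the empty
  arc makes it nonempty.\<close>

lemma max_arc_le:
  assumes "\<And>k K. proj_arc R k 6 K \<Longrightarrow> k \<le> m"
  shows "max_arc R 6 \<le> m"
proof -
  have "{k. \<exists>K. proj_arc R k 6 K} \<subseteq> {..m}" using assms by auto
  then have "finite {k. \<exists>K. proj_arc R k 6 K}" by (rule finite_subset) simp
  moreover have "proj_arc R 0 6 {}" by (simp add: proj_arc_def)
  then have "{k. \<exists>K. proj_arc R k 6 K} \<noteq> {}" by blast
  ultimately show ?thesis unfolding max_arc_def using assms by (subst Max_le_iff) auto
qed

end

section \<open>The three rings in digit coordinates\<close>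

fun gcode :: "gf4 \<Rightarrow> nat" where
  "gcode F0 = 0" | "gcode F1 = 1" | "gcode Fw = 2" | "gcode Fv = 3"

definition frob :: "gf4 \<Rightarrow> gf4" where "frob x = x * x"

lemma frob_add: "frob (x + y) = frob x + frob y"
  by (cases x; cases y) (simp_all add: frob_def gf4_defs)

lemma frob_mult: "frob (x * y) = frob x * frob y"
  by (simp add: frob_def ac_simps)

lemma gcode_add: "f4_add (gcode x) (gcode y) = gcode (x + y)"
  by (cases x; cases y) (simp_all add: f4_add_def gf4_defs)

lemma gcode_mult: "f4_mul (gcode x) (gcode y) = gcode (x * y)"
  by (cases x; cases y) (simp_all add: f4_mul_def gf4_defs)

lemma gcode_frob: "f4_frob (gcode x) = gcode (frob x)"
  by (cases x) (simp_all add: f4_frob_def frob_def gf4_defs)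

lemma gcode_inj: "gcode x = gcode y \<longleftrightarrow> x = y"
  by (cases x; cases y) simp_all

lemma gcode_range: "{0..<4} \<times> {0..<4} = {(gcode a, gcode b) |a b. True}"
proof -
  have r: "range gcode = {0..<4}" by (simp add: UNIV_gf4) auto
  show ?thesis unfolding r[symmetric] by auto
qed

lemma carrier_S4: "carrier S4 = {(gcode a, gcode b) |a b. True}"
  unfolding gcode_range[symmetric] by (simp add: S4_def)

lemma carrier_T4: "carrier T4 = {(gcode a, gcode b) |a b. True}"
  unfolding gcode_range[symmetric] by (simp add: T4_def)

lemma coord_ring_S4: "coord_ring (\<lambda>x. x) (\<lambda>_ _. 0) S4 (\<lambda>a b. (gcode a, gcode b))"
proof
  show "carrier S4 = {(gcode a, gcode b) |a b. True}" by (rule carrier_S4)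
  fix a b c d
  show "mult S4 (gcode a, gcode b) (gcode c, gcode d) = (gcode (a * c), gcode (a * d + b * c))"
    by (simp add: S4_def gcode_mult gcode_add)
  show "add S4 (gcode a, gcode b) (gcode c, gcode d) = (gcode (a + c), gcode (b + d + 0))"
    by (simp add: S4_def gcode_add)
  show "zero S4 = (gcode 0, gcode 0)" "one S4 = (gcode 1, gcode 0)"
    by (simp_all add: S4_def zero_gf4_def one_gf4_def)
qed (simp_all add: gcode_inj)

lemma coord_ring_T4: "coord_ring frob (\<lambda>_ _. 0) T4 (\<lambda>a b. (gcode a, gcode b))"
proof
  show "carrier T4 = {(gcode a, gcode b) |a b. True}" by (rule carrier_T4)
  fix a b c d
  show "mult T4 (gcode a, gcode b) (gcode c, gcode d) = (gcode (a * c), gcode (a * d + b * frob c))"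
    by (simp add: T4_def gcode_mult gcode_add gcode_frob)
  show "add T4 (gcode a, gcode b) (gcode c, gcode d) = (gcode (a + c), gcode (b + d + 0))"
    by (simp add: T4_def gcode_add)
  show "zero T4 = (gcode 0, gcode 0)" "one T4 = (gcode 1, gcode 0)"
    by (simp_all add: T4_def zero_gf4_def one_gf4_def)
  show "frob 1 = 1" by (simp add: frob_def)
qed (simp_all add: gcode_inj frob_add frob_mult)

text \<open>The Teichmueller digits of an element of the Galois ring: x = t(a) + 2 t(b). Products of
  digits are digits, and t(a) + t(c) = t(a + c) + 2 t(sqrt(a c)).\<close>
fun teich :: "gf4 \<Rightarrow> nat \<times> nat" where
  "teich F0 = (0, 0)" | "teich F1 = (1, 0)" | "teich Fw = (0, 1)" | "teich Fv = (3, 3)"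

definition genc :: "gf4 \<Rightarrow> gf4 \<Rightarrow> nat \<times> nat" where
  "genc a b = ((fst (teich a) + 2 * fst (teich b)) mod 4, (snd (teich a) + 2 * snd (teich b)) mod 4)"

lemma genc_inj: "genc a b = genc c d \<longleftrightarrow> a = c \<and> b = d"
  by (cases a; cases b; cases c; cases d) (simp_all add: genc_def)

lemma genc_range: "{0..<4} \<times> {0..<4} = {genc a b |a b. True}"
proof -
  have "{genc a b |a b. True} = range (\<lambda>(a, b). genc a b)"
  proof (intro equalityI subsetI)
    fix z assume "z \<in> {genc a b |a b. True}"
    then obtain a b where "z = (\<lambda>(a, b). genc a b) (a, b)" by auto
    then show "z \<in> range (\<lambda>(a, b). genc a b)" by (rule range_eqI)
  qed auto
  moreover have "inj (\<lambda>(a, b). genc a b)" by (auto simp: inj_def genc_inj)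
  ultimately have "card {genc a b |a b. True} = 16"
    by (simp add: card_image card_gf4 flip: UNIV_Times_UNIV)
  moreover have "{genc a b |a b. True} \<subseteq> {0..<4} \<times> {0..<4}" by (auto simp: genc_def)
  ultimately show ?thesis by (intro card_subset_eq[symmetric]) simp_all
qed

lemma genc_mult: "mult G4 (genc a b) (genc c d) = genc (a * c) (a * d + b * c)"
  by (cases a; cases b; cases c; cases d) (simp_all add: genc_def G4_def gf4_defs)

text \<open>The carry comes from t(a + c) = (t(sqrt a) + t(sqrt c))^2 = t(a) + t(c) + 2 t(sqrt(a c))
  modulo 4; as x^4 = x in the field, the square root is \<open>frob\<close>.\<close>

lemma genc_add: "add G4 (genc a b) (genc c d) = genc (a + c) (b + d + frob (a * c))"
  by (cases a; cases b; cases c; cases d) (simp_all add: genc_def G4_def gf4_defs frob_def)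

lemma coord_ring_G4: "coord_ring (\<lambda>x. x) (\<lambda>x y. frob (x * y)) G4 genc"
proof
  fix x y z :: gf4
  show "frob (x * y) + frob ((x + y) * z) = frob (y * z) + frob (x * (y + z))"
    by (simp add: frob_add algebra_simps)
  show "x * frob (y * z) = frob (x * y * (x * z))"
    by (cases x; cases y; cases z) (simp_all add: frob_def gf4_defs)
  show "frob (y * z) * x = frob (y * x * (z * x))"
    by (cases x; cases y; cases z) (simp_all add: frob_def gf4_defs)
  show "carrier G4 = {genc a b |a b. True}" by (simp add: G4_def genc_range)
  show "zero G4 = genc 0 0" "one G4 = genc 1 0" by (simp_all add: G4_def genc_def gf4_defs)
qed (simp_all add: genc_inj genc_mult genc_add ac_simps, simp add: frob_def)

theorem theorem4p17:
  assumes "R \<in> {G4, S4, T4}"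
  shows "max_arc R 6 \<le> 84 \<and> (R \<noteq> G4 \<longrightarrow> max_arc R 6 < 84)"
proof -
  have "max_arc G4 6 \<le> 84" by (rule coord_ring.max_arc_le[OF coord_ring_G4 coord_ring.arc_le_84[OF coord_ring_G4]])
  moreover have "max_arc S4 6 \<le> 83" by (rule coord_ring.max_arc_le[OF coord_ring_S4]) (use coord_ring.arc_less_84[OF coord_ring_S4] in fastforce)
  moreover have "max_arc T4 6 \<le> 83" by (rule coord_ring.max_arc_le[OF coord_ring_T4]) (use coord_ring.arc_less_84[OF coord_ring_T4] in fastforce)
  ultimately show ?thesis using assms by auto
qed

end
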